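(* Work in $\mathsf{ZF}$. The following are equivalent: (1) for every set $X$, $\aleph(X)=\aleph^*(X)$; (2) there is a cardinal $\kappa$ such that for every set $X$, if $\aleph^*(X)\geq\kappa$ then $\aleph(X)=\aleph^*(X)$; (3) there is a cardinal $\kappa$ such that for every set $X$, if $\aleph(X)\geq\kappa$ then $\aleph(X)=\aleph^*(X)$; (4) $\mathsf{AC}_{\mathsf{WO}}$; (5) for every set $X$, $\aleph(X)$ is a successor cardinal; (6) for every set $X$, $\aleph(X)$ is a regular cardinal.
   Context: For a set $X$, the Hartogs number $\aleph(X)$ is the least ordinal $\alpha$ such that there is no injection $\alpha\to X$, and the Lindenbaum number $\aleph^*(X)$ is the least ordinal $\alpha>0$ such that there is no surjection $X\to\alpha$; both are (well-ordered) cardinals and $\aleph(X)\leq\aleph^*(X)$. $\mathsf{AC}_{\mathsf{WO}}$ is the statement that every well-orderable family of non-empty sets has a choice function. Cardinals are well-ordered (initial ordinal) cardinals.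
   Formalization: Clause (6) is stated only for infinite sets X, since for a finite X with n elements ℵ(X) = n+1 is not a regular cardinal, so (6) read for every set would be false even under AC_WO. *)

theory Defs
  imports Main
begin

text \<open>
  HOL has a choice operator, so a statement of ZF cannot be rendered as a statement about HOL
  types and sets without trivialising it. ``Work in ZF'' is instead rendered as: in every model
  \<open>(M, mem)\<close> of first-order ZF, whose universe is an arbitrary type. Separation and Replacement
  are restricted to first-order formulas with parameters; with arbitrary HOL predicates
  the model would inherit the axiom of choice from HOL. Every set-theoretic notion below is evaluated
  inside the model: its quantifiers range over elements of the model only.
\<close>

datatype fm =
    Mem nat nat
  | Eq nat nat
  | Neg fm
  | Conj fm fm
  | Forall nat fm

primrec sat :: "('a \<Rightarrow> 'a \<Rightarrow> bool) \<Rightarrow> (nat \<Rightarrow> 'a) \<Rightarrow> fm \<Rightarrow> bool" where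
  "sat mem e (Mem i j) \<longleftrightarrow> mem (e i) (e j)"
| "sat mem e (Eq i j) \<longleftrightarrow> e i = e j"
| "sat mem e (Neg \<phi>) \<longleftrightarrow> \<not> sat mem e \<phi>"
| "sat mem e (Conj \<phi> \<psi>) \<longleftrightarrow> sat mem e \<phi> \<and> sat mem e \<psi>"
| "sat mem e (Forall i \<phi>) \<longleftrightarrow> (\<forall>x. sat mem (e(i := x)) \<phi>)"

locale ZF_model =
  fixes mem :: "'a \<Rightarrow> 'a \<Rightarrow> bool" (infix "\<in>\<^sub>m" 50)
  assumes extensionality: "(\<forall>z. z \<in>\<^sub>m x \<longleftrightarrow> z \<in>\<^sub>m y) \<Longrightarrow> x = y"
    and foundation: "\<exists>y. y \<in>\<^sub>m x \<Longrightarrow> \<exists>y. y \<in>\<^sub>m x \<and> \<not> (\<exists>z. z \<in>\<^sub>m x \<and> z \<in>\<^sub>m y)"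
    and pairing: "\<exists>z. \<forall>w. w \<in>\<^sub>m z \<longleftrightarrow> w = x \<or> w = y"
    and union: "\<exists>u. \<forall>z. z \<in>\<^sub>m u \<longleftrightarrow> (\<exists>y. y \<in>\<^sub>m x \<and> z \<in>\<^sub>m y)"
    and power_set: "\<exists>p. \<forall>y. y \<in>\<^sub>m p \<longleftrightarrow> (\<forall>z. z \<in>\<^sub>m y \<longrightarrow> z \<in>\<^sub>m x)"
    and infinity:
      "\<exists>i. (\<exists>z. z \<in>\<^sub>m i \<and> (\<forall>y. \<not> y \<in>\<^sub>m z)) \<and>
           (\<forall>x. x \<in>\<^sub>m i \<longrightarrow> (\<exists>s. s \<in>\<^sub>m i \<and> (\<forall>y. y \<in>\<^sub>m s \<longleftrightarrow> y \<in>\<^sub>m x \<or> y = x)))"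
    and separation:
      "\<exists>b. \<forall>x. x \<in>\<^sub>m b \<longleftrightarrow> x \<in>\<^sub>m a \<and> sat (\<in>\<^sub>m) (e(i := x)) \<phi>"
    and replacement:
      "i \<noteq> j \<Longrightarrow>
       (\<forall>x y z. x \<in>\<^sub>m a \<and> sat (\<in>\<^sub>m) (e(i := x, j := y)) \<phi> \<and> sat (\<in>\<^sub>m) (e(i := x, j := z)) \<phi>
          \<longrightarrow> y = z) \<Longrightarrow>
       \<exists>b. \<forall>y. y \<in>\<^sub>m b \<longleftrightarrow> (\<exists>x. x \<in>\<^sub>m a \<and> sat (\<in>\<^sub>m) (e(i := x, j := y)) \<phi>)"

context
  fixes mem :: "'a \<Rightarrow> 'a \<Rightarrow> bool" (infix "\<in>\<^sub>m" 50)
begin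

definition subset_of :: "'a \<Rightarrow> 'a \<Rightarrow> bool" where
  "subset_of x y \<longleftrightarrow> (\<forall>z. z \<in>\<^sub>m x \<longrightarrow> z \<in>\<^sub>m y)"

definition nonempty :: "'a \<Rightarrow> bool" where
  "nonempty x \<longleftrightarrow> (\<exists>z. z \<in>\<^sub>m x)"

definition is_upair :: "'a \<Rightarrow> 'a \<Rightarrow> 'a \<Rightarrow> bool" where
  "is_upair p x y \<longleftrightarrow> (\<forall>z. z \<in>\<^sub>m p \<longleftrightarrow> z = x \<or> z = y)"

text \<open>Kuratowski pairs \<open>{{x}, {x, y}}\<close>.\<close>

definition is_opair :: "'a \<Rightarrow> 'a \<Rightarrow> 'a \<Rightarrow> bool" where
  "is_opair p x y \<longleftrightarrow> (\<exists>u v. is_upair u x x \<and> is_upair v x y \<and> is_upair p u v)"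

definition related :: "'a \<Rightarrow> 'a \<Rightarrow> 'a \<Rightarrow> bool" where
  "related r x y \<longleftrightarrow> (\<exists>p. p \<in>\<^sub>m r \<and> is_opair p x y)"

definition is_function :: "'a \<Rightarrow> 'a \<Rightarrow> 'a \<Rightarrow> bool" where
  "is_function f A B \<longleftrightarrow>
     (\<forall>p. p \<in>\<^sub>m f \<longrightarrow> (\<exists>x y. x \<in>\<^sub>m A \<and> y \<in>\<^sub>m B \<and> is_opair p x y)) \<and>
     (\<forall>x. x \<in>\<^sub>m A \<longrightarrow> (\<exists>!y. related f x y))"

definition injection :: "'a \<Rightarrow> 'a \<Rightarrow> 'a \<Rightarrow> bool" where
  "injection f A B \<longleftrightarrow>
     is_function f A B \<and> (\<forall>x x' y. related f x y \<and> related f x' y \<longrightarrow> x = x')"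

definition surjection :: "'a \<Rightarrow> 'a \<Rightarrow> 'a \<Rightarrow> bool" where
  "surjection f A B \<longleftrightarrow>
     is_function f A B \<and> (\<forall>y. y \<in>\<^sub>m B \<longrightarrow> (\<exists>x. x \<in>\<^sub>m A \<and> related f x y))"

definition bijection :: "'a \<Rightarrow> 'a \<Rightarrow> 'a \<Rightarrow> bool" where
  "bijection f A B \<longleftrightarrow> injection f A B \<and> surjection f A B"

definition well_orders :: "('a \<Rightarrow> 'a \<Rightarrow> bool) \<Rightarrow> 'a \<Rightarrow> bool" where
  "well_orders R A \<longleftrightarrow>
     (\<forall>x. x \<in>\<^sub>m A \<longrightarrow> \<not> R x x) \<and>
     (\<forall>x y z. x \<in>\<^sub>m A \<and> y \<in>\<^sub>m A \<and> z \<in>\<^sub>m A \<and> R x y \<and> R y z \<longrightarrow> R x z) \<and>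
     (\<forall>x y. x \<in>\<^sub>m A \<and> y \<in>\<^sub>m A \<longrightarrow> R x y \<or> x = y \<or> R y x) \<and>
     (\<forall>S. subset_of S A \<and> nonempty S \<longrightarrow>
        (\<exists>m. m \<in>\<^sub>m S \<and> (\<forall>x. x \<in>\<^sub>m S \<longrightarrow> m = x \<or> R m x)))"

definition well_orderable :: "'a \<Rightarrow> bool" where
  "well_orderable A \<longleftrightarrow> (\<exists>r. well_orders (related r) A)"

definition ordinal :: "'a \<Rightarrow> bool" where
  "ordinal \<alpha> \<longleftrightarrow> (\<forall>x. x \<in>\<^sub>m \<alpha> \<longrightarrow> subset_of x \<alpha>) \<and> well_orders (\<in>\<^sub>m) \<alpha>"

definition ord_le :: "'a \<Rightarrow> 'a \<Rightarrow> bool" where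
  "ord_le \<alpha> \<beta> \<longleftrightarrow> \<alpha> \<in>\<^sub>m \<beta> \<or> \<alpha> = \<beta>"

text \<open>Only used for predicates that ZF proves to hold of some ordinal.\<close>

definition least_ordinal :: "('a \<Rightarrow> bool) \<Rightarrow> 'a" where
  "least_ordinal P = (THE \<alpha>. ordinal \<alpha> \<and> P \<alpha> \<and> (\<forall>\<beta>. ordinal \<beta> \<and> P \<beta> \<longrightarrow> ord_le \<alpha> \<beta>))"

definition hartogs :: "'a \<Rightarrow> 'a" where
  "hartogs X = least_ordinal (\<lambda>\<alpha>. \<not> (\<exists>f. injection f \<alpha> X))"

definition lindenbaum :: "'a \<Rightarrow> 'a" where
  "lindenbaum X = least_ordinal (\<lambda>\<alpha>. nonempty \<alpha> \<and> \<not> (\<exists>f. surjection f X \<alpha>))"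

definition cardinal :: "'a \<Rightarrow> bool" where
  "cardinal \<kappa> \<longleftrightarrow> ordinal \<kappa> \<and> (\<forall>\<beta>. \<beta> \<in>\<^sub>m \<kappa> \<longrightarrow> \<not> (\<exists>f. bijection f \<beta> \<kappa>))"

text \<open>Finite cardinals are cardinals, so every finite \<open>n + 1\<close> counts as the successor of \<open>n\<close>.\<close>

definition successor_cardinal :: "'a \<Rightarrow> bool" where
  "successor_cardinal \<kappa> \<longleftrightarrow>
     (\<exists>\<mu>. cardinal \<mu> \<and> \<kappa> = least_ordinal (\<lambda>\<alpha>. cardinal \<alpha> \<and> \<mu> \<in>\<^sub>m \<alpha>))"

definition natural_number :: "'a \<Rightarrow> bool" where
  "natural_number n \<longleftrightarrow>
     (\<forall>I. (\<forall>z. \<not> nonempty z \<longrightarrow> z \<in>\<^sub>m I) \<and>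
          (\<forall>x s. x \<in>\<^sub>m I \<and> (\<forall>y. y \<in>\<^sub>m s \<longleftrightarrow> y \<in>\<^sub>m x \<or> y = x) \<longrightarrow> s \<in>\<^sub>m I) \<longrightarrow> n \<in>\<^sub>m I)"

definition infinite_set :: "'a \<Rightarrow> bool" where
  "infinite_set X \<longleftrightarrow> \<not> (\<exists>n f. natural_number n \<and> bijection f n X)"

definition cofinality :: "'a \<Rightarrow> 'a" where
  "cofinality \<kappa> = least_ordinal (\<lambda>\<alpha>. \<exists>f. is_function f \<alpha> \<kappa> \<and>
     (\<forall>\<beta>. \<beta> \<in>\<^sub>m \<kappa> \<longrightarrow> (\<exists>x y. related f x y \<and> ord_le \<beta> y)))"

text \<open>
  Regular cardinals are infinite. The Hartogs number of an \<open>n\<close>-element set is \<open>n + 1\<close>, which is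
  therefore never regular, so regularity of Hartogs numbers is only meaningful for infinite sets.
\<close>

definition regular_cardinal :: "'a \<Rightarrow> bool" where
  "regular_cardinal \<kappa> \<longleftrightarrow> cardinal \<kappa> \<and> infinite_set \<kappa> \<and> cofinality \<kappa> = \<kappa>"

definition AC_WO :: bool where
  "AC_WO \<longleftrightarrow>
     (\<forall>F. well_orderable F \<and> (\<forall>x. x \<in>\<^sub>m F \<longrightarrow> nonempty x) \<longrightarrow>
        (\<exists>c B. is_function c F B \<and> (\<forall>x y. x \<in>\<^sub>m F \<and> related c x y \<longrightarrow> y \<in>\<^sub>m x)))"

end

end

theory Submission
  imports Defs
begin

text \<open>
  Choice for well-ordered families turns a surjection \<open>X \<rightarrow> \<alpha>\<close> into an injection \<open>\<alpha> \<rightarrow> X\<close> by choosing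
  from the fibres, and it lets one choose injections into \<open>X\<close> of all ordinals below \<open>\<aleph>(X)\<close> (or of a
  cofinal set of them) simultaneously; the union of their ranges is a well-orderable subset of \<open>X\<close>
  which is too large unless \<open>\<aleph>(X)\<close> is a successor and regular.

  Conversely, let \<open>A\<close> be a family of non-empty sets indexed by the least ordinal \<open>\<lambda>\<close> for which choice
  fails. Let \<open>P\<^sub>\<alpha>\<close> be the set of choice functions for the restriction of \<open>A\<close> to \<open>\<alpha> < \<lambda>\<close>, let
  \<open>\<kappa>\<^sub>\<alpha>\<close> be a strictly increasing \<open>\<lambda>\<close>-sequence of large cardinals with supremum \<open>\<mu>\<close>, and let \<open>X\<close> be the
  disjoint union of the sets \<open>P\<^sub>\<alpha> \<times> \<kappa>\<^sub>\<alpha>\<close>. Then \<open>X\<close> maps onto \<open>\<mu>\<close>, and every ordinal below \<open>\<mu>\<close> injects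
  into \<open>X\<close>. An injection of \<open>\<mu>\<close> itself would meet unboundedly many summands, and so pick out enough
  partial choice functions to choose from all of \<open>A\<close>. Hence \<open>\<aleph>(X) = \<mu>\<close> is a singular limit
  cardinal smaller than \<open>\<aleph>\<^sup>*(X)\<close>, and \<open>\<mu>\<close> can be taken arbitrarily large.
\<close>

section \<open>Definable predicates\<close>

text \<open>HOL comprehension yields no sets of the model: every set that is built needs a
  first-order formula, hence the \<open>definable\<close> layer below. Uniform selections must come
  from unique witnesses, from least ordinals, or from \<open>AC_WO\<close>.

  The largeness of the cardinals serves mainly one step. Let Q be a fixed set holding all pairs of
  an index and a partial choice function. If an injection of the supremum met only summands of index
  at most a, its restriction to kappa_(a+1) would land in Q x kappa_a. This is impossible once
  kappa_a is infinite and at least aleph(Q), although Q need not be well-orderable: mark each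
  argument by its second coordinate and by its position in the fibre of that coordinate. Fibres
  inject into Q, so positions are below aleph(Q), and kappa_(a+1) would inject into kappa_a x
  kappa_a, hence into kappa_a.

  If the indices are unbounded instead, the least argument whose index exceeds i names one partial
  choice function to evaluate at i. Keeping the cardinals above lambda makes the lambda-sequence
  short, hence the supremum singular; keeping them above a given K refutes any threshold in
  (3).\<close>

named_theorems definable_intros

primrec rename :: "(nat \<Rightarrow> nat) \<Rightarrow> fm \<Rightarrow> fm" where
  "rename f (Mem i j) = Mem (f i) (f j)"
| "rename f (Eq i j) = Eq (f i) (f j)"
| "rename f (Neg \<phi>) = Neg (rename f \<phi>)"
| "rename f (Conj \<phi> \<psi>) = Conj (rename f \<phi>) (rename f \<psi>)"
| "rename f (Forall i \<phi>) = Forall (f i) (rename f \<phi>)"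

text \<open>Injectivity prevents capture: the updated slot \<open>f i\<close> is the image of slot
  \<open>i\<close> alone.\<close>

lemma sat_rename:
  assumes "inj f"
  shows "sat mem e (rename f \<phi>) \<longleftrightarrow> sat mem (\<lambda>n. e (f n)) \<phi>"
proof (induction \<phi> arbitrary: e)
  case (Forall i \<phi>)
  have "(\<lambda>n. (e(f i := x)) (f n)) = (\<lambda>n. e (f n))(i := x)" for x
    using assms by (auto simp: fun_eq_iff inj_eq)
  then show ?case using Forall by simp
qed auto

definition ehd :: "(nat \<Rightarrow> 'a) \<Rightarrow> 'a" where
  "ehd e = e 0"

definition etl :: "(nat \<Rightarrow> 'a) \<Rightarrow> nat \<Rightarrow> 'a" where
  "etl e = (\<lambda>n. e (Suc n))"

definition econs :: "'a \<Rightarrow> (nat \<Rightarrow> 'a) \<Rightarrow> nat \<Rightarrow> 'a" where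
  "econs x e = case_nat x e"

lemma ehd_econs [simp]: "ehd (econs x e) = x"
  by (simp add: ehd_def econs_def)

lemma etl_econs [simp]: "etl (econs x e) = e"
  by (simp add: etl_def econs_def)

text \<open>Even slots carry the variables, odd slots the parameters.\<close>

definition mix :: "(nat \<Rightarrow> 'a) \<Rightarrow> (nat \<Rightarrow> 'a) \<Rightarrow> nat \<Rightarrow> 'a" where
  "mix p e n = (if even n then e (n div 2) else p (n div 2))"

context ZF_model
begin

text \<open>
  Bound variables are treated in de Bruijn style: under a quantifier, \<open>ehd\<close> reads the bound variable
  and \<open>etl\<close> recovers the outer environment. Elements of the model occurring in the body are
  parameters.
\<close>

definition definable :: "((nat \<Rightarrow> 'a) \<Rightarrow> bool) \<Rightarrow> bool" where
  "definable Q \<longleftrightarrow> (\<exists>\<phi> p. \<forall>e. Q e \<longleftrightarrow> sat (\<in>\<^sub>m) (mix p e) \<phi>)"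

text \<open>\<open>fm\<close> has no terms, so a term counts as definable through its graph, with
  slot 0 holding the value.\<close>

definition definable_term :: "((nat \<Rightarrow> 'a) \<Rightarrow> 'a) \<Rightarrow> bool" where
  "definable_term t \<longleftrightarrow> definable (\<lambda>e. ehd e = t (etl e))"

lemma definable_not [definable_intros]:
  assumes "definable P" shows "definable (\<lambda>e. \<not> P e)"
proof -
  obtain \<phi> p where "\<And>e. P e \<longleftrightarrow> sat (\<in>\<^sub>m) (mix p e) \<phi>"
    using assms unfolding definable_def by blast
  then show ?thesis unfolding definable_def by (intro exI[of _ "Neg \<phi>"] exI[of _ p]) simp
qed

lemma definable_conj [definable_intros]:
  assumes "definable P" "definable Q" shows "definable (\<lambda>e. P e \<and> Q e)"
proof -
  obtain \<phi> p where P: "\<And>e. P e \<longleftrightarrow> sat (\<in>\<^sub>m) (mix p e) \<phi>"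
    using assms(1) unfolding definable_def by blast
  obtain \<psi> q where Q: "\<And>e. Q e \<longleftrightarrow> sat (\<in>\<^sub>m) (mix q e) \<psi>"
    using assms(2) unfolding definable_def by blast
  \<comment> \<open>The two formulas come with different parameters. Variables stay in the even
    slots, while the parameter slots go to the residues 1 and 3 modulo 4, where
    \<open>mix q p\<close> supplies both sequences.\<close>
  define f where "f n = (if even n then n else 4 * (n div 2) + 1)" for n :: nat
  define g where "g n = (if even n then n else 4 * (n div 2) + 3)" for n :: nat
  have inj: "inj f" "inj g"
    unfolding f_def g_def inj_def by (auto split: if_splits; presburger)+
  have "(\<lambda>n. mix (mix q p) e (f n)) = mix p e" "(\<lambda>n. mix (mix q p) e (g n)) = mix q e" for e
  proof -
    have "(4 * k + 3) div 2 = 2 * k + 1" for k :: nat by presburger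
    then show "(\<lambda>n. mix (mix q p) e (f n)) = mix p e" "(\<lambda>n. mix (mix q p) e (g n)) = mix q e" for e
      unfolding mix_def f_def g_def by (auto simp: fun_eq_iff elim!: oddE)
  qed
  then have "P e \<and> Q e \<longleftrightarrow> sat (\<in>\<^sub>m) (mix (mix q p) e) (Conj (rename f \<phi>) (rename g \<psi>))" for e
    using P Q inj by (simp add: sat_rename)
  then show ?thesis unfolding definable_def by blast
qed

lemma definable_all [definable_intros]:
  assumes "definable (\<lambda>e. P (etl e) (ehd e))" shows "definable (\<lambda>e. \<forall>x. P e x)"
proof -
  obtain \<phi> p where P: "\<And>e. P (etl e) (ehd e) \<longleftrightarrow> sat (\<in>\<^sub>m) (mix p e) \<phi>"
    using assms unfolding definable_def by blast
  \<comment> \<open>The bound variable moves from slot 0 to the freed slot 1; the other variables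
    shift down by one place and the parameters up by one.\<close>
  define f where "f n = (if n = 0 then 1 else if even n then n - 2 else n + 2)" for n :: nat
  have inj: "inj f"
    unfolding f_def by (auto intro!: injI split: if_splits; presburger)
  define q where "q n = p (n - 1)" for n
  have eq: "(\<lambda>n. ((mix q e)(1 := x)) (f n)) = mix p (econs x e)" for e x
    unfolding mix_def f_def q_def econs_def
    by (auto simp: fun_eq_iff split: nat.split elim!: evenE oddE)
  have "P e x \<longleftrightarrow> sat (\<in>\<^sub>m) ((mix q e)(1 := x)) (rename f \<phi>)" for e x
    using P[of "econs x e"] inj eq by (simp add: sat_rename)
  then have "(\<forall>x. P e x) \<longleftrightarrow> sat (\<in>\<^sub>m) (mix q e) (Forall 1 (rename f \<phi>))" for e
    by simp
  then show ?thesis unfolding definable_def by blast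
qed

lemma definable_rename:
  assumes "definable Q" "inj f" shows "definable (\<lambda>e. Q (\<lambda>n. e (f n)))"
proof -
  obtain \<phi> p where Q: "\<And>e. Q e \<longleftrightarrow> sat (\<in>\<^sub>m) (mix p e) \<phi>"
    using assms(1) unfolding definable_def by blast
  define g where "g n = (if even n then 2 * f (n div 2) else n)" for n :: nat
  have inj: "inj g"
  proof (rule injI)
    fix m n assume "g m = g n"
    then show "m = n" using assms(2) unfolding g_def
      by (auto split: if_splits dest!: injD elim!: evenE)
  qed
  have "mix p (\<lambda>n. e (f n)) = (\<lambda>n. mix p e (g n))" for e
    unfolding mix_def g_def by (auto simp: fun_eq_iff)
  then show ?thesis unfolding definable_def
    using Q inj by (intro exI[of _ "rename g \<phi>"] exI[of _ p]) (simp add: sat_rename)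
qed

lemma definable_imp [definable_intros]:
  assumes "definable P" "definable Q" shows "definable (\<lambda>e. P e \<longrightarrow> Q e)"
  using definable_not[OF definable_conj[OF assms(1) definable_not[OF assms(2)]]] by simp

lemma definable_disj [definable_intros]:
  assumes "definable P" "definable Q" shows "definable (\<lambda>e. P e \<or> Q e)"
  using definable_imp[OF definable_not[OF assms(1)] assms(2)] by (simp add: disj_imp)

lemma definable_iff [definable_intros]:
  assumes "definable P" "definable Q" shows "definable (\<lambda>e. P e \<longleftrightarrow> Q e)"
  using definable_conj[OF definable_imp[OF assms] definable_imp[OF assms(2,1)]]
  by (simp add: iff_conv_conj_imp)

lemma definable_ex [definable_intros]:
  assumes "definable (\<lambda>e. P (etl e) (ehd e))" shows "definable (\<lambda>e. \<exists>x. P e x)"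
  using definable_not[OF definable_all[OF definable_not[OF assms]]] by simp

lemma definable_term_const [definable_intros]: "definable_term (\<lambda>e. a)"
  unfolding definable_term_def definable_def
  by (intro exI[of _ "Eq 0 1"] exI[of _ "\<lambda>_. a"]) (simp add: mix_def ehd_def)

lemma definable_term_ehd [definable_intros]: "definable_term (\<lambda>e. ehd e)"
  unfolding definable_term_def definable_def
  by (intro exI[of _ "Eq 0 2"] exI[of _ undefined]) (simp add: mix_def ehd_def etl_def)

text \<open>Weakening under one more quantifier: slot 0 still holds the value, and the older
  variables are read one place further on, past the new one.\<close>

lemma definable_term_etl:
  assumes "definable_term t" shows "definable_term (\<lambda>e. t (etl e))"
proof -
  define f where "f n = (if n = 0 then 0 else Suc n)" for n
  have "inj f" unfolding f_def by (auto intro!: injI split: if_splits)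
  from definable_rename[OF assms[unfolded definable_term_def] this] show ?thesis
    unfolding definable_term_def by (simp add: ehd_def etl_def f_def)
qed

text \<open>Weakening past zero to five further quantifiers, as separate rules, so that
  \<open>intro\<close> can try each depth on an abstract term.\<close>

lemmas lift =
  asm_rl
  definable_term_etl
  definable_term_etl[THEN definable_term_etl]
  definable_term_etl[THEN definable_term_etl, THEN definable_term_etl]
  definable_term_etl[THEN definable_term_etl, THEN definable_term_etl, THEN definable_term_etl]
  definable_term_etl[THEN definable_term_etl, THEN definable_term_etl, THEN definable_term_etl,
    THEN definable_term_etl]

lemmas definable_term_var [definable_intros] =
  lift(2-)[OF definable_term_ehd]
  lift(6)[THEN definable_term_etl, OF definable_term_ehd]
  lift(6)[THEN definable_term_etl, THEN definable_term_etl, OF definable_term_ehd]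
  lift(6)[THEN definable_term_etl, THEN definable_term_etl, THEN definable_term_etl, OF definable_term_ehd]

text \<open>The term is eliminated through its graph: some \<open>x\<close> is the value of
  \<open>t\<close> at \<open>e\<close> and satisfies \<open>P e x\<close>.\<close>

lemma definable_subst:
  assumes "definable (\<lambda>e. P (etl e) (ehd e))" "definable_term t"
  shows "definable (\<lambda>e. P e (t e))"
  using definable_ex[OF definable_conj[OF assms(2)[unfolded definable_term_def] assms(1)]] by simp

lemma definable_subst2:
  assumes "definable (\<lambda>e. R (ehd (etl e)) (ehd e))" "definable_term t" "definable_term s"
  shows "definable (\<lambda>e. R (t e) (s e))"
proof -
  have "definable (\<lambda>e. R (ehd e) (s (etl e)))"
    by (rule definable_subst[of "\<lambda>e. R (ehd e)" "\<lambda>e. s (etl e)",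
          OF assms(1) definable_term_etl[OF assms(3)]])
  then show ?thesis by (rule definable_subst[of "\<lambda>e x. R x (s e)" t, OF _ assms(2)])
qed

lemma definable_mem [definable_intros]:
  assumes "definable_term t" "definable_term s" shows "definable (\<lambda>e. t e \<in>\<^sub>m s e)"
proof (rule definable_subst2[OF _ assms])
  show "definable (\<lambda>e. ehd (etl e) \<in>\<^sub>m ehd e)"
    unfolding definable_def
    by (intro exI[of _ "Mem 2 0"] exI[of _ undefined]) (simp add: mix_def ehd_def etl_def)
qed

lemma definable_eq [definable_intros]:
  assumes "definable_term t" "definable_term s" shows "definable (\<lambda>e. t e = s e)"
proof (rule definable_subst2[OF _ assms])
  show "definable (\<lambda>e. ehd (etl e) = ehd e)"
    unfolding definable_def
    by (intro exI[of _ "Eq 2 0"] exI[of _ undefined]) (simp add: mix_def ehd_def etl_def)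
qed

lemma definable_ex1 [definable_intros]:
  assumes "definable (\<lambda>e. P (etl e) (ehd e))" shows "definable (\<lambda>e. \<exists>!x. P e x)"
proof -
  define f where "f n = (if n = 0 then 0 else Suc n)" for n
  have "inj f" unfolding f_def by (auto intro!: injI split: if_splits)
  from definable_rename[OF assms this]
  have "definable (\<lambda>e. P (etl (etl e)) (ehd e))"
    by (simp add: ehd_def etl_def f_def)
  then show ?thesis unfolding Ex1_def using assms by (intro definable_intros)
qed

text \<open>Separation with the formula hidden behind \<open>definable\<close>; all variable slots
  other than slot 0 are filled with the dummy \<open>a\<close>.\<close>

lemma Sep:
  assumes "definable (\<lambda>e. P (ehd e))"
  shows "\<exists>b. \<forall>x. x \<in>\<^sub>m b \<longleftrightarrow> x \<in>\<^sub>m a \<and> P x"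
proof -
  obtain \<phi> p where P: "\<And>e. P (ehd e) \<longleftrightarrow> sat (\<in>\<^sub>m) (mix p e) \<phi>"
    using assms unfolding definable_def by blast
  have "(mix p (\<lambda>_. a))(0 := x) = mix p ((\<lambda>_. a)(0 := x))" for x
    by (auto simp: mix_def fun_eq_iff)
  then have "P x \<longleftrightarrow> sat (\<in>\<^sub>m) ((mix p (\<lambda>_. a))(0 := x)) \<phi>" for x
    using P[of "(\<lambda>_. a)(0 := x)"] by (simp add: ehd_def)
  then show ?thesis using separation[of a "mix p (\<lambda>_. a)" 0 \<phi>] by simp
qed

lemma Repl:
  assumes "definable (\<lambda>e. R (ehd (etl e)) (ehd e))"
    and "\<And>x y z. x \<in>\<^sub>m a \<Longrightarrow> R x y \<Longrightarrow> R x z \<Longrightarrow> y = z"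
  shows "\<exists>b. \<forall>y. y \<in>\<^sub>m b \<longleftrightarrow> (\<exists>x. x \<in>\<^sub>m a \<and> R x y)"
proof -
  obtain \<phi> p where P: "\<And>e. R (ehd (etl e)) (ehd e) \<longleftrightarrow> sat (\<in>\<^sub>m) (mix p e) \<phi>"
    using assms(1) unfolding definable_def by blast
  \<comment> \<open>The argument is variable 1 and the value variable 0, which \<open>mix\<close>
    places in the slots 2 and 0.\<close>
  have "(mix p (\<lambda>_. a))(2 := x, 0 := y) = mix p ((\<lambda>_. a)(1 := x, 0 := y))" for x y
    by (auto simp: mix_def fun_eq_iff elim!: evenE)
  then have *: "R x y \<longleftrightarrow> sat (\<in>\<^sub>m) ((mix p (\<lambda>_. a))(2 := x, 0 := y)) \<phi>" for x y
    using P[of "(\<lambda>_. a)(1 := x, 0 := y)"] by (simp add: ehd_def etl_def)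
  show ?thesis
    using replacement[of 2 0 a "mix p (\<lambda>_. a)" \<phi>] assms(2) by (simp add: *[symmetric]) blast
qed

section \<open>Pairs and functions\<close>


lemma ext_eq: "(\<And>z. z \<in>\<^sub>m x \<longleftrightarrow> z \<in>\<^sub>m y) \<Longrightarrow> x = y"
  by (rule extensionality) simp

definition emp :: 'a where
  "emp = (THE z. \<forall>x. \<not> x \<in>\<^sub>m z)"

lemma not_mem_emp [simp]: "\<not> x \<in>\<^sub>m emp"
proof -
  obtain b where b: "\<forall>x. \<not> x \<in>\<^sub>m b" using infinity by blast
  have "emp = b" unfolding emp_def
    by (rule the_equality) (use b in \<open>auto intro: ext_eq\<close>)
  then show ?thesis using b by simp
qed

lemma eq_emp_iff: "z = emp \<longleftrightarrow> (\<forall>x. \<not> x \<in>\<^sub>m z)"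
  by (auto intro: ext_eq)

definition upr :: "'a \<Rightarrow> 'a \<Rightarrow> 'a" where
  "upr x y = (THE z. \<forall>w. w \<in>\<^sub>m z \<longleftrightarrow> w = x \<or> w = y)"

lemma mem_upr [simp]: "w \<in>\<^sub>m upr x y \<longleftrightarrow> w = x \<or> w = y"
proof -
  obtain b where b: "\<forall>w. w \<in>\<^sub>m b \<longleftrightarrow> w = x \<or> w = y" using pairing by blast
  have "upr x y = b" unfolding upr_def
    by (rule the_equality) (use b in \<open>auto intro: ext_eq\<close>)
  then show ?thesis using b by simp
qed

lemma is_upair_iff: "is_upair (\<in>\<^sub>m) p x y \<longleftrightarrow> p = upr x y"
  unfolding is_upair_def by (auto intro: ext_eq)

lemma upr_eq_iff: "upr x y = upr z w \<longleftrightarrow> x = z \<and> y = w \<or> x = w \<and> y = z"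
proof
  assume eq: "upr x y = upr z w"
  have "v = x \<or> v = y \<longleftrightarrow> v = z \<or> v = w" for v
    using mem_upr[of v x y] mem_upr[of v z w] eq by simp
  then show "x = z \<and> y = w \<or> x = w \<and> y = z" by metis
next
  assume "x = z \<and> y = w \<or> x = w \<and> y = z"
  then show "upr x y = upr z w" by (auto intro: ext_eq)
qed

definition pr :: "'a \<Rightarrow> 'a \<Rightarrow> 'a" where
  "pr x y = upr (upr x x) (upr x y)"

lemma is_opair_iff: "is_opair (\<in>\<^sub>m) p x y \<longleftrightarrow> p = pr x y"
  unfolding is_opair_def is_upair_iff pr_def by auto

lemma pr_eq_iff [simp]: "pr x y = pr z w \<longleftrightarrow> x = z \<and> y = w"
  unfolding pr_def upr_eq_iff by auto

lemma related_iff: "related (\<in>\<^sub>m) r x y \<longleftrightarrow> pr x y \<in>\<^sub>m r"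
  unfolding related_def is_opair_iff by auto

lemma definable_term_upr [definable_intros]:
  assumes "definable_term t" "definable_term s"
  shows "definable_term (\<lambda>e. upr (t e) (s e))"
proof -
  have "z = upr x y \<longleftrightarrow> (\<forall>w. w \<in>\<^sub>m z \<longleftrightarrow> w = x \<or> w = y)" for x y z
    by (auto intro: ext_eq)
  then show ?thesis unfolding definable_term_def
    by (simp only:) (intro definable_intros lift[OF assms(1)] lift[OF assms(2)])
qed

lemma definable_term_pr [definable_intros]:
  assumes "definable_term t" "definable_term s"
  shows "definable_term (\<lambda>e. pr (t e) (s e))"
  unfolding pr_def by (intro definable_intros lift[OF assms(1)] lift[OF assms(2)])

text \<open>Outside pairs the value is pinned to \<open>emp\<close>, so that the graph is definable
  and the projection total.\<close>

definition pfst :: "'a \<Rightarrow> 'a" where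
  "pfst p = (if \<exists>x y. p = pr x y then THE x. \<exists>y. p = pr x y else emp)"

definition psnd :: "'a \<Rightarrow> 'a" where
  "psnd p = (if \<exists>x y. p = pr x y then THE y. \<exists>x. p = pr x y else emp)"

lemma pfst_pr [simp]: "pfst (pr x y) = x"
  unfolding pfst_def by auto

lemma psnd_pr [simp]: "psnd (pr x y) = y"
  unfolding psnd_def by auto

lemma definable_term_pfst [definable_intros]:
  assumes "definable_term t" shows "definable_term (\<lambda>e. pfst (t e))"
proof -
  have "z = pfst p \<longleftrightarrow> (\<exists>y. p = pr z y) \<or> \<not> (\<exists>x y. p = pr x y) \<and> z = emp" for z p
    unfolding pfst_def by auto
  then show ?thesis unfolding definable_term_def
    by (simp only:) (intro definable_intros lift[OF assms(1)])
qed

lemma definable_term_psnd [definable_intros]: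
  assumes "definable_term t" shows "definable_term (\<lambda>e. psnd (t e))"
proof -
  have "z = psnd p \<longleftrightarrow> (\<exists>x. p = pr x z) \<or> \<not> (\<exists>x y. p = pr x y) \<and> z = emp" for z p
    unfolding psnd_def by auto
  then show ?thesis unfolding definable_term_def
    by (simp only:) (intro definable_intros lift[OF assms(1)])
qed

text \<open>The value is \<open>emp\<close> at arguments where \<open>f\<close> is not single-valued, which keeps \<open>app\<close> definable.\<close>

definition app :: "'a \<Rightarrow> 'a \<Rightarrow> 'a" where
  "app f x = (if \<exists>!y. pr x y \<in>\<^sub>m f then THE y. pr x y \<in>\<^sub>m f else emp)"

lemma app_eqI:
  assumes "pr x y \<in>\<^sub>m f" "\<And>z. pr x z \<in>\<^sub>m f \<Longrightarrow> z = y" shows "app f x = y"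
proof -
  have "\<exists>!z. pr x z \<in>\<^sub>m f" using assms by (rule ex1I)
  moreover have "(THE z. pr x z \<in>\<^sub>m f) = y" using assms by (rule the_equality)
  ultimately show ?thesis unfolding app_def by simp
qed

lemma definable_term_app [definable_intros]:
  assumes "definable_term t" "definable_term s"
  shows "definable_term (\<lambda>e. app (t e) (s e))"
proof -
  have "z = app f x \<longleftrightarrow>
      pr x z \<in>\<^sub>m f \<and> (\<forall>y. pr x y \<in>\<^sub>m f \<longrightarrow> y = z) \<or> \<not> (\<exists>!y. pr x y \<in>\<^sub>m f) \<and> z = emp" for z f x
  proof (cases "\<exists>!y. pr x y \<in>\<^sub>m f")
    case True
    then obtain y where y: "pr x y \<in>\<^sub>m f" "\<And>w. pr x w \<in>\<^sub>m f \<Longrightarrow> w = y" by blast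
    then have "app f x = y" by (rule app_eqI)
    then show ?thesis using y True by metis
  next
    case False
    then show ?thesis unfolding app_def by auto
  qed
  then show ?thesis unfolding definable_term_def
    by (simp only:) (intro definable_intros lift[OF assms(1)] lift[OF assms(2)])
qed

text \<open>Replacement applied to the pairs themselves gives the graph of \<open>R\<close> on
  \<open>A\<close> as a set, with no codomain fixed in advance.\<close>

lemma fun_ex_rel:
  assumes R: "definable (\<lambda>e. R (ehd (etl e)) (ehd e))"
    and ex: "\<And>x. x \<in>\<^sub>m A \<Longrightarrow> \<exists>!y. R x y"
  shows "\<exists>g. (\<forall>p. p \<in>\<^sub>m g \<longleftrightarrow> (\<exists>x y. x \<in>\<^sub>m A \<and> R x y \<and> p = pr x y)) \<and> (\<forall>x. x \<in>\<^sub>m A \<longrightarrow> R x (app g x))"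
proof -
  have d: "definable (\<lambda>e. \<exists>y. R (ehd (etl e)) y \<and> ehd e = pr (ehd (etl e)) y)"
    by (intro definable_intros definable_subst2[OF R])
  have "\<exists>g. \<forall>p. p \<in>\<^sub>m g \<longleftrightarrow> (\<exists>x. x \<in>\<^sub>m A \<and> (\<exists>y. R x y \<and> p = pr x y))"
    by (rule Repl[OF d]) (use ex in blast)
  then obtain g where g: "\<forall>p. p \<in>\<^sub>m g \<longleftrightarrow> (\<exists>x. x \<in>\<^sub>m A \<and> (\<exists>y. R x y \<and> p = pr x y))" by blast
  have "R x (app g x)" if x: "x \<in>\<^sub>m A" for x
  proof -
    obtain y where y: "R x y" "\<And>z. R x z \<Longrightarrow> z = y" using ex[OF x] by blast
    have "pr x z \<in>\<^sub>m g \<longleftrightarrow> R x z" for z using g x by auto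
    then have "app g x = y" using y by (intro app_eqI) blast+
    then show ?thesis using y(1) by simp
  qed
  then show ?thesis using g by blast
qed

lemma fun_ex:
  assumes "definable (\<lambda>e. R (ehd (etl e)) (ehd e))"
    and "\<And>x. x \<in>\<^sub>m A \<Longrightarrow> \<exists>!y. R x y"
  shows "\<exists>g. \<forall>x. x \<in>\<^sub>m A \<longrightarrow> R x (app g x)"
  using fun_ex_rel[OF assms] by blast

lemma fun_ex_term:
  assumes "definable_term (\<lambda>e. H (ehd e))"
  shows "\<exists>g. \<forall>x. x \<in>\<^sub>m A \<longrightarrow> app g x = H x"
proof -
  have "definable (\<lambda>e. ehd e = H (ehd (etl e)))"
    using assms unfolding definable_term_def .
  from fun_ex[OF this] show ?thesis by blast
qed

lemma image_ex:
  "\<exists>B. \<forall>y. y \<in>\<^sub>m B \<longleftrightarrow> (\<exists>x. x \<in>\<^sub>m A \<and> y = app g x)"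
  by (rule Repl) (intro definable_intros | simp)+

section \<open>Function graphs, injections, surjections and bijections expressed through
  \<open>app\<close>\<close>

lemma is_function_app:
  assumes "is_function (\<in>\<^sub>m) f A B" "x \<in>\<^sub>m A"
  shows "app f x \<in>\<^sub>m B" "related (\<in>\<^sub>m) f x y \<longleftrightarrow> y = app f x"
proof -
  have u: "\<exists>!y. pr x y \<in>\<^sub>m f" using assms unfolding is_function_def related_iff by blast
  then have "pr x (app f x) \<in>\<^sub>m f" unfolding app_def using theI'[OF u] by simp
  then show "app f x \<in>\<^sub>m B" "related (\<in>\<^sub>m) f x y \<longleftrightarrow> y = app f x"
    using assms u unfolding is_function_def related_iff is_opair_iff by (fastforce, blast)
qed

lemma related_domain:
  "is_function (\<in>\<^sub>m) f A B \<Longrightarrow> related (\<in>\<^sub>m) f x y \<Longrightarrow> x \<in>\<^sub>m A"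
  unfolding is_function_def related_iff is_opair_iff by fastforce

text \<open>A set \<open>g\<close> used through \<open>app\<close> may contain stray pairs; trimming
  it to \<open>A\<close> yields a graph that meets \<open>is_function\<close>.\<close>

lemma is_function_of_app:
  assumes "\<And>x. x \<in>\<^sub>m A \<Longrightarrow> app g x \<in>\<^sub>m B"
  obtains f where "is_function (\<in>\<^sub>m) f A B"
    "\<And>x y. related (\<in>\<^sub>m) f x y \<longleftrightarrow> x \<in>\<^sub>m A \<and> y = app g x"
    "\<And>x. x \<in>\<^sub>m A \<Longrightarrow> app f x = app g x"
proof -
  have d: "definable (\<lambda>e. ehd e = app g (ehd (etl e)))" by (intro definable_intros)
  obtain f where f: "\<And>p. p \<in>\<^sub>m f \<longleftrightarrow> (\<exists>x y. x \<in>\<^sub>m A \<and> y = app g x \<and> p = pr x y)"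
      "\<And>x. x \<in>\<^sub>m A \<Longrightarrow> app f x = app g x"
    using fun_ex_rel[OF d, of A] by auto
  show ?thesis
  proof (rule that[of f])
    show "is_function (\<in>\<^sub>m) f A B" unfolding is_function_def related_iff is_opair_iff
      using f(1) assms by auto
  qed (use f in \<open>auto simp: related_iff\<close>)
qed

text \<open>Built on \<open>app\<close> because that is total and definable: \<open>g\<close> may be
  any set, even one with pairs outside \<open>A\<close>, so restrictions require no
  trimming.\<close>

definition injects :: "'a \<Rightarrow> 'a \<Rightarrow> bool" where
  "injects A B \<longleftrightarrow> (\<exists>g. (\<forall>x. x \<in>\<^sub>m A \<longrightarrow> app g x \<in>\<^sub>m B) \<and>
     (\<forall>x y. x \<in>\<^sub>m A \<and> y \<in>\<^sub>m A \<and> app g x = app g y \<longrightarrow> x = y))"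

lemma injectsE:
  assumes "injects A B"
  obtains g where "\<And>x. x \<in>\<^sub>m A \<Longrightarrow> app g x \<in>\<^sub>m B"
    "\<And>x y. x \<in>\<^sub>m A \<Longrightarrow> y \<in>\<^sub>m A \<Longrightarrow> app g x = app g y \<Longrightarrow> x = y"
proof -
  from assms[unfolded injects_def]
  obtain g where "(\<forall>x. x \<in>\<^sub>m A \<longrightarrow> app g x \<in>\<^sub>m B) \<and>
     (\<forall>x y. x \<in>\<^sub>m A \<and> y \<in>\<^sub>m A \<and> app g x = app g y \<longrightarrow> x = y)" ..
  then show ?thesis by (intro that[of g]) blast+
qed

lemma injectsI:
  assumes "\<And>x. x \<in>\<^sub>m A \<Longrightarrow> app g x \<in>\<^sub>m B"
    "\<And>x y. x \<in>\<^sub>m A \<Longrightarrow> y \<in>\<^sub>m A \<Longrightarrow> app g x = app g y \<Longrightarrow> x = y"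
  shows "injects A B"
  unfolding injects_def
proof (intro exI[of _ g] conjI allI impI)
  show "x = y" if "x \<in>\<^sub>m A \<and> y \<in>\<^sub>m A \<and> app g x = app g y" for x y
    using that assms(2)[of x y] by simp
qed (rule assms(1))

lemma definable_injects [definable_intros]:
  assumes "definable_term t" "definable_term s" shows "definable (\<lambda>e. injects (t e) (s e))"
  unfolding injects_def by (intro definable_intros lift[OF assms(1)] lift[OF assms(2)])

lemma injection_iff_app:
  assumes "is_function (\<in>\<^sub>m) f A B"
  shows "injection (\<in>\<^sub>m) f A B \<longleftrightarrow>
    (\<forall>x y. x \<in>\<^sub>m A \<and> y \<in>\<^sub>m A \<and> app f x = app f y \<longrightarrow> x = y)"
proof -
  have "related (\<in>\<^sub>m) f x y \<longleftrightarrow> x \<in>\<^sub>m A \<and> y = app f x" for x y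
    using is_function_app(2)[OF assms] related_domain[OF assms] by blast
  then show ?thesis unfolding injection_def using assms by auto
qed

lemma surjection_iff_app:
  assumes "is_function (\<in>\<^sub>m) f A B"
  shows "surjection (\<in>\<^sub>m) f A B \<longleftrightarrow> (\<forall>y. y \<in>\<^sub>m B \<longrightarrow> (\<exists>x. x \<in>\<^sub>m A \<and> app f x = y))"
proof -
  have "related (\<in>\<^sub>m) f x y \<longleftrightarrow> x \<in>\<^sub>m A \<and> y = app f x" for x y
    using is_function_app(2)[OF assms] related_domain[OF assms] by blast
  then show ?thesis unfolding surjection_def using assms by auto
qed

lemma injects_iff_injection: "(\<exists>f. injection (\<in>\<^sub>m) f A B) \<longleftrightarrow> injects A B"
proof
  assume "\<exists>f. injection (\<in>\<^sub>m) f A B"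
  then obtain f where f: "injection (\<in>\<^sub>m) f A B" by blast
  then have fn: "is_function (\<in>\<^sub>m) f A B" unfolding injection_def by blast
  show "injects A B" unfolding injects_def
    using f[unfolded injection_iff_app[OF fn]] is_function_app(1)[OF fn] by (intro exI[of _ f]) simp
next
  assume "injects A B"
  then obtain g where g: "\<And>x. x \<in>\<^sub>m A \<Longrightarrow> app g x \<in>\<^sub>m B"
    "\<forall>x y. x \<in>\<^sub>m A \<and> y \<in>\<^sub>m A \<and> app g x = app g y \<longrightarrow> x = y" unfolding injects_def by auto
  obtain f where f: "is_function (\<in>\<^sub>m) f A B" "\<And>x. x \<in>\<^sub>m A \<Longrightarrow> app f x = app g x"
    using is_function_of_app[OF g(1)] by metis
  then have "injection (\<in>\<^sub>m) f A B" unfolding injection_iff_app[OF f(1)] using g(2) f(2) by metis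
  then show "\<exists>f. injection (\<in>\<^sub>m) f A B" ..
qed

lemma surjection_iff: "(\<exists>f. surjection (\<in>\<^sub>m) f A B) \<longleftrightarrow>
   (\<exists>g. (\<forall>x. x \<in>\<^sub>m A \<longrightarrow> app g x \<in>\<^sub>m B) \<and> (\<forall>y. y \<in>\<^sub>m B \<longrightarrow> (\<exists>x. x \<in>\<^sub>m A \<and> app g x = y)))"
  (is "?L \<longleftrightarrow> ?R")
proof
  assume ?L
  then obtain f where f: "surjection (\<in>\<^sub>m) f A B" by blast
  then have fn: "is_function (\<in>\<^sub>m) f A B" unfolding surjection_def by blast
  show ?R
    using f[unfolded surjection_iff_app[OF fn]] is_function_app(1)[OF fn] by (intro exI[of _ f]) simp
next
  assume ?R
  then obtain g where g: "\<And>x. x \<in>\<^sub>m A \<Longrightarrow> app g x \<in>\<^sub>m B"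
    "\<forall>y. y \<in>\<^sub>m B \<longrightarrow> (\<exists>x. x \<in>\<^sub>m A \<and> app g x = y)" by auto
  obtain f where f: "is_function (\<in>\<^sub>m) f A B" "\<And>x. x \<in>\<^sub>m A \<Longrightarrow> app f x = app g x"
    using is_function_of_app[OF g(1)] by metis
  then have "surjection (\<in>\<^sub>m) f A B" unfolding surjection_iff_app[OF f(1)] using g(2) f(2) by metis
  then show ?L ..
qed

lemma bijection_iff: "(\<exists>f. bijection (\<in>\<^sub>m) f A B) \<longleftrightarrow>
   (\<exists>g. (\<forall>x. x \<in>\<^sub>m A \<longrightarrow> app g x \<in>\<^sub>m B) \<and> (\<forall>x y. x \<in>\<^sub>m A \<and> y \<in>\<^sub>m A \<and> app g x = app g y \<longrightarrow> x = y) \<and>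
        (\<forall>y. y \<in>\<^sub>m B \<longrightarrow> (\<exists>x. x \<in>\<^sub>m A \<and> app g x = y)))" (is "?L \<longleftrightarrow> ?R")
proof
  assume ?L
  then obtain f where f: "injection (\<in>\<^sub>m) f A B" "surjection (\<in>\<^sub>m) f A B"
    unfolding bijection_def by blast
  then have fn: "is_function (\<in>\<^sub>m) f A B" unfolding surjection_def by blast
  show ?R
    using f(1)[unfolded injection_iff_app[OF fn]] f(2)[unfolded surjection_iff_app[OF fn]]
      is_function_app(1)[OF fn] by (intro exI[of _ f]) simp
next
  assume ?R
  then obtain g where g: "\<And>x. x \<in>\<^sub>m A \<Longrightarrow> app g x \<in>\<^sub>m B"
    "\<forall>x y. x \<in>\<^sub>m A \<and> y \<in>\<^sub>m A \<and> app g x = app g y \<longrightarrow> x = y"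
    "\<forall>y. y \<in>\<^sub>m B \<longrightarrow> (\<exists>x. x \<in>\<^sub>m A \<and> app g x = y)" by auto
  obtain f where f: "is_function (\<in>\<^sub>m) f A B" "\<And>x. x \<in>\<^sub>m A \<Longrightarrow> app f x = app g x"
    using is_function_of_app[OF g(1)] by metis
  then have "injection (\<in>\<^sub>m) f A B" unfolding injection_iff_app[OF f(1)] using g(2) f(2) by metis
  moreover have "surjection (\<in>\<^sub>m) f A B"
    unfolding surjection_iff_app[OF f(1)] using g(3) f(2) by metis
  ultimately show ?L unfolding bijection_def by blast
qed

lemma injects_refl: "injects A A"
proof -
  have "definable_term (\<lambda>e. ehd e)" by (intro definable_intros)
  from fun_ex_term[OF this] show ?thesis unfolding injects_def by metis
qed

lemma injects_trans:
  assumes "injects A B" "injects B C" shows "injects A C"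
proof -
  obtain f where f: "\<And>x. x \<in>\<^sub>m A \<Longrightarrow> app f x \<in>\<^sub>m B"
     "\<And>x y. x \<in>\<^sub>m A \<Longrightarrow> y \<in>\<^sub>m A \<Longrightarrow> app f x = app f y \<Longrightarrow> x = y" using injectsE[OF assms(1)] by metis
  obtain g where g: "\<And>x. x \<in>\<^sub>m B \<Longrightarrow> app g x \<in>\<^sub>m C"
     "\<And>x y. x \<in>\<^sub>m B \<Longrightarrow> y \<in>\<^sub>m B \<Longrightarrow> app g x = app g y \<Longrightarrow> x = y" using injectsE[OF assms(2)] by metis
  have "definable_term (\<lambda>e. app g (app f (ehd e)))" by (intro definable_intros)
  from fun_ex_term[OF this, of A] obtain h where "\<forall>x. x \<in>\<^sub>m A \<longrightarrow> app h x = app g (app f x)" by blast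
  then show ?thesis using f g by (intro injectsI[of A h]) simp_all
qed

lemma injects_subset:
  assumes "\<And>x. x \<in>\<^sub>m A \<Longrightarrow> x \<in>\<^sub>m B" shows "injects A B"
  by (rule injectsE[OF injects_refl[of B]], rule injectsI) (use assms in blast)+

lemma injects_term:
  assumes "definable_term (\<lambda>e. H (ehd e))"
    "\<And>x. x \<in>\<^sub>m A \<Longrightarrow> H x \<in>\<^sub>m B"
    "\<And>x y. x \<in>\<^sub>m A \<Longrightarrow> y \<in>\<^sub>m A \<Longrightarrow> H x = H y \<Longrightarrow> x = y"
  shows "injects A B"
  using fun_ex_term[OF assms(1), of A] assms(2,3) unfolding injects_def by metis

lemma injects_rel:
  assumes "definable (\<lambda>e. R (ehd (etl e)) (ehd e))"
    "\<And>x. x \<in>\<^sub>m A \<Longrightarrow> \<exists>!y. R x y"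
    "\<And>x y. x \<in>\<^sub>m A \<Longrightarrow> R x y \<Longrightarrow> y \<in>\<^sub>m B"
    "\<And>x x' y. x \<in>\<^sub>m A \<Longrightarrow> x' \<in>\<^sub>m A \<Longrightarrow> R x y \<Longrightarrow> R x' y \<Longrightarrow> x = x'"
  shows "injects A B"
proof -
  from fun_ex[OF assms(1,2), of A] obtain g where "\<forall>x. x \<in>\<^sub>m A \<longrightarrow> R x (app g x)" by blast
  then show ?thesis using assms(3,4) by (intro injectsI[of A g]) metis+
qed

section \<open>Cartesian products and successors\<close>

lemma Prod_ex: "\<exists>P. \<forall>z. z \<in>\<^sub>m P \<longleftrightarrow> (\<exists>a b. a \<in>\<^sub>m A \<and> b \<in>\<^sub>m B \<and> z = pr a b)"
proof -
  \<comment> \<open>One Replacement forms the row over a fixed \<open>a\<close>, a second one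
    collects the rows, and Union flattens them.\<close>
  have row: "\<exists>S. \<forall>z. z \<in>\<^sub>m S \<longleftrightarrow> (\<exists>b. b \<in>\<^sub>m B \<and> z = pr a b)" for a
    by (rule Repl) (intro definable_intros | simp)+
  have d: "definable (\<lambda>e. \<forall>z. z \<in>\<^sub>m ehd e \<longleftrightarrow> (\<exists>b. b \<in>\<^sub>m B \<and> z = pr (ehd (etl e)) b))"
    by (intro definable_intros)
  have "\<exists>D. \<forall>S. S \<in>\<^sub>m D \<longleftrightarrow> (\<exists>a. a \<in>\<^sub>m A \<and> (\<forall>z. z \<in>\<^sub>m S \<longleftrightarrow> (\<exists>b. b \<in>\<^sub>m B \<and> z = pr a b)))"
    by (rule Repl[OF d], rule ext_eq) simp
  then obtain D where D: "\<forall>S. S \<in>\<^sub>m D \<longleftrightarrow> (\<exists>a. a \<in>\<^sub>m A \<and> (\<forall>z. z \<in>\<^sub>m S \<longleftrightarrow> (\<exists>b. b \<in>\<^sub>m B \<and> z = pr a b)))"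
    by blast
  obtain U where U: "\<forall>z. z \<in>\<^sub>m U \<longleftrightarrow> (\<exists>y. y \<in>\<^sub>m D \<and> z \<in>\<^sub>m y)" using union by blast
  have "z \<in>\<^sub>m U \<longleftrightarrow> (\<exists>a b. a \<in>\<^sub>m A \<and> b \<in>\<^sub>m B \<and> z = pr a b)" for z
  proof
    assume "z \<in>\<^sub>m U" then show "\<exists>a b. a \<in>\<^sub>m A \<and> b \<in>\<^sub>m B \<and> z = pr a b" using U D by metis
  next
    assume "\<exists>a b. a \<in>\<^sub>m A \<and> b \<in>\<^sub>m B \<and> z = pr a b"
    then obtain a b where ab: "a \<in>\<^sub>m A" "b \<in>\<^sub>m B" "z = pr a b" by blast
    obtain S where S: "\<forall>z. z \<in>\<^sub>m S \<longleftrightarrow> (\<exists>b. b \<in>\<^sub>m B \<and> z = pr a b)" using row by blast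
    then show "z \<in>\<^sub>m U" using U D ab by metis
  qed
  then show ?thesis by blast
qed

definition prod :: "'a \<Rightarrow> 'a \<Rightarrow> 'a" where
  "prod A B = (THE P. \<forall>z. z \<in>\<^sub>m P \<longleftrightarrow> (\<exists>a b. a \<in>\<^sub>m A \<and> b \<in>\<^sub>m B \<and> z = pr a b))"

lemma mem_prod: "z \<in>\<^sub>m prod A B \<longleftrightarrow> (\<exists>a b. a \<in>\<^sub>m A \<and> b \<in>\<^sub>m B \<and> z = pr a b)"
proof -
  obtain P where P: "\<forall>z. z \<in>\<^sub>m P \<longleftrightarrow> (\<exists>a b. a \<in>\<^sub>m A \<and> b \<in>\<^sub>m B \<and> z = pr a b)" using Prod_ex by blast
  have "prod A B = P" unfolding prod_def
    by (rule the_equality) (use P in \<open>auto intro: ext_eq\<close>)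
  then show ?thesis using P by simp
qed

lemma pr_mem_prod [simp]: "pr a b \<in>\<^sub>m prod A B \<longleftrightarrow> a \<in>\<^sub>m A \<and> b \<in>\<^sub>m B"
  unfolding mem_prod by auto

lemma definable_term_prod [definable_intros]:
  assumes "definable_term t" "definable_term s"
  shows "definable_term (\<lambda>e. prod (t e) (s e))"
proof -
  have "z = prod A B \<longleftrightarrow> (\<forall>w. w \<in>\<^sub>m z \<longleftrightarrow> (\<exists>a b. a \<in>\<^sub>m A \<and> b \<in>\<^sub>m B \<and> w = pr a b))" for z A B
    by (auto simp: mem_prod intro: ext_eq)
  then show ?thesis unfolding definable_term_def
    by (simp only:) (intro definable_intros lift[OF assms(1)] lift[OF assms(2)])
qed

lemma injects_prod:
  assumes "injects A B" shows "injects (prod A A) (prod B B)"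
proof -
  obtain f where f: "\<And>x. x \<in>\<^sub>m A \<Longrightarrow> app f x \<in>\<^sub>m B"
     "\<And>x y. x \<in>\<^sub>m A \<Longrightarrow> y \<in>\<^sub>m A \<Longrightarrow> app f x = app f y \<Longrightarrow> x = y" using injectsE[OF assms(1)] by metis
  show ?thesis
  proof (rule injects_term)
    show "definable_term (\<lambda>e. pr (app f (pfst (ehd e))) (app f (psnd (ehd e))))"
      by (intro definable_intros)
  next
    fix x assume "x \<in>\<^sub>m prod A A"
    then show "pr (app f (pfst x)) (app f (psnd x)) \<in>\<^sub>m prod B B" using f(1) by (auto simp: mem_prod)
  next
    fix x y
    assume "x \<in>\<^sub>m prod A A" "y \<in>\<^sub>m prod A A"
      "pr (app f (pfst x)) (app f (psnd x)) = pr (app f (pfst y)) (app f (psnd y))"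
    then show "x = y" using f(2) unfolding mem_prod by auto
  qed
qed

definition suc :: "'a \<Rightarrow> 'a" where
  "suc x = (THE s. \<forall>y. y \<in>\<^sub>m s \<longleftrightarrow> y \<in>\<^sub>m x \<or> y = x)"

lemma mem_suc [simp]: "y \<in>\<^sub>m suc x \<longleftrightarrow> y \<in>\<^sub>m x \<or> y = x"
proof -
  obtain U where U: "\<forall>z. z \<in>\<^sub>m U \<longleftrightarrow> (\<exists>y. y \<in>\<^sub>m upr x (upr x x) \<and> z \<in>\<^sub>m y)" using union by blast
  then have U': "\<forall>y. y \<in>\<^sub>m U \<longleftrightarrow> y \<in>\<^sub>m x \<or> y = x" by auto
  have "suc x = U" unfolding suc_def
    by (rule the_equality) (use U' in \<open>auto intro: ext_eq\<close>)
  then show ?thesis using U' by simp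
qed

lemma eq_suc_iff: "s = suc x \<longleftrightarrow> (\<forall>y. y \<in>\<^sub>m s \<longleftrightarrow> y \<in>\<^sub>m x \<or> y = x)"
  by (auto intro: ext_eq)

lemma definable_term_suc [definable_intros]:
  assumes "definable_term t" shows "definable_term (\<lambda>e. suc (t e))"
  unfolding definable_term_def eq_suc_iff by (intro definable_intros lift[OF assms(1)])

section \<open>Ordinals and order types\<close>


abbreviation Ord :: "'a \<Rightarrow> bool" where "Ord \<equiv> ordinal (\<in>\<^sub>m)"

abbreviation le :: "'a \<Rightarrow> 'a \<Rightarrow> bool" (infix "\<preceq>" 50) where "le \<equiv> ord_le (\<in>\<^sub>m)"

definition transitive :: "'a \<Rightarrow> bool" where
  "transitive x \<longleftrightarrow> (\<forall>y z. z \<in>\<^sub>m y \<and> y \<in>\<^sub>m x \<longrightarrow> z \<in>\<^sub>m x)"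

text \<open>In the presence of Foundation this characterises the ordinals (\<open>Ord_iff\<close>)
  without the quantifier over subsets that \<open>well_orders\<close> contains.\<close>

definition hered_transitive :: "'a \<Rightarrow> bool" where
  "hered_transitive x \<longleftrightarrow> transitive x \<and> (\<forall>y. y \<in>\<^sub>m x \<longrightarrow> transitive y)"

lemma definable_transitive [definable_intros]:
  assumes "definable_term t" shows "definable (\<lambda>e. transitive (t e))"
  unfolding transitive_def by (intro definable_intros lift[OF assms])

lemma definable_hered_transitive [definable_intros]:
  assumes "definable_term t" shows "definable (\<lambda>e. hered_transitive (t e))"
  unfolding hered_transitive_def by (intro definable_intros lift[OF assms])

lemma mem_irrefl: "\<not> x \<in>\<^sub>m x"
  using foundation[of "upr x x"] by auto

lemma mem_asym: "x \<in>\<^sub>m y \<Longrightarrow> \<not> y \<in>\<^sub>m x"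
  using foundation[of "upr x y"] by auto

lemma hered_transitive_mem: "hered_transitive x \<Longrightarrow> y \<in>\<^sub>m x \<Longrightarrow> hered_transitive y"
  unfolding hered_transitive_def transitive_def by blast

text \<open>Foundation is applied to the elements of \<open>x\<close> satisfying \<open>P\<close>.
  Transitivity of \<open>x\<close> puts all elements of the minimal \<open>y\<close> back into
  \<open>x\<close>, so none of them satisfies \<open>P\<close>.\<close>

lemma hered_transitive_least:
  assumes P: "definable (\<lambda>e. P (ehd e))" and x: "hered_transitive x" "P x"
  shows "\<exists>y. hered_transitive y \<and> P y \<and> (\<forall>z. z \<in>\<^sub>m y \<longrightarrow> \<not> P z)"
proof (cases "\<exists>z. z \<in>\<^sub>m x \<and> P z")
  case True
  obtain b where b: "\<forall>z. z \<in>\<^sub>m b \<longleftrightarrow> z \<in>\<^sub>m x \<and> P z" using Sep[OF P] by blast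
  then obtain y where y: "y \<in>\<^sub>m b" "\<not> (\<exists>z. z \<in>\<^sub>m b \<and> z \<in>\<^sub>m y)" using True foundation[of b] by blast
  have "\<not> P z" if "z \<in>\<^sub>m y" for z
    using y b that x(1) unfolding hered_transitive_def transitive_def by blast
  then show ?thesis using y(1) b hered_transitive_mem[OF x(1)] by blast
qed (use x in blast)

text \<open>A double minimal counterexample: \<open>a\<close> is minimal among the sets incomparable
  to something, \<open>b\<close> minimal among those incomparable to \<open>a\<close>. Comparability
  one level down forces \<open>a\<close> and \<open>b\<close> to have the same elements.\<close>

lemma hered_transitive_linear:
  assumes "hered_transitive x" "hered_transitive y" shows "x \<in>\<^sub>m y \<or> x = y \<or> y \<in>\<^sub>m x"
proof (rule ccontr)
  assume neg: "\<not> ?thesis"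
  let ?I = "\<lambda>x y. \<not> (x \<in>\<^sub>m y \<or> x = y \<or> y \<in>\<^sub>m x)"
  have d1: "definable (\<lambda>e. \<exists>y. hered_transitive y \<and> ?I (ehd e) y)" by (intro definable_intros)
  obtain a where a: "hered_transitive a" "\<exists>y. hered_transitive y \<and> ?I a y"
     "\<And>z. z \<in>\<^sub>m a \<Longrightarrow> \<not> (\<exists>y. hered_transitive y \<and> ?I z y)"
    using hered_transitive_least[OF d1, of x] neg assms by blast
  have d2: "definable (\<lambda>e. ?I a (ehd e))" by (intro definable_intros)
  obtain b where b: "hered_transitive b" "?I a b" "\<And>z. z \<in>\<^sub>m b \<Longrightarrow> \<not> ?I a z"
    using hered_transitive_least[OF d2] a(2) by blast
  have "z \<in>\<^sub>m b" if "z \<in>\<^sub>m a" for z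
  proof -
    have "z \<in>\<^sub>m b \<or> z = b \<or> b \<in>\<^sub>m z" using a(3)[OF that] b(1) by blast
    moreover have "b \<in>\<^sub>m z \<Longrightarrow> b \<in>\<^sub>m a"
      using a(1) that unfolding hered_transitive_def transitive_def by blast
    ultimately show ?thesis using b(2) that by blast
  qed
  moreover have "z \<in>\<^sub>m a" if "z \<in>\<^sub>m b" for z
  proof -
    have "z \<in>\<^sub>m a \<or> z = a \<or> a \<in>\<^sub>m z" using b(3)[OF that] by blast
    moreover have "a \<in>\<^sub>m z \<Longrightarrow> a \<in>\<^sub>m b"
      using b(1) that unfolding hered_transitive_def transitive_def by blast
    ultimately show ?thesis using b(2) that by blast
  qed
  ultimately have "a = b" by (intro ext_eq) blast
  then show False using b(2) by simp
qed

lemma well_ordersI: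
  assumes "\<And>x. x \<in>\<^sub>m A \<Longrightarrow> \<not> R x x"
    and "\<And>x y z. x \<in>\<^sub>m A \<Longrightarrow> y \<in>\<^sub>m A \<Longrightarrow> z \<in>\<^sub>m A \<Longrightarrow> R x y \<Longrightarrow> R y z \<Longrightarrow> R x z"
    and "\<And>x y. x \<in>\<^sub>m A \<Longrightarrow> y \<in>\<^sub>m A \<Longrightarrow> R x y \<or> x = y \<or> R y x"
    and "\<And>S. (\<And>z. z \<in>\<^sub>m S \<Longrightarrow> z \<in>\<^sub>m A) \<Longrightarrow> \<exists>z. z \<in>\<^sub>m S \<Longrightarrow> \<exists>m. m \<in>\<^sub>m S \<and> (\<forall>x. x \<in>\<^sub>m S \<longrightarrow> m = x \<or> R m x)"
  shows "well_orders (\<in>\<^sub>m) R A"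
  unfolding well_orders_def
proof (intro conjI allI impI)
  fix x y z assume "x \<in>\<^sub>m A \<and> y \<in>\<^sub>m A \<and> z \<in>\<^sub>m A \<and> R x y \<and> R y z"
  then show "R x z" using assms(2)[of x y z] by simp
next
  fix x y assume "x \<in>\<^sub>m A \<and> y \<in>\<^sub>m A"
  then show "R x y \<or> x = y \<or> R y x" using assms(3)[of x y] by simp
next
  fix S assume "subset_of (\<in>\<^sub>m) S A \<and> nonempty (\<in>\<^sub>m) S"
  then show "\<exists>m. m \<in>\<^sub>m S \<and> (\<forall>x. x \<in>\<^sub>m S \<longrightarrow> m = x \<or> R m x)"
    using assms(4)[of S] by (simp add: subset_of_def nonempty_def)
qed (rule assms(1))

text \<open>Forwards, transitivity of membership on \<open>x\<close> makes the elements of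
  \<open>x\<close> transitive. Backwards, Foundation gives minimal elements, and
  \<open>hered_transitive_linear\<close> turns minimal into least.\<close>

lemma Ord_iff: "Ord x \<longleftrightarrow> hered_transitive x"
proof
  assume "Ord x"
  then have sub: "\<forall>y. y \<in>\<^sub>m x \<longrightarrow> subset_of (\<in>\<^sub>m) y x" and wo: "well_orders (\<in>\<^sub>m) (\<in>\<^sub>m) x"
    unfolding ordinal_def by (rule conjunct1, rule conjunct2)
  have "\<forall>a b c. a \<in>\<^sub>m x \<and> b \<in>\<^sub>m x \<and> c \<in>\<^sub>m x \<and> a \<in>\<^sub>m b \<and> b \<in>\<^sub>m c \<longrightarrow> a \<in>\<^sub>m c"
    using wo unfolding well_orders_def by (elim conjE) assumption
  moreover have "\<And>y z. z \<in>\<^sub>m y \<Longrightarrow> y \<in>\<^sub>m x \<Longrightarrow> z \<in>\<^sub>m x"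
    using sub unfolding subset_of_def by blast
  ultimately show "hered_transitive x"
    unfolding hered_transitive_def transitive_def by blast
next
  assume h: "hered_transitive x"
  have "well_orders (\<in>\<^sub>m) (\<in>\<^sub>m) x"
  proof (rule well_ordersI)
    fix S assume S: "\<And>z. z \<in>\<^sub>m S \<Longrightarrow> z \<in>\<^sub>m x" "\<exists>z. z \<in>\<^sub>m S"
    obtain m where m: "m \<in>\<^sub>m S" "\<not> (\<exists>z. z \<in>\<^sub>m S \<and> z \<in>\<^sub>m m)" using foundation[OF S(2)] by blast
    have "m = z \<or> m \<in>\<^sub>m z" if z: "z \<in>\<^sub>m S" for z
      using hered_transitive_linear[of m z] hered_transitive_mem[OF h] S(1)[OF m(1)] S(1)[OF z] m(2) z
      by blast
    then show "\<exists>m. m \<in>\<^sub>m S \<and> (\<forall>z. z \<in>\<^sub>m S \<longrightarrow> m = z \<or> m \<in>\<^sub>m z)" using m(1) by blast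
  next
    show "a \<in>\<^sub>m c" if "c \<in>\<^sub>m x" "a \<in>\<^sub>m b" "b \<in>\<^sub>m c" for a b c
      using h that unfolding hered_transitive_def transitive_def by blast
    show "b \<in>\<^sub>m c \<or> b = c \<or> c \<in>\<^sub>m b" if "b \<in>\<^sub>m x" "c \<in>\<^sub>m x" for b c
      using hered_transitive_linear[of b c] hered_transitive_mem[OF h] that by blast
  qed (rule mem_irrefl)
  moreover have "\<forall>y. y \<in>\<^sub>m x \<longrightarrow> subset_of (\<in>\<^sub>m) y x"
    using h unfolding hered_transitive_def transitive_def subset_of_def by blast
  ultimately show "Ord x" unfolding ordinal_def by blast
qed

lemma definable_Ord [definable_intros]:
  assumes "definable_term t" shows "definable (\<lambda>e. Ord (t e))"
  unfolding Ord_iff by (intro definable_intros lift[OF assms])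

lemma definable_le [definable_intros]:
  assumes "definable_term t" "definable_term s" shows "definable (\<lambda>e. t e \<preceq> s e)"
  unfolding ord_le_def by (intro definable_intros lift[OF assms(1)] lift[OF assms(2)])

lemma Ord_mem: "Ord x \<Longrightarrow> y \<in>\<^sub>m x \<Longrightarrow> Ord y"
  unfolding Ord_iff by (rule hered_transitive_mem)

lemma Ord_trans: "Ord x \<Longrightarrow> z \<in>\<^sub>m y \<Longrightarrow> y \<in>\<^sub>m x \<Longrightarrow> z \<in>\<^sub>m x"
  unfolding Ord_iff hered_transitive_def transitive_def by blast

lemma Ord_linear: "Ord x \<Longrightarrow> Ord y \<Longrightarrow> x \<in>\<^sub>m y \<or> x = y \<or> y \<in>\<^sub>m x"
  unfolding Ord_iff by (rule hered_transitive_linear)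

lemma OrdI: "(\<And>y. y \<in>\<^sub>m x \<Longrightarrow> Ord y) \<Longrightarrow> (\<And>y z. z \<in>\<^sub>m y \<Longrightarrow> y \<in>\<^sub>m x \<Longrightarrow> z \<in>\<^sub>m x) \<Longrightarrow> Ord x"
  unfolding Ord_iff hered_transitive_def transitive_def by blast

lemma Ord_least:
  assumes "definable (\<lambda>e. P (ehd e))" "Ord x" "P x"
  shows "\<exists>y. Ord y \<and> P y \<and> (\<forall>z. z \<in>\<^sub>m y \<longrightarrow> \<not> P z)"
  using hered_transitive_least assms unfolding Ord_iff by blast

lemma Ord_induct:
  assumes "definable (\<lambda>e. P (ehd e))" "Ord x" "\<And>y. Ord y \<Longrightarrow> (\<And>z. z \<in>\<^sub>m y \<Longrightarrow> P z) \<Longrightarrow> P y"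
  shows "P x"
  using Ord_least[OF definable_not[OF assms(1)] assms(2)] assms(3) by blast

lemma le_not_mem: "Ord x \<Longrightarrow> Ord y \<Longrightarrow> x \<preceq> y \<longleftrightarrow> \<not> y \<in>\<^sub>m x"
  unfolding ord_le_def using Ord_linear mem_asym mem_irrefl by blast

lemma le_iff_subset: "Ord x \<Longrightarrow> Ord y \<Longrightarrow> x \<preceq> y \<longleftrightarrow> (\<forall>z. z \<in>\<^sub>m x \<longrightarrow> z \<in>\<^sub>m y)"
  using Ord_linear[of x y] Ord_trans[of y _ x] mem_irrefl[of y] unfolding ord_le_def by blast

lemma le_refl [simp]: "x \<preceq> x"
  unfolding ord_le_def by simp

lemma le_trans: "Ord z \<Longrightarrow> x \<preceq> y \<Longrightarrow> y \<preceq> z \<Longrightarrow> x \<preceq> z"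
  unfolding ord_le_def using Ord_trans by blast

lemma le_mem_trans: "Ord z \<Longrightarrow> x \<preceq> y \<Longrightarrow> y \<in>\<^sub>m z \<Longrightarrow> x \<in>\<^sub>m z"
  unfolding ord_le_def using Ord_trans by blast

lemma mem_le_trans: "Ord z \<Longrightarrow> x \<in>\<^sub>m y \<Longrightarrow> y \<preceq> z \<Longrightarrow> x \<in>\<^sub>m z"
  unfolding ord_le_def using Ord_trans by blast

lemma le_antisym: "x \<preceq> y \<Longrightarrow> y \<preceq> x \<Longrightarrow> x = y"
  unfolding ord_le_def using mem_asym by blast

lemma injects_of_le: "Ord y \<Longrightarrow> x \<preceq> y \<Longrightarrow> injects x y"
  by (rule injects_subset) (rule mem_le_trans)

lemma Ord_suc: "Ord x \<Longrightarrow> Ord (suc x)"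
  by (rule OrdI) (auto intro: Ord_mem Ord_trans)

lemma Ord_emp: "Ord emp"
  by (rule OrdI) auto

lemma Ord_Union:
  assumes "\<forall>z. z \<in>\<^sub>m u \<longleftrightarrow> (\<exists>y. y \<in>\<^sub>m D \<and> z \<in>\<^sub>m y)" "\<And>y. y \<in>\<^sub>m D \<Longrightarrow> Ord y"
  shows "Ord u"
  by (rule OrdI) (use assms Ord_mem Ord_trans in blast)+

lemma Ord_max:
  assumes "Ord x" "Ord y" obtains z where "Ord z" "x \<preceq> z" "y \<preceq> z"
  using assms Ord_linear[OF assms] unfolding ord_le_def by blast

lemma least_ordinal_eqI:
  assumes "Ord x" "P x" "\<And>y. y \<in>\<^sub>m x \<Longrightarrow> \<not> P y"
  shows "least_ordinal (\<in>\<^sub>m) P = x"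
  unfolding least_ordinal_def
proof (rule the_equality)
  show "Ord x \<and> P x \<and> (\<forall>\<beta>. Ord \<beta> \<and> P \<beta> \<longrightarrow> x \<preceq> \<beta>)"
    using assms le_not_mem by blast
  fix y assume y: "Ord y \<and> P y \<and> (\<forall>\<beta>. Ord \<beta> \<and> P \<beta> \<longrightarrow> y \<preceq> \<beta>)"
  then have "y \<preceq> x" using assms by blast
  then show "y = x" unfolding ord_le_def using assms(3) y by blast
qed

text \<open>\<open>least_ordinal\<close> is a definite description in HOL; definability of
  \<open>P\<close> is what lets the model supply a least witness for it.\<close>

lemma least_ordinal_props:
  assumes "definable (\<lambda>e. P (ehd e))" "Ord x" "P x"
  shows "Ord (least_ordinal (\<in>\<^sub>m) P)" "P (least_ordinal (\<in>\<^sub>m) P)"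
    "\<And>y. y \<in>\<^sub>m least_ordinal (\<in>\<^sub>m) P \<Longrightarrow> \<not> P y"
proof -
  obtain y where y: "Ord y" "P y" "\<And>z. z \<in>\<^sub>m y \<Longrightarrow> \<not> P z" using Ord_least[OF assms] by blast
  then have "least_ordinal (\<in>\<^sub>m) P = y" by (intro least_ordinal_eqI) auto
  then show "Ord (least_ordinal (\<in>\<^sub>m) P)" "P (least_ordinal (\<in>\<^sub>m) P)"
    "\<And>y. y \<in>\<^sub>m least_ordinal (\<in>\<^sub>m) P \<Longrightarrow> \<not> P y" using y by auto
qed

section \<open>Order isomorphisms onto ordinals and existence of order types\<close>

lemma increasing_le:
  assumes "Ord a" "\<And>x. x \<in>\<^sub>m a \<Longrightarrow> Ord (app k x)"
    "\<And>x y. y \<in>\<^sub>m a \<Longrightarrow> x \<in>\<^sub>m y \<Longrightarrow> app k x \<in>\<^sub>m app k y" "x \<in>\<^sub>m a"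
  shows "x \<preceq> app k x"
proof (rule ccontr)
  assume "\<not> x \<preceq> app k x"
  then have "x \<in>\<^sub>m a \<and> app k x \<in>\<^sub>m x" using assms(1,2,4) le_not_mem Ord_mem by blast
  moreover have d: "definable (\<lambda>e. ehd e \<in>\<^sub>m a \<and> app k (ehd e) \<in>\<^sub>m ehd e)" by (intro definable_intros)
  moreover have "Ord x" using assms Ord_mem by blast
  \<comment> \<open>At a least \<open>y\<close> moved downwards, \<open>app k y\<close> is a smaller
    argument that is moved downwards too.\<close>
  ultimately obtain y where y: "y \<in>\<^sub>m a" "app k y \<in>\<^sub>m y" "\<And>z. z \<in>\<^sub>m y \<Longrightarrow> \<not> (z \<in>\<^sub>m a \<and> app k z \<in>\<^sub>m z)"
    using Ord_least[OF d] by blast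
  show False using y(3)[OF y(2)] assms(3)[OF y(1,2)] Ord_trans[OF assms(1) y(2,1)] by blast
qed

text \<open>Injectivity is not listed; it follows from the order equivalence when \<open>R\<close>
  is total on \<open>S\<close> (\<open>iso_bij\<close>).\<close>

definition iso :: "'a \<Rightarrow> ('a \<Rightarrow> 'a \<Rightarrow> bool) \<Rightarrow> 'a \<Rightarrow> 'a \<Rightarrow> bool" where
  "iso S R a g \<longleftrightarrow> (\<forall>y. y \<in>\<^sub>m S \<longrightarrow> app g y \<in>\<^sub>m a) \<and> (\<forall>z. z \<in>\<^sub>m a \<longrightarrow> (\<exists>y. y \<in>\<^sub>m S \<and> app g y = z)) \<and>
     (\<forall>y y'. y \<in>\<^sub>m S \<and> y' \<in>\<^sub>m S \<longrightarrow> (R y y' \<longleftrightarrow> app g y \<in>\<^sub>m app g y'))"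

lemma iso_mem: "iso S R a g \<Longrightarrow> y \<in>\<^sub>m S \<Longrightarrow> app g y \<in>\<^sub>m a"
  unfolding iso_def by blast

lemma iso_onto: "iso S R a g \<Longrightarrow> z \<in>\<^sub>m a \<Longrightarrow> \<exists>y. y \<in>\<^sub>m S \<and> app g y = z"
  unfolding iso_def by blast

lemma iso_less: "iso S R a g \<Longrightarrow> y \<in>\<^sub>m S \<Longrightarrow> y' \<in>\<^sub>m S \<Longrightarrow> R y y' \<longleftrightarrow> app g y \<in>\<^sub>m app g y'"
  unfolding iso_def by blast

lemma isoI:
  assumes "\<And>y. y \<in>\<^sub>m S \<Longrightarrow> app g y \<in>\<^sub>m a" "\<And>z. z \<in>\<^sub>m a \<Longrightarrow> \<exists>y. y \<in>\<^sub>m S \<and> app g y = z"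
    "\<And>y y'. y \<in>\<^sub>m S \<Longrightarrow> y' \<in>\<^sub>m S \<Longrightarrow> R y y' \<longleftrightarrow> app g y \<in>\<^sub>m app g y'"
  shows "iso S R a g"
  unfolding iso_def using assms by auto

lemma definable_iso_mem [definable_intros]:
  assumes "definable_term s" "definable_term a" "definable_term g"
  shows "definable (\<lambda>e. iso (s e) (\<in>\<^sub>m) (a e) (g e))"
  unfolding iso_def
  by (intro definable_intros lift[OF assms(1)] lift[OF assms(2)] lift[OF assms(3)])

text \<open>Going back along \<open>g\<close> and then forward along \<open>h\<close> gives a
  strictly increasing map from \<open>a\<close> to \<open>b\<close>, and
  \<open>increasing_le\<close> places each element of \<open>a\<close> at or below its
  image.\<close>

lemma iso_mono:
  assumes "iso S R a g" "iso T R b h" "Ord a" "Ord b" "\<And>x. x \<in>\<^sub>m S \<Longrightarrow> x \<in>\<^sub>m T"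
  shows "a \<preceq> b"
proof -
  have d: "definable (\<lambda>e. \<exists>y. y \<in>\<^sub>m S \<and> app g y = ehd (etl e) \<and> ehd e = app h y)"
    by (intro definable_intros)
  have 1: "\<exists>!w. \<exists>y. y \<in>\<^sub>m S \<and> app g y = z \<and> w = app h y" if z: "z \<in>\<^sub>m a" for z
  proof -
    \<comment> \<open>Totality of \<open>R\<close> is not assumed, so \<open>g\<close> may identify
      points. Neither is then \<open>R\<close>-below the other, and \<open>h\<close> identifies them
      as well, so the composite is single-valued.\<close>
    have *: "app h y = app h y'" if y: "y \<in>\<^sub>m S" "y' \<in>\<^sub>m S" "app g y = app g y'" for y y'
    proof -
      have "\<not> R y y'" "\<not> R y' y" using iso_less[OF assms(1)] y mem_irrefl by auto
      then have "\<not> app h y \<in>\<^sub>m app h y'" "\<not> app h y' \<in>\<^sub>m app h y" "Ord (app h y)" "Ord (app h y')"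
        using iso_less[OF assms(2)] iso_mem[OF assms(2)] assms(4,5) y Ord_mem by blast+
      then show ?thesis using Ord_linear by blast
    qed
    obtain y where y: "y \<in>\<^sub>m S" "app g y = z" using iso_onto[OF assms(1) z] by blast
    show ?thesis
    proof (rule ex1I)
      show "\<exists>y'. y' \<in>\<^sub>m S \<and> app g y' = z \<and> app h y = app h y'"
        by (rule exI[of _ y]) (simp add: y)
      show "w = app h y" if w: "\<exists>y. y \<in>\<^sub>m S \<and> app g y = z \<and> w = app h y" for w
      proof -
        obtain v where v: "v \<in>\<^sub>m S" "app g v = z" "w = app h v" using w by blast
        show ?thesis unfolding v(3) by (rule *[OF v(1) y(1)]) (simp add: v y)
      qed
    qed
  qed
  obtain k where k: "\<And>z. z \<in>\<^sub>m a \<Longrightarrow> \<exists>y. y \<in>\<^sub>m S \<and> app g y = z \<and> app k z = app h y"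
    using fun_ex[OF d 1, of a] by blast
  have kb: "app k z \<in>\<^sub>m b" if "z \<in>\<^sub>m a" for z
    using k[OF that] iso_mem[OF assms(2)] assms(5) by auto
  have inc: "app k x \<in>\<^sub>m app k y" if xy: "y \<in>\<^sub>m a" "x \<in>\<^sub>m y" for x y
  proof -
    have "x \<in>\<^sub>m a" using xy assms(3) Ord_trans by blast
    then obtain u v where uv: "u \<in>\<^sub>m S" "app g u = x" "app k x = app h u" "v \<in>\<^sub>m S" "app g v = y" "app k y = app h v"
      using k[of x] k[of y] xy by blast
    then have "R u v" using iso_less[OF assms(1), of u v] that by simp
    then show ?thesis using iso_less[OF assms(2), of u v] assms(5) uv by simp
  qed
  have "x \<in>\<^sub>m b" if "x \<in>\<^sub>m a" for x
  proof -
    have "x \<preceq> app k x" by (rule increasing_le[OF assms(3) _ inc that]) (use kb assms(4) Ord_mem in blast)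
    then show ?thesis using kb[OF that] le_mem_trans assms(4) by blast
  qed
  then show ?thesis using le_iff_subset assms by blast
qed

lemma iso_unique:
  assumes "iso S R a g" "iso S R b h" "Ord a" "Ord b" shows "a = b"
  using le_antisym iso_mono[OF assms] iso_mono[OF assms(2,1,4,3)] by blast

lemma iso_segment:
  assumes "iso T R a g" "Ord a" "x \<in>\<^sub>m T" "\<And>y. y \<in>\<^sub>m S \<longleftrightarrow> y \<in>\<^sub>m T \<and> R y x"
  shows "iso S R (app g x) g" "app g x \<in>\<^sub>m a"
proof -
  show ga: "app g x \<in>\<^sub>m a" using iso_mem[OF assms(1,3)] .
  show "iso S R (app g x) g"
  proof (rule isoI)
    show "app g y \<in>\<^sub>m app g x" if "y \<in>\<^sub>m S" for y
      using that assms(4) iso_less[OF assms(1) _ assms(3)] by blast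
    show "\<exists>y. y \<in>\<^sub>m S \<and> app g y = z" if z: "z \<in>\<^sub>m app g x" for z
    proof -
      obtain y where y: "y \<in>\<^sub>m T" "app g y = z" using iso_onto[OF assms(1) Ord_trans[OF assms(2) z ga]] by blast
      then show ?thesis using assms(4) iso_less[OF assms(1) y(1) assms(3)] z by blast
    qed
    show "R y y' \<longleftrightarrow> app g y \<in>\<^sub>m app g y'" if "y \<in>\<^sub>m S" "y' \<in>\<^sub>m S" for y y'
      using that assms(4) iso_less[OF assms(1)] by blast
  qed
qed

text \<open>No recursion is used: \<open>G x a\<close> says that the segment below \<open>x\<close>
  has type \<open>a\<close>. The points \<open>D\<close> having such a type form an initial segment,
  and their types form an ordinal \<open>b\<close> to which \<open>D\<close> is isomorphic. A least
  point outside \<open>D\<close> would have exactly \<open>D\<close> below it, hence the type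
  \<open>b\<close> after all.\<close>

theorem order_type_ex:
  assumes R: "definable (\<lambda>e. R (ehd (etl e)) (ehd e))" and wo: "well_orders (\<in>\<^sub>m) R A"
  shows "\<exists>a g. Ord a \<and> iso A R a g"
proof -
  have irr: "\<And>x. x \<in>\<^sub>m A \<Longrightarrow> \<not> R x x"
    and tr: "\<And>x y z. x \<in>\<^sub>m A \<Longrightarrow> y \<in>\<^sub>m A \<Longrightarrow> z \<in>\<^sub>m A \<Longrightarrow> R x y \<Longrightarrow> R y z \<Longrightarrow> R x z"
    and lin: "\<And>x y. x \<in>\<^sub>m A \<Longrightarrow> y \<in>\<^sub>m A \<Longrightarrow> R x y \<or> x = y \<or> R y x"
    and least: "\<And>S. (\<And>z. z \<in>\<^sub>m S \<Longrightarrow> z \<in>\<^sub>m A) \<Longrightarrow> \<exists>z. z \<in>\<^sub>m S \<Longrightarrow> \<exists>m. m \<in>\<^sub>m S \<and> (\<forall>x. x \<in>\<^sub>m S \<longrightarrow> m = x \<or> R m x)"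
    using wo unfolding well_orders_def subset_of_def nonempty_def by (elim conjE; blast)+
  define G where "G x a \<longleftrightarrow> Ord a \<and> (\<exists>S g. (\<forall>y. y \<in>\<^sub>m S \<longleftrightarrow> y \<in>\<^sub>m A \<and> R y x) \<and> iso S R a g)" for x a
  have dG: "definable (\<lambda>e. G (ehd (etl e)) (ehd e))"
    unfolding G_def iso_def by (intro definable_intros definable_subst2[OF R])
  have uG: "a = b" if "G x a" "G x b" for x a b
  proof -
    obtain S g T h where *: "\<forall>y. y \<in>\<^sub>m S \<longleftrightarrow> y \<in>\<^sub>m A \<and> R y x" "iso S R a g"
      "\<forall>y. y \<in>\<^sub>m T \<longleftrightarrow> y \<in>\<^sub>m A \<and> R y x" "iso T R b h" "Ord a" "Ord b"
      using \<open>G x a\<close> \<open>G x b\<close> unfolding G_def by blast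
    then have "S = T" by (intro ext_eq) blast
    then show ?thesis using iso_unique * by blast
  qed
  have "definable (\<lambda>e. \<exists>a. G (ehd e) a)" by (intro definable_intros definable_subst2[OF dG])
  from Sep[OF this, of A]
  obtain D where D: "\<And>x. x \<in>\<^sub>m D \<longleftrightarrow> x \<in>\<^sub>m A \<and> (\<exists>a. G x a)" by blast
  have "\<exists>k. \<forall>x. x \<in>\<^sub>m D \<longrightarrow> G x (app k x)"
    by (rule fun_ex[OF dG]) (use uG D in blast)
  then obtain k where k: "\<And>x. x \<in>\<^sub>m D \<Longrightarrow> G x (app k x)" by blast
  obtain b where b: "\<And>y. y \<in>\<^sub>m b \<longleftrightarrow> (\<exists>x. x \<in>\<^sub>m D \<and> y = app k x)" using image_ex by metis
  have seg: "(\<exists>g. (\<forall>y. y \<in>\<^sub>m A \<and> R y x \<longrightarrow> y \<in>\<^sub>m D \<and> app k y = app g y \<and> app g y \<in>\<^sub>m app k x) \<and>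
     (\<forall>z. z \<in>\<^sub>m app k x \<longrightarrow> (\<exists>y. y \<in>\<^sub>m A \<and> R y x \<and> app g y = z)))" if x: "x \<in>\<^sub>m D" for x
  proof -
    obtain S g where S: "\<And>y. y \<in>\<^sub>m S \<longleftrightarrow> y \<in>\<^sub>m A \<and> R y x" and g: "iso S R (app k x) g" and o: "Ord (app k x)"
      using k[OF x] unfolding G_def by blast
    have "y \<in>\<^sub>m D \<and> app k y = app g y \<and> app g y \<in>\<^sub>m app k x" if y: "y \<in>\<^sub>m A" "R y x" for y
    proof -
      have dR: "definable (\<lambda>e. R (ehd e) y)" by (intro definable_intros definable_subst2[OF R])
      obtain T where T: "\<And>z. z \<in>\<^sub>m T \<longleftrightarrow> z \<in>\<^sub>m S \<and> R z y" using Sep[OF dR] by metis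
      have yS: "y \<in>\<^sub>m S" using S y by blast
      have i: "iso T R (app g y) g" "app g y \<in>\<^sub>m app k x" using iso_segment[OF g o yS T] by blast+
      have "\<forall>z. z \<in>\<^sub>m T \<longleftrightarrow> z \<in>\<^sub>m A \<and> R z y" using T S y tr x D by blast
      then have "G y (app g y)" unfolding G_def using i o Ord_mem by blast
      then show ?thesis using D y i(2) k uG by blast
    qed
    moreover have "\<exists>y. y \<in>\<^sub>m A \<and> R y x \<and> app g y = z" if "z \<in>\<^sub>m app k x" for z
      using iso_onto[OF g that] S by blast
    ultimately show ?thesis by blast
  qed
  have Ob: "Ord b"
  proof (rule OrdI)
    show "Ord y" if "y \<in>\<^sub>m b" for y
    proof -
      obtain x where "x \<in>\<^sub>m D" "y = app k x" using b[of y] \<open>y \<in>\<^sub>m b\<close> by blast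
      then show ?thesis using k[of x] unfolding G_def by simp
    qed
    show "z \<in>\<^sub>m b" if zy: "z \<in>\<^sub>m y" "y \<in>\<^sub>m b" for y z
    proof -
      obtain x where x: "x \<in>\<^sub>m D" "y = app k x" using zy b by blast
      then obtain w where "w \<in>\<^sub>m D" "app k w = z" using seg[OF x(1)] zy(1) by blast
      then show ?thesis using b by blast
    qed
  qed
  have mono: "app k y \<in>\<^sub>m app k x" if "x \<in>\<^sub>m D" "y \<in>\<^sub>m D" "R y x" for x y
    using seg[OF that(1)] that D by fastforce
  have iD: "iso D R b k"
  proof (rule isoI)
    fix y y' assume yy: "y \<in>\<^sub>m D" "y' \<in>\<^sub>m D"
    show "R y y' \<longleftrightarrow> app k y \<in>\<^sub>m app k y'"
    proof
      assume *: "app k y \<in>\<^sub>m app k y'"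
      show "R y y'"
        using lin[of y y'] yy D * mono[of y y'] mem_asym[OF *] mem_irrefl[of "app k y"] by blast
    qed (use mono yy in blast)
  next
    show "app k y \<in>\<^sub>m b" if "y \<in>\<^sub>m D" for y unfolding b using that by blast
    show "\<exists>y. y \<in>\<^sub>m D \<and> app k y = z" if "z \<in>\<^sub>m b" for z using that[unfolded b] by auto
  qed
  have "D = A"
  proof (rule ccontr)
    assume "D \<noteq> A"
    have "definable (\<lambda>e. \<not> ehd e \<in>\<^sub>m D)" by (intro definable_intros)
    from Sep[OF this, of A] obtain C where C: "\<And>x. x \<in>\<^sub>m C \<longleftrightarrow> x \<in>\<^sub>m A \<and> \<not> x \<in>\<^sub>m D" by blast
    have "\<exists>z. z \<in>\<^sub>m C" using \<open>D \<noteq> A\<close> C D ext_eq[of D A] by blast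
    then obtain x where x: "x \<in>\<^sub>m C" "\<And>y. y \<in>\<^sub>m C \<Longrightarrow> x = y \<or> R x y" using least[of C] C by blast
    have "y \<in>\<^sub>m D \<longleftrightarrow> y \<in>\<^sub>m A \<and> R y x" for y
    proof
      assume y: "y \<in>\<^sub>m D"
      then show "y \<in>\<^sub>m A \<and> R y x" using lin[of y x] x(1) C D seg[OF y] by blast
    next
      assume y: "y \<in>\<^sub>m A \<and> R y x"
      then show "y \<in>\<^sub>m D" using x C tr[of x y x] irr by blast
    qed
    then have "G x b" unfolding G_def using iD Ob by blast
    then show False using D C x(1) by blast
  qed
  then show ?thesis using iD Ob by blast
qed

section \<open>Hartogs and Lindenbaum numbers\<close>


lemma well_orders_mem:
  assumes "\<And>x. x \<in>\<^sub>m S \<Longrightarrow> Ord x" shows "well_orders (\<in>\<^sub>m) (\<in>\<^sub>m) S"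
proof (rule well_ordersI)
  fix T assume T: "\<And>z. z \<in>\<^sub>m T \<Longrightarrow> z \<in>\<^sub>m S" "\<exists>z. z \<in>\<^sub>m T"
  obtain m where m: "m \<in>\<^sub>m T" "\<not> (\<exists>z. z \<in>\<^sub>m T \<and> z \<in>\<^sub>m m)" using foundation[OF T(2)] by blast
  have "m = z \<or> m \<in>\<^sub>m z" if z: "z \<in>\<^sub>m T" for z
    using Ord_linear[of m z] assms T(1)[OF m(1)] T(1)[OF z] m(2) z by blast
  then show "\<exists>m. m \<in>\<^sub>m T \<and> (\<forall>z. z \<in>\<^sub>m T \<longrightarrow> m = z \<or> m \<in>\<^sub>m z)" using m(1) by blast
next
  show "a \<in>\<^sub>m c" if "c \<in>\<^sub>m S" "a \<in>\<^sub>m b" "b \<in>\<^sub>m c" for a b c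
    using Ord_trans[OF assms] that by blast
  show "b \<in>\<^sub>m c \<or> b = c \<or> c \<in>\<^sub>m b" if "b \<in>\<^sub>m S" "c \<in>\<^sub>m S" for b c
    using Ord_linear assms that by blast
qed (rule mem_irrefl)

lemma order_type_ordinals:
  assumes "\<And>x. x \<in>\<^sub>m S \<Longrightarrow> Ord x" obtains a g where "Ord a" "iso S (\<in>\<^sub>m) a g"
proof -
  have "definable (\<lambda>e. ehd (etl e) \<in>\<^sub>m ehd e)" by (intro definable_intros)
  from order_type_ex[OF this well_orders_mem[OF assms]] show ?thesis using that by blast
qed

definition bij :: "'a \<Rightarrow> 'a \<Rightarrow> 'a \<Rightarrow> bool" where
  "bij g A B \<longleftrightarrow> (\<forall>x. x \<in>\<^sub>m A \<longrightarrow> app g x \<in>\<^sub>m B) \<and>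
     (\<forall>x y. x \<in>\<^sub>m A \<and> y \<in>\<^sub>m A \<and> app g x = app g y \<longrightarrow> x = y) \<and>
     (\<forall>y. y \<in>\<^sub>m B \<longrightarrow> (\<exists>x. x \<in>\<^sub>m A \<and> app g x = y))"

lemma bijection_iff_bij: "(\<exists>f. bijection (\<in>\<^sub>m) f A B) \<longleftrightarrow> (\<exists>g. bij g A B)"
  unfolding bijection_iff bij_def ..

lemma bij_mem: "bij g A B \<Longrightarrow> x \<in>\<^sub>m A \<Longrightarrow> app g x \<in>\<^sub>m B"
  unfolding bij_def by blast

lemma bij_inj: "bij g A B \<Longrightarrow> x \<in>\<^sub>m A \<Longrightarrow> y \<in>\<^sub>m A \<Longrightarrow> app g x = app g y \<Longrightarrow> x = y"
  unfolding bij_def by metis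

lemma bij_onto: "bij g A B \<Longrightarrow> y \<in>\<^sub>m B \<Longrightarrow> \<exists>x. x \<in>\<^sub>m A \<and> app g x = y"
  unfolding bij_def by blast

lemma bijI:
  assumes "\<And>x. x \<in>\<^sub>m A \<Longrightarrow> app g x \<in>\<^sub>m B"
    "\<And>x y. x \<in>\<^sub>m A \<Longrightarrow> y \<in>\<^sub>m A \<Longrightarrow> app g x = app g y \<Longrightarrow> x = y"
    "\<And>y. y \<in>\<^sub>m B \<Longrightarrow> \<exists>x. x \<in>\<^sub>m A \<and> app g x = y"
  shows "bij g A B"
  unfolding bij_def
proof (intro conjI allI impI)
  show "x = y" if "x \<in>\<^sub>m A \<and> y \<in>\<^sub>m A \<and> app g x = app g y" for x y
    using that assms(2)[of x y] by simp
qed (use assms(1,3) in auto)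

lemma bij_injects: "bij g A B \<Longrightarrow> injects A B"
  by (rule injectsI[of A g]) (erule (1) bij_mem, erule (3) bij_inj)

lemma inverse_ex:
  assumes "\<And>y. y \<in>\<^sub>m B \<Longrightarrow> \<exists>x. x \<in>\<^sub>m A \<and> app g x = y"
    "\<And>x y. x \<in>\<^sub>m A \<Longrightarrow> y \<in>\<^sub>m A \<Longrightarrow> app g x = app g y \<Longrightarrow> x = y"
  obtains h where "\<And>y. y \<in>\<^sub>m B \<Longrightarrow> app h y \<in>\<^sub>m A" "\<And>y. y \<in>\<^sub>m B \<Longrightarrow> app g (app h y) = y"
proof -
  have d: "definable (\<lambda>e. ehd e \<in>\<^sub>m A \<and> app g (ehd e) = ehd (etl e))" by (intro definable_intros)
  have 1: "\<exists>!x. x \<in>\<^sub>m A \<and> app g x = y" if y: "y \<in>\<^sub>m B" for y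
  proof -
    obtain x where x: "x \<in>\<^sub>m A" "app g x = y" using assms(1)[OF y] by blast
    show ?thesis
    proof (rule ex1I)
      show "x \<in>\<^sub>m A \<and> app g x = y" using x by simp
      show "z = x" if "z \<in>\<^sub>m A \<and> app g z = y" for z using assms(2)[of z x] x that by simp
    qed
  qed
  from fun_ex[OF d 1, of B] show ?thesis using that by blast
qed

lemma bij_sym:
  assumes "bij g A B" obtains h where "bij h B A"
proof -
  obtain h where h: "\<And>y. y \<in>\<^sub>m B \<Longrightarrow> app h y \<in>\<^sub>m A" "\<And>y. y \<in>\<^sub>m B \<Longrightarrow> app g (app h y) = y"
    using inverse_ex[OF bij_onto[OF assms] bij_inj[OF assms]] by blast
  have "bij h B A"
  proof (rule bijI)
    show "app h y \<in>\<^sub>m A" if "y \<in>\<^sub>m B" for y using h(1)[OF that] .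
    show "x = y" if xy: "x \<in>\<^sub>m B" "y \<in>\<^sub>m B" "app h x = app h y" for x y
      using h(2)[OF xy(1)] h(2)[OF xy(2)] unfolding xy(3) by (rule box_equals[OF refl])
    show "\<exists>x. x \<in>\<^sub>m B \<and> app h x = y" if y: "y \<in>\<^sub>m A" for y
    proof -
      have b: "app g y \<in>\<^sub>m B" using bij_mem[OF assms y] .
      have "app h (app g y) = y" by (rule bij_inj[OF assms h(1)[OF b] y h(2)[OF b]])
      then show ?thesis using b by blast
    qed
  qed
  then show ?thesis using that by blast
qed

lemma bij_injects': "bij g A B \<Longrightarrow> injects B A"
  using bij_sym bij_injects by metis

lemma iso_bij:
  assumes i: "iso S R a g" and "\<And>x y. x \<in>\<^sub>m S \<Longrightarrow> y \<in>\<^sub>m S \<Longrightarrow> R x y \<or> x = y \<or> R y x"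
  shows "bij g S a"
proof (rule bijI[OF iso_mem[OF i] _ iso_onto[OF i]])
  show "x = y" if xy: "x \<in>\<^sub>m S" "y \<in>\<^sub>m S" "app g x = app g y" for x y
    using assms(2)[OF xy(1,2)] iso_less[OF i xy(1,2)] iso_less[OF i xy(2,1)] xy(3) mem_irrefl by auto
qed

lemma iso_id_ex:
  assumes "Ord a" obtains g where "iso a (\<in>\<^sub>m) a g"
proof -
  have "definable_term (\<lambda>e. ehd e)" by (intro definable_intros)
  from fun_ex_term[OF this, of a] obtain g where g: "\<And>x. x \<in>\<^sub>m a \<Longrightarrow> app g x = x" by blast
  have "iso a (\<in>\<^sub>m) a g" by (rule isoI) (use g in auto)
  then show ?thesis using that by blast
qed

text \<open>The image of the injection is a set of ordinals; its order type is the required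
  \<open>n\<close>, and comparison with the identity on \<open>d\<close> bounds it.\<close>

lemma injects_Ord_bij:
  assumes "injects W d" "Ord d"
  obtains n h where "Ord n" "n \<preceq> d" "bij h n W"
proof -
  obtain f where f: "\<And>x. x \<in>\<^sub>m W \<Longrightarrow> app f x \<in>\<^sub>m d"
     "\<And>x y. x \<in>\<^sub>m W \<Longrightarrow> y \<in>\<^sub>m W \<Longrightarrow> app f x = app f y \<Longrightarrow> x = y" using injectsE[OF assms(1)] by metis
  obtain S where S: "\<And>y. y \<in>\<^sub>m S \<longleftrightarrow> (\<exists>x. x \<in>\<^sub>m W \<and> y = app f x)" using image_ex by metis
  have Sd: "y \<in>\<^sub>m d" if "y \<in>\<^sub>m S" for y using that[unfolded S] f(1) by auto
  have SO: "Ord y" if "y \<in>\<^sub>m S" for y using Ord_mem[OF assms(2) Sd[OF that]] .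
  obtain n g where n: "Ord n" "iso S (\<in>\<^sub>m) n g" using order_type_ordinals[OF SO] by metis
  obtain i where i: "iso d (\<in>\<^sub>m) d i" using iso_id_ex[OF assms(2)] .
  have le: "n \<preceq> d" using iso_mono[OF n(2) i n(1) assms(2) Sd] .
  have b1: "bij g S n" by (rule iso_bij[OF n(2)]) (use SO Ord_linear in blast)
  have "definable_term (\<lambda>e. app g (app f (ehd e)))" by (intro definable_intros)
  from fun_ex_term[OF this, of W] obtain k where k: "\<And>x. x \<in>\<^sub>m W \<Longrightarrow> app k x = app g (app f x)" by blast
  have fS: "app f x \<in>\<^sub>m S" if "x \<in>\<^sub>m W" for x using that S by blast
  have "bij k W n"
  proof (rule bijI)
    show "app k x \<in>\<^sub>m n" if "x \<in>\<^sub>m W" for x using k[OF that] bij_mem[OF b1 fS[OF that]] by simp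
    show "x = y" if "x \<in>\<^sub>m W" "y \<in>\<^sub>m W" "app k x = app k y" for x y
      by (rule f(2)[OF that(1,2)], rule bij_inj[OF b1 fS[OF that(1)] fS[OF that(2)]])
        (use k that in simp)
    show "\<exists>x. x \<in>\<^sub>m W \<and> app k x = y" if y: "y \<in>\<^sub>m n" for y
    proof -
      obtain s where "s \<in>\<^sub>m S" "app g s = y" using bij_onto[OF b1 y] by blast
      then obtain x where "x \<in>\<^sub>m W" "s = app f x" using S by blast
      then show ?thesis using k \<open>app g s = y\<close> by auto
    qed
  qed
  then obtain h where "bij h n W" by (rule bij_sym)
  then show ?thesis using that n(1) le by blast
qed

abbreviation Card :: "'a \<Rightarrow> bool" where "Card \<equiv> cardinal (\<in>\<^sub>m)"

text \<open>An injection of \<open>k\<close> into a smaller \<open>b\<close> collapses to a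
  bijection of \<open>k\<close> with some \<open>n\<close> at most \<open>b\<close>, which
  \<open>cardinal\<close> forbids. The form with injections composes more easily.\<close>

lemma Card_iff: "Card k \<longleftrightarrow> Ord k \<and> (\<forall>b. b \<in>\<^sub>m k \<longrightarrow> \<not> injects k b)"
proof
  assume c: "Card k"
  then have o: "Ord k" and nb: "\<And>b. b \<in>\<^sub>m k \<Longrightarrow> \<not> (\<exists>g. bij g b k)"
    unfolding cardinal_def bijection_iff_bij by blast+
  have "\<not> injects k b" if b: "b \<in>\<^sub>m k" for b
  proof
    assume l: "injects k b"
    have Ob: "Ord b" using Ord_mem[OF o b] .
    obtain n h where n: "n \<preceq> b" "bij h n k" using injects_Ord_bij[OF l Ob] by blast
    show False using nb[OF le_mem_trans[OF o n(1) b]] n(2) by blast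
  qed
  then show "Ord k \<and> (\<forall>b. b \<in>\<^sub>m k \<longrightarrow> \<not> injects k b)" using o by blast
next
  assume "Ord k \<and> (\<forall>b. b \<in>\<^sub>m k \<longrightarrow> \<not> injects k b)"
  then show "Card k" unfolding cardinal_def bijection_iff_bij using bij_injects' by blast
qed

lemma definable_Card [definable_intros]:
  assumes "definable_term t" shows "definable (\<lambda>e. Card (t e))"
  unfolding Card_iff by (intro definable_intros lift[OF assms])

text \<open>\<open>c\<close> is the least ordinal into which \<open>W\<close> injects. Collapsing
  the image in \<open>c\<close> cannot give anything smaller, so \<open>c\<close> itself is in
  bijection with \<open>W\<close>.\<close>

lemma equipollent_Card_ex:
  assumes "Ord n" "injects W n" obtains c where "Card c" "c \<preceq> n" "injects W c" "injects c W"
proof -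
  have d: "definable (\<lambda>e. injects W (ehd e))" by (intro definable_intros)
  obtain c where c: "Ord c" "injects W c" "\<And>z. z \<in>\<^sub>m c \<Longrightarrow> \<not> injects W z" using Ord_least[OF d assms] by blast
  have "\<not> n \<in>\<^sub>m c" using c(3) assms(2) by blast
  then have cn: "c \<preceq> n" using le_not_mem c(1) assms(1) by blast
  obtain m h where m: "Ord m" "m \<preceq> c" "bij h m W" using injects_Ord_bij[OF c(2,1)] .
  have "\<not> m \<in>\<^sub>m c" using c(3) bij_injects'[OF m(3)] by blast
  then have "m = c" using m(2) unfolding ord_le_def by blast
  then have "injects c W" using bij_injects[OF m(3)] by simp
  moreover have "Card c" unfolding Card_iff using c injects_trans by blast
  ultimately show ?thesis using that cn c(2) by blast
qed

text \<open>An ordinal injecting into \<open>X\<close> is the order type of a relation on a subset of \<open>X\<close>.\<close>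

lemma hartogs_ex: "\<exists>a. Ord a \<and> \<not> injects a X"
proof -
  obtain P where P: "\<And>y. y \<in>\<^sub>m P \<longleftrightarrow> (\<forall>z. z \<in>\<^sub>m y \<longrightarrow> z \<in>\<^sub>m X)" using power_set by metis
  obtain Q where Q: "\<And>y. y \<in>\<^sub>m Q \<longleftrightarrow> (\<forall>z. z \<in>\<^sub>m y \<longrightarrow> z \<in>\<^sub>m prod X X)" using power_set by metis
  \<comment> \<open>A pair \<open>p\<close> codes the relation \<open>psnd p\<close> on the subset
    \<open>pfst p\<close> of \<open>X\<close>. Order types are unique, so Replacement collects all
    of them in \<open>H\<close>.\<close>
  define T where "T p a \<longleftrightarrow> Ord a \<and> (\<exists>g. iso (pfst p) (\<lambda>x y. pr x y \<in>\<^sub>m psnd p) a g)" for p a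
  have dT: "definable (\<lambda>e. T (ehd (etl e)) (ehd e))"
    unfolding T_def iso_def by (intro definable_intros)
  have "\<exists>H. \<forall>a. a \<in>\<^sub>m H \<longleftrightarrow> (\<exists>p. p \<in>\<^sub>m prod P Q \<and> T p a)"
    by (rule Repl[OF dT]) (use iso_unique in \<open>unfold T_def, blast\<close>)
  then obtain H where H: "\<And>a. a \<in>\<^sub>m H \<longleftrightarrow> (\<exists>p. p \<in>\<^sub>m prod P Q \<and> T p a)" by blast
  have in_H: "a \<in>\<^sub>m H" if a: "Ord a" "injects a X" for a
  proof -
    obtain f where f: "\<And>x. x \<in>\<^sub>m a \<Longrightarrow> app f x \<in>\<^sub>m X"
     "\<And>x y. x \<in>\<^sub>m a \<Longrightarrow> y \<in>\<^sub>m a \<Longrightarrow> app f x = app f y \<Longrightarrow> x = y" using injectsE[OF a(2)] by metis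
    obtain S where S: "\<And>y. y \<in>\<^sub>m S \<longleftrightarrow> (\<exists>x. x \<in>\<^sub>m a \<and> y = app f x)" using image_ex by metis
    have d: "definable (\<lambda>e. \<exists>x y. x \<in>\<^sub>m a \<and> y \<in>\<^sub>m a \<and> x \<in>\<^sub>m y \<and> ehd e = pr (app f x) (app f y))"
      by (intro definable_intros)
    obtain r where r: "\<And>z. z \<in>\<^sub>m r \<longleftrightarrow> z \<in>\<^sub>m prod X X \<and> (\<exists>x y. x \<in>\<^sub>m a \<and> y \<in>\<^sub>m a \<and> x \<in>\<^sub>m y \<and> z = pr (app f x) (app f y))"
      using Sep[OF d, of "prod X X"] by blast
    obtain g where g: "\<And>y. y \<in>\<^sub>m S \<Longrightarrow> app g y \<in>\<^sub>m a" "\<And>y. y \<in>\<^sub>m S \<Longrightarrow> app f (app g y) = y"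
    proof (rule inverse_ex[of S a f])
      show "\<exists>x. x \<in>\<^sub>m a \<and> app f x = y" if "y \<in>\<^sub>m S" for y using that[unfolded S] by auto
    qed (use f(2) in blast)+
    have "iso S (\<lambda>x y. pr x y \<in>\<^sub>m r) a g"
    proof (rule isoI[OF g(1)])
      show "\<exists>y. y \<in>\<^sub>m S \<and> app g y = z" if z: "z \<in>\<^sub>m a" for z
      proof -
        have s: "app f z \<in>\<^sub>m S" using S z by blast
        have "app g (app f z) = z" by (rule f(2)[OF g(1)[OF s] z g(2)[OF s]])
        then show ?thesis using s by blast
      qed
      show "pr y y' \<in>\<^sub>m r \<longleftrightarrow> app g y \<in>\<^sub>m app g y'" if y: "y \<in>\<^sub>m S" "y' \<in>\<^sub>m S" for y y'
      proof
        assume "pr y y' \<in>\<^sub>m r"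
        then obtain u v where uv: "u \<in>\<^sub>m a" "v \<in>\<^sub>m a" "u \<in>\<^sub>m v" "y = app f u" "y' = app f v"
          unfolding r by auto
        have "app g y = u" "app g y' = v"
          using f(2)[OF g(1)[OF y(1)] uv(1)] f(2)[OF g(1)[OF y(2)] uv(2)] g(2)[OF y(1)] g(2)[OF y(2)] uv by auto
        then show "app g y \<in>\<^sub>m app g y'" using uv by simp
      next
        assume *: "app g y \<in>\<^sub>m app g y'"
        have "pr y y' = pr (app f (app g y)) (app f (app g y'))" using g(2) y by simp
        moreover have "y \<in>\<^sub>m X" "y' \<in>\<^sub>m X" using f(1)[OF g(1)[OF y(1)]] f(1)[OF g(1)[OF y(2)]] g(2) y by auto
        ultimately show "pr y y' \<in>\<^sub>m r" unfolding r using g(1) y * pr_mem_prod by blast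
      qed
    qed
    then have "T (pr S r) a" unfolding T_def using a(1) by auto
    moreover have "S \<in>\<^sub>m P" unfolding P using S f(1) by auto
    moreover have "r \<in>\<^sub>m Q" unfolding Q using r by blast
    ultimately show ?thesis unfolding H using pr_mem_prod by blast
  qed
  obtain U where U: "\<forall>z. z \<in>\<^sub>m U \<longleftrightarrow> (\<exists>y. y \<in>\<^sub>m H \<and> z \<in>\<^sub>m y)" using union by blast
  have "Ord U" by (rule Ord_Union[OF U]) (use H in \<open>unfold T_def, blast\<close>)
  \<comment> \<open>The union \<open>U\<close> may itself belong to \<open>H\<close>; its successor
    cannot, since \<open>U\<close> would then be a member of \<open>U\<close>.\<close>
  have "suc U \<in>\<^sub>m H \<Longrightarrow> U \<in>\<^sub>m U" using U mem_suc by blast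
  then have "\<not> injects (suc U) X" using in_H[OF Ord_suc[OF \<open>Ord U\<close>]] mem_irrefl by blast
  then show ?thesis using Ord_suc[OF \<open>Ord U\<close>] by blast
qed

section \<open>Basic properties of Hartogs numbers\<close>

lemma hartogs_eq: "hartogs (\<in>\<^sub>m) X = least_ordinal (\<in>\<^sub>m) (\<lambda>a. \<not> injects a X)"
  unfolding hartogs_def injects_iff_injection ..

lemma hartogs_props:
  shows Ord_hartogs: "Ord (hartogs (\<in>\<^sub>m) X)"
    and hartogs_not_injects: "\<not> injects (hartogs (\<in>\<^sub>m) X) X"
    and mem_hartogs_injects: "b \<in>\<^sub>m hartogs (\<in>\<^sub>m) X \<Longrightarrow> injects b X"
proof -
  have d: "definable (\<lambda>e. \<not> injects (ehd e) X)" by (intro definable_intros)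
  obtain a where a: "Ord a" "\<not> injects a X" using hartogs_ex by blast
  note * = least_ordinal_props[OF d a, folded hartogs_eq]
  show "Ord (hartogs (\<in>\<^sub>m) X)" "\<not> injects (hartogs (\<in>\<^sub>m) X) X" "b \<in>\<^sub>m hartogs (\<in>\<^sub>m) X \<Longrightarrow> injects b X"
    using *(1,2) *(3)[of b] by blast+
qed

lemma hartogs_eqI:
  assumes "Ord a" "\<not> injects a X" "\<And>b. b \<in>\<^sub>m a \<Longrightarrow> injects b X" shows "hartogs (\<in>\<^sub>m) X = a"
  unfolding hartogs_eq by (rule least_ordinal_eqI) (use assms in auto)

lemma mem_hartogs_iff: "Ord b \<Longrightarrow> b \<in>\<^sub>m hartogs (\<in>\<^sub>m) X \<longleftrightarrow> injects b X"
  using mem_hartogs_injects[of b X] hartogs_not_injects[of X] le_not_mem[OF Ord_hartogs, of b X]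
    injects_of_le[of b "hartogs (\<in>\<^sub>m) X"] injects_trans[of "hartogs (\<in>\<^sub>m) X" b X] by blast

lemma Card_hartogs: "Card (hartogs (\<in>\<^sub>m) X)"
  unfolding Card_iff using Ord_hartogs mem_hartogs_injects hartogs_not_injects injects_trans by blast

lemma emp_mem_hartogs: "emp \<in>\<^sub>m hartogs (\<in>\<^sub>m) X"
  unfolding mem_hartogs_iff[OF Ord_emp] by (rule injects_subset) simp

lemma self_mem_hartogs: "Ord b \<Longrightarrow> b \<in>\<^sub>m hartogs (\<in>\<^sub>m) b"
  unfolding mem_hartogs_iff by (rule injects_refl)

section \<open>Surjections and Lindenbaum numbers\<close>

definition surjects :: "'a \<Rightarrow> 'a \<Rightarrow> bool" where
  "surjects A B \<longleftrightarrow> (\<exists>g. (\<forall>x. x \<in>\<^sub>m A \<longrightarrow> app g x \<in>\<^sub>m B) \<and> (\<forall>y. y \<in>\<^sub>m B \<longrightarrow> (\<exists>x. x \<in>\<^sub>m A \<and> app g x = y)))"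

lemma definable_surjects [definable_intros]:
  assumes "definable_term t" "definable_term s" shows "definable (\<lambda>e. surjects (t e) (s e))"
  unfolding surjects_def by (intro definable_intros lift[OF assms(1)] lift[OF assms(2)])

lemma surjects_of_injects:
  assumes "injects B A" "y0 \<in>\<^sub>m B" shows "surjects A B"
proof -
  obtain f where f: "\<And>x. x \<in>\<^sub>m B \<Longrightarrow> app f x \<in>\<^sub>m A"
     "\<And>x y. x \<in>\<^sub>m B \<Longrightarrow> y \<in>\<^sub>m B \<Longrightarrow> app f x = app f y \<Longrightarrow> x = y" using injectsE[OF assms(1)] by metis
  \<comment> \<open>A left inverse of \<open>f\<close>, with the default value \<open>y0\<close> off
    the range.\<close>
  define R where "R x y \<longleftrightarrow> (y \<in>\<^sub>m B \<and> app f y = x) \<or> (\<not> (\<exists>y. y \<in>\<^sub>m B \<and> app f y = x) \<and> y = y0)" for x y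
  have d: "definable (\<lambda>e. R (ehd (etl e)) (ehd e))" unfolding R_def by (intro definable_intros)
  have 1: "\<exists>!y. R x y" for x
  proof (cases "\<exists>y. y \<in>\<^sub>m B \<and> app f y = x")
    case True
    then obtain y where y: "y \<in>\<^sub>m B" "app f y = x" by blast
    show ?thesis
    proof (rule ex1I)
      show "R x y" unfolding R_def using y by simp
      show "z = y" if "R x z" for z
      proof -
        have "z \<in>\<^sub>m B" "app f z = x" using \<open>R x z\<close> y unfolding R_def by blast+
        then show ?thesis using f(2)[of z y] y by simp
      qed
    qed
  qed (auto simp: R_def)
  obtain g where g: "\<And>x. x \<in>\<^sub>m A \<Longrightarrow> R x (app g x)" using fun_ex[OF d 1, of A] by blast
  show ?thesis unfolding surjects_def
  proof (rule exI[of _ g], intro conjI allI impI)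
    show "app g x \<in>\<^sub>m B" if "x \<in>\<^sub>m A" for x using g[OF that] assms(2) unfolding R_def by auto
    show "\<exists>x. x \<in>\<^sub>m A \<and> app g x = y" if y: "y \<in>\<^sub>m B" for y
    proof -
      have "R (app f y) y" unfolding R_def using y by blast
      then have "app g (app f y) = y" using 1 g[OF f(1)[OF y]] by blast
      then show ?thesis using f(1)[OF y] by blast
    qed
  qed
qed

text \<open>Each value goes to its fibre; fibres of a surjection are non-empty and so determine
  their value. Hence the Hartogs number of the power set is an ordinal onto which \<open>X\<close>
  does not map, and the Lindenbaum number exists.\<close>

lemma surjects_injects_Pow:
  assumes "surjects X a" "\<And>y. y \<in>\<^sub>m P \<longleftrightarrow> (\<forall>z. z \<in>\<^sub>m y \<longrightarrow> z \<in>\<^sub>m X)" shows "injects a P"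
proof -
  obtain g where g: "\<And>y. y \<in>\<^sub>m a \<Longrightarrow> \<exists>x. x \<in>\<^sub>m X \<and> app g x = y"
    using assms(1) unfolding surjects_def by blast
  show ?thesis
  proof (rule injects_rel)
    show "definable (\<lambda>e. \<forall>x. x \<in>\<^sub>m ehd e \<longleftrightarrow> x \<in>\<^sub>m X \<and> app g x = ehd (etl e))" by (intro definable_intros)
    show "\<exists>!y. \<forall>x. x \<in>\<^sub>m y \<longleftrightarrow> x \<in>\<^sub>m X \<and> app g x = z" if "z \<in>\<^sub>m a" for z
    proof -
      have "definable (\<lambda>e. app g (ehd e) = z)" by (intro definable_intros)
      from Sep[OF this, of X] obtain S where S: "\<forall>x. x \<in>\<^sub>m S \<longleftrightarrow> x \<in>\<^sub>m X \<and> app g x = z" by blast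
      show ?thesis by (rule ex1I[of _ S]) (use S in \<open>auto intro: ext_eq\<close>)
    qed
    show "y \<in>\<^sub>m P" if "\<forall>x. x \<in>\<^sub>m y \<longleftrightarrow> x \<in>\<^sub>m X \<and> app g x = z" for z y
      unfolding assms(2) using that by blast
    show "z = z'" if z: "z \<in>\<^sub>m a" and y: "\<forall>x. x \<in>\<^sub>m y \<longleftrightarrow> x \<in>\<^sub>m X \<and> app g x = z"
      "\<forall>x. x \<in>\<^sub>m y \<longleftrightarrow> x \<in>\<^sub>m X \<and> app g x = z'" for z z' y
    proof -
      obtain x where "x \<in>\<^sub>m X" "app g x = z" using g[OF z] by blast
      then have "x \<in>\<^sub>m y" using y(1) by blast
      then have "app g x = z'" using y(2) by blast
      then show ?thesis using \<open>app g x = z\<close> by simp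
    qed
  qed
qed

lemma lindenbaum_eq:
  "lindenbaum (\<in>\<^sub>m) X = least_ordinal (\<in>\<^sub>m) (\<lambda>a. (\<exists>z. z \<in>\<^sub>m a) \<and> \<not> surjects X a)"
  unfolding lindenbaum_def surjection_iff nonempty_def surjects_def ..

lemma lindenbaum_props:
  shows Ord_lindenbaum: "Ord (lindenbaum (\<in>\<^sub>m) X)"
    and lindenbaum_nonempty: "\<exists>z. z \<in>\<^sub>m lindenbaum (\<in>\<^sub>m) X"
    and lindenbaum_not_surjects: "\<not> surjects X (lindenbaum (\<in>\<^sub>m) X)"
proof -
  have d: "definable (\<lambda>e. (\<exists>z. z \<in>\<^sub>m ehd e) \<and> \<not> surjects X (ehd e))" by (intro definable_intros)
  obtain P where P: "\<And>y. y \<in>\<^sub>m P \<longleftrightarrow> (\<forall>z. z \<in>\<^sub>m y \<longrightarrow> z \<in>\<^sub>m X)" using power_set by metis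
  have a: "(\<exists>z. z \<in>\<^sub>m hartogs (\<in>\<^sub>m) P) \<and> \<not> surjects X (hartogs (\<in>\<^sub>m) P)"
    using emp_mem_hartogs surjects_injects_Pow[OF _ P] hartogs_not_injects by blast
  note * = least_ordinal_props[OF d Ord_hartogs a, folded lindenbaum_eq]
  show "Ord (lindenbaum (\<in>\<^sub>m) X)" "\<exists>z. z \<in>\<^sub>m lindenbaum (\<in>\<^sub>m) X" "\<not> surjects X (lindenbaum (\<in>\<^sub>m) X)"
    using *(1,2) by blast+
qed

lemma hartogs_le_lindenbaum: "hartogs (\<in>\<^sub>m) X \<preceq> lindenbaum (\<in>\<^sub>m) X"
  using le_not_mem[OF Ord_hartogs Ord_lindenbaum] mem_hartogs_injects surjects_of_injects
    lindenbaum_nonempty lindenbaum_not_surjects by blast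

text \<open>A non-empty ordinal below the Hartogs number injects into \<open>X\<close> and is
  therefore an image of \<open>X\<close>, so nothing smaller is a candidate.\<close>

lemma lindenbaum_eq_hartogsI:
  assumes "\<not> surjects X (hartogs (\<in>\<^sub>m) X)" shows "lindenbaum (\<in>\<^sub>m) X = hartogs (\<in>\<^sub>m) X"
  unfolding lindenbaum_eq
  by (rule least_ordinal_eqI[OF Ord_hartogs])
    (use assms emp_mem_hartogs mem_hartogs_injects surjects_of_injects in blast)+

section \<open>Finite sets and squares of ordinals\<close>


lemma natural_number_iff:
  "natural_number (\<in>\<^sub>m) n \<longleftrightarrow> (\<forall>I. emp \<in>\<^sub>m I \<and> (\<forall>x. x \<in>\<^sub>m I \<longrightarrow> suc x \<in>\<^sub>m I) \<longrightarrow> n \<in>\<^sub>m I)"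
proof -
  have "\<not> nonempty (\<in>\<^sub>m) z \<longleftrightarrow> z = emp" for z unfolding nonempty_def eq_emp_iff by blast
  moreover have "(\<forall>y. y \<in>\<^sub>m s \<longleftrightarrow> y \<in>\<^sub>m x \<or> y = x) \<longleftrightarrow> s = suc x" for s x
    by (rule eq_suc_iff[symmetric])
  ultimately show ?thesis unfolding natural_number_def by simp
qed

definition omega :: 'a where
  "omega = (THE w. \<forall>n. n \<in>\<^sub>m w \<longleftrightarrow> natural_number (\<in>\<^sub>m) n)"

lemma mem_omega: "n \<in>\<^sub>m omega \<longleftrightarrow> natural_number (\<in>\<^sub>m) n"
proof -
  obtain I where I: "\<exists>z. z \<in>\<^sub>m I \<and> (\<forall>y. \<not> y \<in>\<^sub>m z)"
    "\<forall>x. x \<in>\<^sub>m I \<longrightarrow> (\<exists>s. s \<in>\<^sub>m I \<and> (\<forall>y. y \<in>\<^sub>m s \<longleftrightarrow> y \<in>\<^sub>m x \<or> y = x))" using infinity by blast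
  have I': "emp \<in>\<^sub>m I" "x \<in>\<^sub>m I \<Longrightarrow> suc x \<in>\<^sub>m I" for x
    using I unfolding eq_emp_iff[symmetric] eq_suc_iff[symmetric] by auto
  have "definable (\<lambda>e. natural_number (\<in>\<^sub>m) (ehd e))"
    unfolding natural_number_iff by (intro definable_intros)
  from Sep[OF this, of I] obtain w where w: "\<And>n. n \<in>\<^sub>m w \<longleftrightarrow> n \<in>\<^sub>m I \<and> natural_number (\<in>\<^sub>m) n" by blast
  have "natural_number (\<in>\<^sub>m) n \<Longrightarrow> n \<in>\<^sub>m I" for n using I' unfolding natural_number_iff by blast
  then have w': "\<forall>n. n \<in>\<^sub>m w \<longleftrightarrow> natural_number (\<in>\<^sub>m) n" using w by blast
  have "omega = w" unfolding omega_def by (rule the_equality) (use w' in \<open>auto intro: ext_eq\<close>)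
  then show ?thesis using w' by simp
qed

lemma emp_mem_omega: "emp \<in>\<^sub>m omega"
  unfolding mem_omega natural_number_iff by blast

lemma suc_mem_omega: "n \<in>\<^sub>m omega \<Longrightarrow> suc n \<in>\<^sub>m omega"
  unfolding mem_omega natural_number_iff by blast

lemma omega_induct:
  assumes P: "definable (\<lambda>e. P (ehd e))" and n: "n \<in>\<^sub>m omega" and "P emp"
    and "\<And>k. k \<in>\<^sub>m omega \<Longrightarrow> P k \<Longrightarrow> P (suc k)"
  shows "P n"
proof -
  obtain I where I: "\<And>x. x \<in>\<^sub>m I \<longleftrightarrow> x \<in>\<^sub>m omega \<and> P x" using Sep[OF P, of omega] by blast
  have "emp \<in>\<^sub>m I" unfolding I using assms(3) emp_mem_omega by blast
  moreover have "\<forall>x. x \<in>\<^sub>m I \<longrightarrow> suc x \<in>\<^sub>m I" unfolding I using assms(4) suc_mem_omega by blast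
  ultimately have "n \<in>\<^sub>m I" using n[unfolded mem_omega natural_number_iff] by simp
  then show ?thesis using I by blast
qed

lemma Ord_omega: "Ord omega"
proof (rule OrdI)
  show "Ord n" if n: "n \<in>\<^sub>m omega" for n
    by (rule omega_induct[OF _ n]) (intro definable_intros Ord_emp Ord_suc | assumption)+
  show "k \<in>\<^sub>m omega" if k: "k \<in>\<^sub>m n" and n: "n \<in>\<^sub>m omega" for n k
  proof -
    have d: "definable (\<lambda>e. \<forall>k. k \<in>\<^sub>m ehd e \<longrightarrow> k \<in>\<^sub>m omega)" by (intro definable_intros)
    have "\<forall>k. k \<in>\<^sub>m n \<longrightarrow> k \<in>\<^sub>m omega" by (rule omega_induct[OF d n]) auto
    then show ?thesis using k by blast
  qed
qed

section \<open>Pigeonhole principle and finiteness\<close>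

lemma not_injects_suc_nat:
  assumes n: "n \<in>\<^sub>m omega" shows "\<not> injects (suc n) n"
proof -
  have d: "definable (\<lambda>e. \<not> injects (suc (ehd e)) (ehd e))" by (intro definable_intros)
  show ?thesis
  proof (rule omega_induct[OF d n])
    show "\<not> injects (suc emp) emp"
    proof
      assume "injects (suc emp) emp"
      then obtain g where "\<And>x. x \<in>\<^sub>m suc emp \<Longrightarrow> app g x \<in>\<^sub>m emp" by (rule injectsE) blast
      then show False using mem_suc not_mem_emp by blast
    qed
  next
    fix k assume k: "\<not> injects (suc k) k"
    show "\<not> injects (suc (suc k)) (suc k)"
    proof
      assume "injects (suc (suc k)) (suc k)"
      then obtain g where g: "\<And>x. x \<in>\<^sub>m suc (suc k) \<Longrightarrow> app g x \<in>\<^sub>m suc k"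
        "\<And>x y. x \<in>\<^sub>m suc (suc k) \<Longrightarrow> y \<in>\<^sub>m suc (suc k) \<Longrightarrow> app g x = app g y \<Longrightarrow> x = y" by (rule injectsE) blast
      \<comment> \<open>The argument \<open>suc k\<close> and the value \<open>k\<close> are removed
        together: an argument sent to \<open>k\<close> takes over the value that
        \<open>suc k\<close> had.\<close>
      define R where "R x y \<longleftrightarrow> (app g x = k \<and> y = app g (suc k)) \<or> (app g x \<noteq> k \<and> y = app g x)" for x y
      have ne: "x \<noteq> suc k" if "x \<in>\<^sub>m suc k" for x using that mem_irrefl by blast
      have s: "suc k \<in>\<^sub>m suc (suc k)" "\<And>x. x \<in>\<^sub>m suc k \<Longrightarrow> x \<in>\<^sub>m suc (suc k)" by simp_all
      have "injects (suc k) k"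
      proof (rule injects_rel)
        show "definable (\<lambda>e. R (ehd (etl e)) (ehd e))" unfolding R_def by (intro definable_intros)
        show "\<exists>!y. R x y" for x unfolding R_def by auto
        show "y \<in>\<^sub>m k" if x: "x \<in>\<^sub>m suc k" and r: "R x y" for x y
        proof (cases "app g x = k")
          case True
          then have y: "y = app g (suc k)" using r unfolding R_def by blast
          have "y \<noteq> k" using g(2)[OF s(2)[OF x] s(1)] ne[OF x] True y by auto
          then show ?thesis using g(1)[OF s(1)] y by simp
        next
          case False
          then show ?thesis using r g(1)[OF s(2)[OF x]] unfolding R_def by auto
        qed
        show "x = x'" if x: "x \<in>\<^sub>m suc k" "x' \<in>\<^sub>m suc k" "R x y" "R x' y" for x x' y
        proof -
          note 1 = g(2)[OF s(2)[OF x(1)] s(2)[OF x(2)]] g(2)[OF s(2)[OF x(1)] s(1)] g(2)[OF s(2)[OF x(2)] s(1)]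
          show ?thesis using x(3,4) 1 ne[OF x(1)] ne[OF x(2)] unfolding R_def by metis
        qed
      qed
      then show False using k by blast
    qed
  qed
qed

lemma not_injects_omega_nat: "n \<in>\<^sub>m omega \<Longrightarrow> \<not> injects omega n"
  using not_injects_suc_nat injects_trans[OF injects_of_le[OF Ord_omega]] suc_mem_omega unfolding ord_le_def by blast

text \<open>Being dominated by a natural number passes along injections without computing an exact
  size.\<close>

definition finite_in_model :: "'a \<Rightarrow> bool" where
  "finite_in_model A \<longleftrightarrow> (\<exists>n. n \<in>\<^sub>m omega \<and> injects A n)"

lemma definable_finite_in_model [definable_intros]:
  assumes "definable_term t" shows "definable (\<lambda>e. finite_in_model (t e))"
  unfolding finite_in_model_def by (intro definable_intros lift[OF assms])

lemma finite_in_model_injects: "finite_in_model B \<Longrightarrow> injects A B \<Longrightarrow> finite_in_model A"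
  unfolding finite_in_model_def using injects_trans by blast

lemma injects_add_point:
  assumes "injects A n" "\<And>x. x \<in>\<^sub>m B \<Longrightarrow> x \<noteq> b \<Longrightarrow> x \<in>\<^sub>m A" shows "injects B (suc n)"
proof -
  obtain g where g: "\<And>x. x \<in>\<^sub>m A \<Longrightarrow> app g x \<in>\<^sub>m n"
    "\<And>x y. x \<in>\<^sub>m A \<Longrightarrow> y \<in>\<^sub>m A \<Longrightarrow> app g x = app g y \<Longrightarrow> x = y" using injectsE[OF assms(1)] by metis
  define R where "R x y \<longleftrightarrow> (x = b \<and> y = n) \<or> (x \<noteq> b \<and> y = app g x)" for x y
  show ?thesis
  proof (rule injects_rel)
    show "definable (\<lambda>e. R (ehd (etl e)) (ehd e))" unfolding R_def by (intro definable_intros)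
    show "\<exists>!y. R x y" for x unfolding R_def by auto
    show "y \<in>\<^sub>m suc n" if "x \<in>\<^sub>m B" "R x y" for x y
      using that assms(2)[of x] g(1)[of x] unfolding R_def by auto
    show "x = x'" if x: "x \<in>\<^sub>m B" "x' \<in>\<^sub>m B" "R x y" "R x' y" for x x' y
      using x(3,4) assms(2)[OF x(1)] assms(2)[OF x(2)] g(1)[of x] g(1)[of x'] g(2)[of x x'] mem_irrefl[of n]
      unfolding R_def by metis
  qed
qed

lemma finite_in_model_add_point:
  assumes "finite_in_model A" "\<And>x. x \<in>\<^sub>m B \<Longrightarrow> x \<noteq> b \<Longrightarrow> x \<in>\<^sub>m A" shows "finite_in_model B"
  using assms(1) injects_add_point[OF _ assms(2)] suc_mem_omega unfolding finite_in_model_def by blast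

lemma finite_in_model_prod_nat:
  assumes k: "k \<in>\<^sub>m omega" and n: "n \<in>\<^sub>m omega" shows "finite_in_model (prod k n)"
proof -
  have d: "definable (\<lambda>e. finite_in_model (prod (ehd e) n))" by (intro definable_intros)
  show ?thesis
  proof (rule omega_induct[OF d k])
    show "finite_in_model (prod emp n)" unfolding finite_in_model_def
      using emp_mem_omega injects_subset[of "prod emp n" emp] mem_prod not_mem_emp by blast
  next
    fix i assume i: "finite_in_model (prod i n)"
    \<comment> \<open>The new row \<open>i\<close> is added point by point. Quantifying over every
      \<open>B\<close> inside the old rows and an initial part of the new one lets the inner
      induction delete a single point.\<close>
    have d2: "definable (\<lambda>e. \<forall>B. (\<forall>x. x \<in>\<^sub>m B \<longrightarrow> x \<in>\<^sub>m prod i n \<or> (\<exists>j. j \<in>\<^sub>m ehd e \<and> x = pr i j)) \<longrightarrow> finite_in_model B)"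
      by (intro definable_intros)
    have "\<forall>B. (\<forall>x. x \<in>\<^sub>m B \<longrightarrow> x \<in>\<^sub>m prod i n \<or> (\<exists>j. j \<in>\<^sub>m n \<and> x = pr i j)) \<longrightarrow> finite_in_model B"
    proof (rule omega_induct[OF d2 n])
      show "\<forall>B. (\<forall>x. x \<in>\<^sub>m B \<longrightarrow> x \<in>\<^sub>m prod i n \<or> (\<exists>j. j \<in>\<^sub>m emp \<and> x = pr i j)) \<longrightarrow> finite_in_model B"
        using finite_in_model_injects[OF i] injects_subset by auto
    next
      fix m assume m: "\<forall>B. (\<forall>x. x \<in>\<^sub>m B \<longrightarrow> x \<in>\<^sub>m prod i n \<or> (\<exists>j. j \<in>\<^sub>m m \<and> x = pr i j)) \<longrightarrow> finite_in_model B"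
      show "\<forall>B. (\<forall>x. x \<in>\<^sub>m B \<longrightarrow> x \<in>\<^sub>m prod i n \<or> (\<exists>j. j \<in>\<^sub>m suc m \<and> x = pr i j)) \<longrightarrow> finite_in_model B"
      proof (intro allI impI)
        fix B assume B: "\<forall>x. x \<in>\<^sub>m B \<longrightarrow> x \<in>\<^sub>m prod i n \<or> (\<exists>j. j \<in>\<^sub>m suc m \<and> x = pr i j)"
        have "definable (\<lambda>e. ehd e \<noteq> pr i m)" by (intro definable_intros)
        from Sep[OF this, of B] obtain C where C: "\<And>x. x \<in>\<^sub>m C \<longleftrightarrow> x \<in>\<^sub>m B \<and> x \<noteq> pr i m" by blast
        have "\<forall>x. x \<in>\<^sub>m C \<longrightarrow> x \<in>\<^sub>m prod i n \<or> (\<exists>j. j \<in>\<^sub>m m \<and> x = pr i j)"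
          using B C by auto
        then have "finite_in_model C" using m by blast
        then show "finite_in_model B" by (rule finite_in_model_add_point[of C B "pr i m"]) (use C in blast)
      qed
    qed
    moreover have "\<forall>x. x \<in>\<^sub>m prod (suc i) n \<longrightarrow> x \<in>\<^sub>m prod i n \<or> (\<exists>j. j \<in>\<^sub>m n \<and> x = pr i j)"
      by (auto simp: mem_prod)
    ultimately show "finite_in_model (prod (suc i) n)" by blast
  qed
qed

lemma not_injects_omega_finite_in_model: "finite_in_model A \<Longrightarrow> \<not> injects omega A"
  unfolding finite_in_model_def using not_injects_omega_nat injects_trans by blast

lemma injects_suc_infinite:
  assumes "Ord m" "omega \<preceq> m" shows "injects (suc m) m"
proof -
  \<comment> \<open>Hilbert's hotel: the new point \<open>m\<close> goes to \<open>emp\<close>,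
    natural numbers move up by one, and everything else stays.\<close>
  define R where "R x y \<longleftrightarrow> (x = m \<and> y = emp) \<or> (x \<noteq> m \<and> x \<in>\<^sub>m omega \<and> y = suc x) \<or>
    (x \<noteq> m \<and> \<not> x \<in>\<^sub>m omega \<and> y = x)" for x y
  have om: "x \<in>\<^sub>m omega \<Longrightarrow> x \<in>\<^sub>m m" for x using mem_le_trans[OF assms(1) _ assms(2)] .
  have ne: "emp \<noteq> suc x" "suc x \<noteq> emp" for x using mem_suc not_mem_emp by metis+
  have inj: "x = y" if "suc x = suc y" for x y using that mem_suc mem_asym by metis
  show ?thesis
  proof (rule injects_rel)
    show "definable (\<lambda>e. R (ehd (etl e)) (ehd e))" unfolding R_def by (intro definable_intros)
    show "\<exists>!y. R x y" for x unfolding R_def by auto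
    show "y \<in>\<^sub>m m" if "x \<in>\<^sub>m suc m" "R x y" for x y
      using that om emp_mem_omega suc_mem_omega unfolding R_def by auto
    show "x = x'" if x: "R x y" "R x' y" for x x' y
      using x ne inj emp_mem_omega suc_mem_omega unfolding R_def by metis
  qed
qed

section \<open>Goedel's well-ordering of pairs\<close>

definition pair_max :: "'a \<Rightarrow> 'a" where
  "pair_max p = (if pfst p \<in>\<^sub>m psnd p then psnd p else pfst p)"

lemma definable_term_pair_max [definable_intros]:
  assumes "definable_term t" shows "definable_term (\<lambda>e. pair_max (t e))"
proof -
  have "z = pair_max p \<longleftrightarrow> (pfst p \<in>\<^sub>m psnd p \<and> z = psnd p) \<or> (\<not> pfst p \<in>\<^sub>m psnd p \<and> z = pfst p)" for z p
    unfolding pair_max_def by simp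
  then show ?thesis unfolding definable_term_def
    by (simp only:) (intro definable_intros lift[OF assms])
qed

definition goedel_less :: "'a \<Rightarrow> 'a \<Rightarrow> bool" where
  "goedel_less p q \<longleftrightarrow> pair_max p \<in>\<^sub>m pair_max q \<or> pair_max p = pair_max q \<and> (pfst p \<in>\<^sub>m pfst q \<or> pfst p = pfst q \<and> psnd p \<in>\<^sub>m psnd q)"

lemma definable_goedel_less [definable_intros]:
  assumes "definable_term t" "definable_term s" shows "definable (\<lambda>e. goedel_less (t e) (s e))"
  unfolding goedel_less_def by (intro definable_intros lift[OF assms(1)] lift[OF assms(2)])

lemma prod_mem_cases:
  assumes "p \<in>\<^sub>m prod c d" shows "pfst p \<in>\<^sub>m c" "psnd p \<in>\<^sub>m d" "p = pr (pfst p) (psnd p)"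
  using assms unfolding mem_prod by auto

lemma well_orders_goedel_less:
  assumes c: "Ord c" shows "well_orders (\<in>\<^sub>m) goedel_less (prod c c)"
proof -
  have O: "Ord (pfst p)" "Ord (psnd p)" "Ord (pair_max p)" if "p \<in>\<^sub>m prod c c" for p
    using prod_mem_cases[OF that] Ord_mem[OF c] unfolding pair_max_def by auto
  have eq: "p = q" if "p \<in>\<^sub>m prod c c" "q \<in>\<^sub>m prod c c" "pfst p = pfst q" "psnd p = psnd q" for p q
    using prod_mem_cases(3)[OF that(1)] prod_mem_cases(3)[OF that(2)] that(3,4) by simp
  show ?thesis
  proof (rule well_ordersI)
    show "\<not> goedel_less p p" for p unfolding goedel_less_def using mem_irrefl by blast
    show "goedel_less p r" if pqr: "p \<in>\<^sub>m prod c c" "q \<in>\<^sub>m prod c c" "r \<in>\<^sub>m prod c c" "goedel_less p q" "goedel_less q r" for p q r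
      using that(4,5) Ord_trans[OF O(1)[OF pqr(3)], of "pfst p" "pfst q"]
        Ord_trans[OF O(2)[OF pqr(3)], of "psnd p" "psnd q"] Ord_trans[OF O(3)[OF pqr(3)], of "pair_max p" "pair_max q"]
      unfolding goedel_less_def by auto
    show "goedel_less p q \<or> p = q \<or> goedel_less q p" if pq: "p \<in>\<^sub>m prod c c" "q \<in>\<^sub>m prod c c" for p q
      using Ord_linear[OF O(1)[OF pq(1)] O(1)[OF pq(2)]] Ord_linear[OF O(2)[OF pq(1)] O(2)[OF pq(2)]]
        Ord_linear[OF O(3)[OF pq(1)] O(3)[OF pq(2)]] eq[OF pq] unfolding goedel_less_def by auto
  next
    fix S assume S: "\<And>z. z \<in>\<^sub>m S \<Longrightarrow> z \<in>\<^sub>m prod c c" "\<exists>z. z \<in>\<^sub>m S"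
    then obtain p0 where p0: "p0 \<in>\<^sub>m S" by blast
    \<comment> \<open>The least element is found by minimising the maximum, then the first and then
      the second coordinate.\<close>
    have d1: "definable (\<lambda>e. \<exists>p. p \<in>\<^sub>m S \<and> pair_max p = ehd e)" by (intro definable_intros)
    obtain m1 where m1: "\<exists>p. p \<in>\<^sub>m S \<and> pair_max p = m1" "\<And>z. z \<in>\<^sub>m m1 \<Longrightarrow> \<not> (\<exists>p. p \<in>\<^sub>m S \<and> pair_max p = z)"
      using Ord_least[OF d1 O(3)[OF S(1)[OF p0]]] p0 by blast
    then obtain p1 where p1: "p1 \<in>\<^sub>m S" "pair_max p1 = m1" by blast
    have d2: "definable (\<lambda>e. \<exists>p. p \<in>\<^sub>m S \<and> pair_max p = m1 \<and> pfst p = ehd e)" by (intro definable_intros)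
    obtain m2 where m2: "\<exists>p. p \<in>\<^sub>m S \<and> pair_max p = m1 \<and> pfst p = m2"
      "\<And>z. z \<in>\<^sub>m m2 \<Longrightarrow> \<not> (\<exists>p. p \<in>\<^sub>m S \<and> pair_max p = m1 \<and> pfst p = z)"
      using Ord_least[OF d2 O(1)[OF S(1)[OF p1(1)]]] p1 by blast
    then obtain p2 where p2: "p2 \<in>\<^sub>m S" "pair_max p2 = m1" "pfst p2 = m2" by blast
    have d3: "definable (\<lambda>e. \<exists>p. p \<in>\<^sub>m S \<and> pair_max p = m1 \<and> pfst p = m2 \<and> psnd p = ehd e)" by (intro definable_intros)
    obtain m3 where m3: "\<exists>p. p \<in>\<^sub>m S \<and> pair_max p = m1 \<and> pfst p = m2 \<and> psnd p = m3"
      "\<And>z. z \<in>\<^sub>m m3 \<Longrightarrow> \<not> (\<exists>p. p \<in>\<^sub>m S \<and> pair_max p = m1 \<and> pfst p = m2 \<and> psnd p = z)"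
      using Ord_least[OF d3 O(2)[OF S(1)[OF p2(1)]]] p2 by blast
    then obtain p where p: "p \<in>\<^sub>m S" "pair_max p = m1" "pfst p = m2" "psnd p = m3" by blast
    have "p = q \<or> goedel_less p q" if q: "q \<in>\<^sub>m S" for q
    proof -
      note pc = S(1)[OF p(1)] and qc = S(1)[OF q]
      have "m1 \<in>\<^sub>m pair_max q \<or> m1 = pair_max q" using Ord_linear[OF O(3)[OF pc] O(3)[OF qc]] m1(2)[of "pair_max q"] q p(2) by blast
      moreover have "m2 \<in>\<^sub>m pfst q \<or> m2 = pfst q" if "m1 = pair_max q"
        using Ord_linear[OF O(1)[OF pc] O(1)[OF qc]] m2(2)[of "pfst q"] q p(3) that by blast
      moreover have "m3 \<in>\<^sub>m psnd q \<or> m3 = psnd q" if "m1 = pair_max q" "m2 = pfst q"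
        using Ord_linear[OF O(2)[OF pc] O(2)[OF qc]] m3(2)[of "psnd q"] q p(4) that by blast
      ultimately show ?thesis using eq[OF pc qc] p unfolding goedel_less_def by auto
    qed
    then show "\<exists>m. m \<in>\<^sub>m S \<and> (\<forall>x. x \<in>\<^sub>m S \<longrightarrow> m = x \<or> goedel_less m x)" using p(1) by blast
  qed
qed

lemma prod_order_type:
  assumes "Ord c" obtains d g where "Ord d" "iso (prod c c) goedel_less d g" "bij g (prod c c) d"
proof -
  have "definable (\<lambda>e. goedel_less (ehd (etl e)) (ehd e))" by (intro definable_intros)
  from order_type_ex[OF this well_orders_goedel_less[OF assms]]
  obtain d g where dg: "Ord d" "iso (prod c c) goedel_less d g" by blast
  have "\<And>x y. x \<in>\<^sub>m prod c c \<Longrightarrow> y \<in>\<^sub>m prod c c \<Longrightarrow> goedel_less x y \<or> x = y \<or> goedel_less y x"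
    using well_orders_goedel_less[OF assms] unfolding well_orders_def by (elim conjE) blast
  from iso_bij[OF dg(2) this] show ?thesis using that dg by blast
qed

text \<open>In Goedel's well-ordering, the segment below \<open>(x, y)\<close> lies in the square of \<open>max x y + 1\<close>.\<close>

theorem injects_prod_infinite:
  assumes "Ord n" "omega \<preceq> n" shows "injects (prod n n) n"
proof -
  have d: "definable (\<lambda>e. omega \<preceq> ehd e \<longrightarrow> injects (prod (ehd e) (ehd e)) (ehd e))" by (intro definable_intros)
  have "omega \<preceq> n \<longrightarrow> injects (prod n n) n"
  proof (rule Ord_induct[OF d assms(1)], intro impI)
    fix n assume n: "Ord n" and IH: "\<And>z. z \<in>\<^sub>m n \<Longrightarrow> omega \<preceq> z \<longrightarrow> injects (prod z z) z" and inf: "omega \<preceq> n"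
    have om_n: "injects omega n" using injects_of_le[OF n inf] .
    show "injects (prod n n) n"
    proof (cases "\<exists>r. r \<in>\<^sub>m n \<and> injects n r")
      \<comment> \<open>Here \<open>n\<close> is not a cardinal: its square injects into the square
        of a smaller \<open>r\<close>, where the induction hypothesis applies.\<close>
      case True
      then obtain r where r: "r \<in>\<^sub>m n" "injects n r" by blast
      have Or: "Ord r" using Ord_mem[OF n r(1)] .
      have "\<not> r \<in>\<^sub>m omega" using not_injects_omega_nat injects_trans[OF om_n r(2)] by blast
      then have "omega \<preceq> r" using le_not_mem[OF Ord_omega Or] by blast
      then have "injects (prod r r) r" using IH[OF r(1)] by blast
      moreover have "injects r n" by (rule injects_of_le[OF n]) (use r(1) in \<open>simp add: ord_le_def\<close>)
      ultimately show ?thesis using injects_trans injects_prod[OF r(2)] by blast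
    next
      case False
      obtain d g where dg: "Ord d" "iso (prod n n) goedel_less d g" "bij g (prod n n) d" using prod_order_type[OF n] .
      have "\<not> n \<in>\<^sub>m d"
      proof
        assume "n \<in>\<^sub>m d"
        \<comment> \<open>The pair \<open>q\<close> occupies position \<open>n\<close>, so the pairs
          before it are equinumerous with \<open>n\<close>. They lie in a square over
          \<open>suc ?m\<close> with \<open>?m\<close> below \<open>n\<close>, which is either
          finite or injects into \<open>?m\<close> by induction.\<close>
        then obtain q where q: "q \<in>\<^sub>m prod n n" "app g q = n" using bij_onto[OF dg(3)] by blast
        let ?m = "pair_max q"
        have m: "?m \<in>\<^sub>m n" using prod_mem_cases[OF q(1)] unfolding pair_max_def by simp
        have Om: "Ord ?m" using Ord_mem[OF n m] .
        have "definable (\<lambda>e. goedel_less (ehd e) q)" by (intro definable_intros)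
        from Sep[OF this, of "prod n n"] obtain S where S: "\<And>p. p \<in>\<^sub>m S \<longleftrightarrow> p \<in>\<^sub>m prod n n \<and> goedel_less p q" by blast
        have i: "iso S goedel_less n g" using iso_segment(1)[OF dg(2,1) q(1) S] q(2) by simp
        have "bij g S n"
          by (rule bijI[OF iso_mem[OF i] _ iso_onto[OF i]], assumption)
            (rule bij_inj[OF dg(3)], simp_all add: S)
        then have nS: "injects n S" by (rule bij_injects')
        have "injects S (prod (suc ?m) (suc ?m))"
        proof (rule injects_subset)
          fix p assume "p \<in>\<^sub>m S"
          then have p: "p \<in>\<^sub>m prod n n" "goedel_less p q" using S by blast+
          have Op: "Ord (pfst p)" "Ord (psnd p)" using prod_mem_cases[OF p(1)] Ord_mem[OF n] by blast+
          have "pair_max p \<in>\<^sub>m ?m \<or> pair_max p = ?m" using p(2) unfolding goedel_less_def by blast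
          moreover have "pfst p \<in>\<^sub>m pair_max p \<or> pfst p = pair_max p" "psnd p \<in>\<^sub>m pair_max p \<or> psnd p = pair_max p"
            using Ord_linear[OF Op] unfolding pair_max_def by auto
          ultimately have "pfst p \<in>\<^sub>m suc ?m" "psnd p \<in>\<^sub>m suc ?m"
            unfolding mem_suc using Ord_trans[OF Om] by metis+
          then have "pr (pfst p) (psnd p) \<in>\<^sub>m prod (suc ?m) (suc ?m)" by simp
          then show "p \<in>\<^sub>m prod (suc ?m) (suc ?m)" using prod_mem_cases(3)[OF p(1)] by simp
        qed
        then have nm: "injects n (prod (suc ?m) (suc ?m))" using nS injects_trans by blast
        show False
        proof (cases "?m \<in>\<^sub>m omega")
          case True
          then have "finite_in_model (prod (suc ?m) (suc ?m))" using finite_in_model_prod_nat suc_mem_omega by blast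
          then show False using not_injects_omega_finite_in_model injects_trans[OF om_n nm] by blast
        next
          case False
          then have om: "omega \<preceq> ?m" using le_not_mem[OF Ord_omega Om] by blast
          have "injects (prod (suc ?m) (suc ?m)) (prod ?m ?m)" using injects_prod[OF injects_suc_infinite[OF Om om]] .
          moreover have "injects (prod ?m ?m) ?m" using IH[OF m] om by blast
          ultimately have "injects n ?m" using nm injects_trans by blast
          then show False using \<open>\<not> (\<exists>r. r \<in>\<^sub>m n \<and> injects n r)\<close> m by blast
        qed
      qed
      then have "d \<preceq> n" using le_not_mem[OF dg(1) n] by blast
      then show ?thesis using injects_trans[OF bij_injects[OF dg(3)] injects_of_le[OF n]] by blast
    qed
  qed
  then show ?thesis using assms(2) by blast
qed

text \<open>A finite \<open>n\<close> would make \<open>A\<close> finite, against its copy of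
  \<open>omega\<close>; an infinite \<open>n\<close> absorbs its square.\<close>

lemma injects_prod_injects:
  assumes "Ord n" "injects omega A" "injects A (prod n n)" shows "injects A n"
proof (cases "n \<in>\<^sub>m omega")
  case True
  then show ?thesis using not_injects_omega_finite_in_model[OF finite_in_model_prod_nat[OF True True]] injects_trans[OF assms(2,3)] by blast
next
  case False
  then have "omega \<preceq> n" using le_not_mem[OF Ord_omega assms(1)] by blast
  from injects_prod_infinite[OF assms(1) this] show ?thesis using injects_trans[OF assms(3)] by blast
qed

section \<open>Consequences of well-ordered choice\<close>


text \<open>\<open>AC_WO\<close> concerns sets of sets, whereas an indexed family may repeat
  members. Its range \<open>F\<close> is well-ordered by the first index at which a member
  occurs.\<close>

lemma AC_WO_choice:
  assumes AC: "AC_WO (\<in>\<^sub>m)" and a: "Ord a" and ne: "\<And>i. i \<in>\<^sub>m a \<Longrightarrow> \<exists>z. z \<in>\<^sub>m app A i"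
  obtains c where "\<And>i. i \<in>\<^sub>m a \<Longrightarrow> app c i \<in>\<^sub>m app A i"
proof -
  obtain F where F: "\<And>y. y \<in>\<^sub>m F \<longleftrightarrow> (\<exists>i. i \<in>\<^sub>m a \<and> y = app A i)" using image_ex by metis
  define R where "R u i \<longleftrightarrow> i \<in>\<^sub>m a \<and> app A i = u \<and> (\<forall>j. j \<in>\<^sub>m i \<longrightarrow> app A j \<noteq> u)" for u i
  have dR: "definable (\<lambda>e. R (ehd (etl e)) (ehd e))" unfolding R_def by (intro definable_intros)
  have exR: "\<exists>!i. R u i" if u: "u \<in>\<^sub>m F" for u
  proof -
    obtain i where i: "i \<in>\<^sub>m a" "app A i = u" using u[unfolded F] by auto
    have d: "definable (\<lambda>e. ehd e \<in>\<^sub>m a \<and> app A (ehd e) = u)" by (intro definable_intros)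
    obtain m where m: "m \<in>\<^sub>m a" "app A m = u" "\<And>z. z \<in>\<^sub>m m \<Longrightarrow> \<not> (z \<in>\<^sub>m a \<and> app A z = u)"
      using Ord_least[OF d Ord_mem[OF a i(1)]] i by blast
    have "R u m" unfolding R_def using m Ord_trans[OF a] by blast
    moreover have "x = y" if xy: "R u x" "R u y" for x y
      using xy Ord_linear[of x y] Ord_mem[OF a] unfolding R_def by blast
    ultimately show ?thesis by blast
  qed
  obtain k where k: "\<And>u. u \<in>\<^sub>m F \<Longrightarrow> R u (app k u)" using fun_ex[OF dR exR, of F] by blast
  have ka: "app k u \<in>\<^sub>m a" "app A (app k u) = u" if "u \<in>\<^sub>m F" for u using k[OF that] unfolding R_def by auto
  have kO: "Ord (app k u)" if "u \<in>\<^sub>m F" for u using Ord_mem[OF a ka(1)[OF that]] .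
  have kinj: "u = v" if uv: "u \<in>\<^sub>m F" "v \<in>\<^sub>m F" "app k u = app k v" for u v
    using ka(2)[OF uv(1)] ka(2)[OF uv(2)] unfolding uv(3) by (rule box_equals[OF refl])
  have "definable (\<lambda>e. app k (pfst (ehd e)) \<in>\<^sub>m app k (psnd (ehd e)))" by (intro definable_intros)
  from Sep[OF this, of "prod F F"]
  obtain r where r: "\<And>p. p \<in>\<^sub>m r \<longleftrightarrow> p \<in>\<^sub>m prod F F \<and> app k (pfst p) \<in>\<^sub>m app k (psnd p)" by blast
  have rel: "related (\<in>\<^sub>m) r u v \<longleftrightarrow> app k u \<in>\<^sub>m app k v" if "u \<in>\<^sub>m F" "v \<in>\<^sub>m F" for u v
    unfolding related_iff r using that by simp
  have "well_orders (\<in>\<^sub>m) (related (\<in>\<^sub>m) r) F"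
  proof (rule well_ordersI)
    show "\<not> related (\<in>\<^sub>m) r u u" if "u \<in>\<^sub>m F" for u using rel[OF that that] mem_irrefl by blast
    show "related (\<in>\<^sub>m) r u w" if "u \<in>\<^sub>m F" "v \<in>\<^sub>m F" "w \<in>\<^sub>m F" "related (\<in>\<^sub>m) r u v" "related (\<in>\<^sub>m) r v w" for u v w
      using that rel Ord_trans[OF kO[OF that(3)]] by blast
    show "related (\<in>\<^sub>m) r u v \<or> u = v \<or> related (\<in>\<^sub>m) r v u" if "u \<in>\<^sub>m F" "v \<in>\<^sub>m F" for u v
      using rel[OF that] rel[OF that(2,1)] kinj[OF that] Ord_linear[OF kO[OF that(1)] kO[OF that(2)]] by blast
  next
    fix S assume S: "\<And>z. z \<in>\<^sub>m S \<Longrightarrow> z \<in>\<^sub>m F" "\<exists>z. z \<in>\<^sub>m S"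
    then obtain u where u: "u \<in>\<^sub>m S" by blast
    have d: "definable (\<lambda>e. \<exists>u. u \<in>\<^sub>m S \<and> app k u = ehd e)" by (intro definable_intros)
    obtain i where i: "\<exists>u. u \<in>\<^sub>m S \<and> app k u = i" "\<And>z. z \<in>\<^sub>m i \<Longrightarrow> \<not> (\<exists>u. u \<in>\<^sub>m S \<and> app k u = z)"
      using Ord_least[OF d kO[OF S(1)[OF u]]] u by blast
    then obtain m where m: "m \<in>\<^sub>m S" "app k m = i" by blast
    have "m = v \<or> related (\<in>\<^sub>m) r m v" if v: "v \<in>\<^sub>m S" for v
      using rel[OF S(1)[OF m(1)] S(1)[OF v]] kinj[OF S(1)[OF m(1)] S(1)[OF v]] i(2)[of "app k v"] v m(2)
        Ord_linear[OF kO[OF S(1)[OF m(1)]] kO[OF S(1)[OF v]]] by auto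
    then show "\<exists>m. m \<in>\<^sub>m S \<and> (\<forall>v. v \<in>\<^sub>m S \<longrightarrow> m = v \<or> related (\<in>\<^sub>m) r m v)" using m(1) by blast
  qed
  then have "well_orderable (\<in>\<^sub>m) F" unfolding well_orderable_def by blast
  moreover have "nonempty (\<in>\<^sub>m) x" if "x \<in>\<^sub>m F" for x
    using that[unfolded F] ne unfolding nonempty_def by auto
  ultimately obtain c B where c: "is_function (\<in>\<^sub>m) c F B"
    "\<And>x y. x \<in>\<^sub>m F \<Longrightarrow> related (\<in>\<^sub>m) c x y \<Longrightarrow> y \<in>\<^sub>m x" using AC unfolding AC_WO_def by blast
  have "definable_term (\<lambda>e. app c (app A (ehd e)))" by (intro definable_intros)
  from fun_ex_term[OF this, of a] obtain h where h: "\<And>i. i \<in>\<^sub>m a \<Longrightarrow> app h i = app c (app A i)" by blast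
  have "app h i \<in>\<^sub>m app A i" if i: "i \<in>\<^sub>m a" for i
  proof -
    have iF: "app A i \<in>\<^sub>m F" unfolding F using i by blast
    have "app c (app A i) \<in>\<^sub>m app A i"
      by (rule c(2)[OF iF]) (simp add: is_function_app(2)[OF c(1) iF])
    then show ?thesis using h[OF i] by simp
  qed
  then show ?thesis using that by blast
qed

theorem hartogs_eq_lindenbaum_of_AC_WO:
  assumes AC: "AC_WO (\<in>\<^sub>m)" shows "hartogs (\<in>\<^sub>m) X = lindenbaum (\<in>\<^sub>m) X"
proof -
  let ?m = "hartogs (\<in>\<^sub>m) X"
  have "\<not> surjects X ?m"
  proof
    assume "surjects X ?m"
    then obtain g where g: "\<And>y. y \<in>\<^sub>m ?m \<Longrightarrow> \<exists>x. x \<in>\<^sub>m X \<and> app g x = y" unfolding surjects_def by blast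
    define R where "R z S \<longleftrightarrow> (\<forall>x. x \<in>\<^sub>m S \<longleftrightarrow> x \<in>\<^sub>m X \<and> app g x = z)" for z S
    have d: "definable (\<lambda>e. R (ehd (etl e)) (ehd e))" unfolding R_def by (intro definable_intros)
    have ex: "\<exists>!S. R z S" for z
    proof -
      have "definable (\<lambda>e. app g (ehd e) = z)" by (intro definable_intros)
      from Sep[OF this, of X] obtain S where S: "R z S" unfolding R_def by blast
      show ?thesis by (rule ex1I[of _ S]) (use S in \<open>auto simp: R_def intro: ext_eq\<close>)
    qed
    obtain A where A: "\<And>z. z \<in>\<^sub>m ?m \<Longrightarrow> R z (app A z)" using fun_ex[OF d ex, of ?m] by blast
    have ne: "\<exists>x. x \<in>\<^sub>m app A z" if "z \<in>\<^sub>m ?m" for z using g[OF that] A[OF that] unfolding R_def by blast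
    obtain c where c: "\<And>z. z \<in>\<^sub>m ?m \<Longrightarrow> app c z \<in>\<^sub>m app A z" using AC_WO_choice[OF AC Ord_hartogs ne] by blast
    have c': "app c z \<in>\<^sub>m X" "app g (app c z) = z" if "z \<in>\<^sub>m ?m" for z
      using c[OF that] A[OF that] unfolding R_def by blast+
    have "injects ?m X"
    proof (rule injectsI[of _ c])
      show "x = y" if xy: "x \<in>\<^sub>m ?m" "y \<in>\<^sub>m ?m" "app c x = app c y" for x y
        using c'(2)[OF xy(1)] c'(2)[OF xy(2)] unfolding xy(3) by (rule box_equals[OF refl])
    qed (rule c'(1))
    then show False using hartogs_not_injects by blast
  qed
  then show ?thesis using lindenbaum_eq_hartogsI by simp
qed

text \<open>\<open>T\<close> relates codes in \<open>d\<close> to the elements they name; taking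
  least codes inverts it without choice.\<close>

lemma injects_of_coded:
  assumes T: "definable (\<lambda>e. T (ehd (etl e)) (ehd e))" and d: "Ord d"
    and ex: "\<And>w. w \<in>\<^sub>m W \<Longrightarrow> \<exists>z. z \<in>\<^sub>m d \<and> T z w"
    and u: "\<And>z w w'. T z w \<Longrightarrow> T z w' \<Longrightarrow> w = w'"
  shows "injects W d"
proof (rule injects_rel)
  let ?R = "\<lambda>w z. z \<in>\<^sub>m d \<and> T z w \<and> (\<forall>z'. z' \<in>\<^sub>m z \<longrightarrow> \<not> T z' w)"
  show "definable (\<lambda>e. ?R (ehd (etl e)) (ehd e))"
    by (intro definable_intros definable_subst2[OF T])
  show "\<exists>!z. ?R w z" if w: "w \<in>\<^sub>m W" for w
  proof -
    obtain z where z: "z \<in>\<^sub>m d" "T z w" using ex[OF w] by blast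
    have dw: "definable (\<lambda>e. ehd e \<in>\<^sub>m d \<and> T (ehd e) w)" by (intro definable_intros definable_subst2[OF T])
    obtain m where m: "m \<in>\<^sub>m d" "T m w" "\<And>z. z \<in>\<^sub>m m \<Longrightarrow> \<not> (z \<in>\<^sub>m d \<and> T z w)"
      using Ord_least[OF dw Ord_mem[OF d z(1)]] z by blast
    have "?R w m" using m Ord_trans[OF d] by blast
    moreover have "x = y" if xy: "?R w x" "?R w y" for x y
      using xy Ord_linear[of x y] Ord_mem[OF d] by blast
    ultimately show ?thesis by blast
  qed
qed (use u in blast)+

text \<open>Shared by the proofs of (5) and (6). \<open>AC_WO\<close> selects injections
  \<open>app G i\<close> for all \<open>i\<close> at once, and \<open>W\<close> is the union of
  their ranges. \<open>W\<close> is well-orderable since each of its elements is coded by a pair of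
  an index and an argument, both below the ordinal \<open>c\<close>.\<close>

lemma union_injections:
  assumes AC: "AC_WO (\<in>\<^sub>m)" and D: "Ord D" and M: "Ord M"
    and sub: "\<And>i x. i \<in>\<^sub>m D \<Longrightarrow> x \<in>\<^sub>m app f i \<Longrightarrow> x \<in>\<^sub>m M"
    and inj: "\<And>i. i \<in>\<^sub>m D \<Longrightarrow> injects (app f i) X"
  obtains W G n h where "\<And>w. w \<in>\<^sub>m W \<Longrightarrow> w \<in>\<^sub>m X"
    "\<And>i x. i \<in>\<^sub>m D \<Longrightarrow> x \<in>\<^sub>m app f i \<Longrightarrow> app (app G i) x \<in>\<^sub>m W"
    "\<And>i x y. i \<in>\<^sub>m D \<Longrightarrow> x \<in>\<^sub>m app f i \<Longrightarrow> y \<in>\<^sub>m app f i \<Longrightarrow> app (app G i) x = app (app G i) y \<Longrightarrow> x = y"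
    "Ord n" "bij h n W"
proof -
  \<comment> \<open>Because \<open>I i g\<close> ignores stray pairs, its solutions need not form a
    set; restricting to subsets of \<open>prod M X\<close> gives \<open>AC_WO\<close> sets to choose
    from.\<close>
  obtain Q where Q: "\<And>y. y \<in>\<^sub>m Q \<longleftrightarrow> (\<forall>z. z \<in>\<^sub>m y \<longrightarrow> z \<in>\<^sub>m prod M X)" using power_set by metis
  define I where "I i g \<longleftrightarrow> (\<forall>x. x \<in>\<^sub>m app f i \<longrightarrow> app g x \<in>\<^sub>m X) \<and>
     (\<forall>x y. x \<in>\<^sub>m app f i \<and> y \<in>\<^sub>m app f i \<and> app g x = app g y \<longrightarrow> x = y)" for i g
  define R where "R i S \<longleftrightarrow> (\<forall>g. g \<in>\<^sub>m S \<longleftrightarrow> g \<in>\<^sub>m Q \<and> I i g)" for i S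
  have dR: "definable (\<lambda>e. R (ehd (etl e)) (ehd e))" unfolding R_def I_def by (intro definable_intros)
  have exR: "\<exists>!S. R i S" for i
  proof -
    have "definable (\<lambda>e. I i (ehd e))" unfolding I_def by (intro definable_intros)
    from Sep[OF this, of Q] obtain S where S: "R i S" unfolding R_def by blast
    show ?thesis by (rule ex1I[of _ S]) (use S in \<open>auto simp: R_def intro: ext_eq\<close>)
  qed
  obtain A where A: "\<And>i. i \<in>\<^sub>m D \<Longrightarrow> R i (app A i)" using fun_ex[OF dR exR, of D] by blast
  have ne: "\<exists>g. g \<in>\<^sub>m app A i" if i: "i \<in>\<^sub>m D" for i
  proof -
    obtain g where g: "injection (\<in>\<^sub>m) g (app f i) X" using inj[OF i] injects_iff_injection by blast
    then have fn: "is_function (\<in>\<^sub>m) g (app f i) X" unfolding injection_def by blast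
    have "I i g" unfolding I_def
      using is_function_app(1)[OF fn] injection_iff_app[OF fn] g by simp
    moreover have "z \<in>\<^sub>m prod M X" if z: "z \<in>\<^sub>m g" for z
    proof -
      obtain x y where "x \<in>\<^sub>m app f i" "y \<in>\<^sub>m X" "z = pr x y"
        using fn z unfolding is_function_def is_opair_iff by blast
      then show ?thesis using sub[OF i] by simp
    qed
    ultimately show ?thesis using A[OF i] Q unfolding R_def by blast
  qed
  obtain G where G: "\<And>i. i \<in>\<^sub>m D \<Longrightarrow> app G i \<in>\<^sub>m app A i" using AC_WO_choice[OF AC D ne] by blast
  have GI: "I i (app G i)" if "i \<in>\<^sub>m D" for i using G[OF that] A[OF that] unfolding R_def by blast
  have dW: "definable (\<lambda>e. \<exists>i x. i \<in>\<^sub>m D \<and> x \<in>\<^sub>m app f i \<and> ehd e = app (app G i) x)" by (intro definable_intros)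
  obtain W where W: "\<And>w. w \<in>\<^sub>m W \<longleftrightarrow> w \<in>\<^sub>m X \<and> (\<exists>i x. i \<in>\<^sub>m D \<and> x \<in>\<^sub>m app f i \<and> w = app (app G i) x)"
    using Sep[OF dW, of X] by blast
  obtain c where c: "Ord c" "D \<preceq> c" "M \<preceq> c" using Ord_max[OF D M] .
  obtain d g where dg: "Ord d" "bij g (prod c c) d" using prod_order_type[OF c(1)] by metis
  define T where "T z w \<longleftrightarrow> (\<exists>p. p \<in>\<^sub>m prod c c \<and> app g p = z \<and> w = app (app G (pfst p)) (psnd p))" for z w
  have "injects W d"
  proof (rule injects_of_coded[OF _ dg(1)])
    show "definable (\<lambda>e. T (ehd (etl e)) (ehd e))" unfolding T_def by (intro definable_intros)
    show "\<exists>z. z \<in>\<^sub>m d \<and> T z w" if w: "w \<in>\<^sub>m W" for w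
    proof -
      obtain i x where ix: "i \<in>\<^sub>m D" "x \<in>\<^sub>m app f i" "w = app (app G i) x" using w W by blast
      have "i \<in>\<^sub>m c" "x \<in>\<^sub>m c"
        using mem_le_trans[OF c(1) ix(1) c(2)] mem_le_trans[OF c(1) sub[OF ix(1,2)] c(3)] by auto
      then have p: "pr i x \<in>\<^sub>m prod c c" by simp
      then show ?thesis using bij_mem[OF dg(2) p] ix(3) unfolding T_def
        by (intro exI[of _ "app g (pr i x)"] conjI exI[of _ "pr i x"]) simp_all
    qed
    show "w = w'" if T: "T z w" "T z w'" for z w w'
    proof -
      obtain p q where "p \<in>\<^sub>m prod c c" "app g p = z" "w = app (app G (pfst p)) (psnd p)"
        "q \<in>\<^sub>m prod c c" "app g q = z" "w' = app (app G (pfst q)) (psnd q)" using T unfolding T_def by blast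
      then show ?thesis using bij_inj[OF dg(2), of p q] by simp
    qed
  qed
  from injects_Ord_bij[OF this dg(1)] obtain n h where nh: "Ord n" "bij h n W" by metis
  show ?thesis
  proof (rule that[of W G n h])
    show "w \<in>\<^sub>m X" if "w \<in>\<^sub>m W" for w using that W by blast
    show "app (app G i) x \<in>\<^sub>m W" if "i \<in>\<^sub>m D" "x \<in>\<^sub>m app f i" for i x
      using GI[OF that(1)] that unfolding W I_def by blast
    show "x = y" if "i \<in>\<^sub>m D" "x \<in>\<^sub>m app f i" "y \<in>\<^sub>m app f i" "app (app G i) x = app (app G i) y" for i x y
      using GI[OF that(1), unfolded I_def, THEN conjunct2] that(2-4) by simp
  qed (fact nh)+
qed

text \<open>The predecessor is the cardinality \<open>c\<close> of the union \<open>W\<close>. It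
  lies below the Hartogs number as \<open>W\<close> is part of \<open>X\<close>, and every
  \<open>y\<close> below the Hartogs number injects into \<open>W\<close>, so no cardinal fits in
  between.\<close>

theorem successor_hartogs_of_AC_WO:
  assumes AC: "AC_WO (\<in>\<^sub>m)" shows "successor_cardinal (\<in>\<^sub>m) (hartogs (\<in>\<^sub>m) X)"
proof -
  let ?m = "hartogs (\<in>\<^sub>m) X"
  have "definable_term (\<lambda>e. ehd e)" by (intro definable_intros)
  \<comment> \<open>The family is the identity: index \<open>i\<close> stands for the ordinal
    \<open>i\<close> itself.\<close>
  from fun_ex_term[OF this, of ?m] obtain f where f: "\<And>x. x \<in>\<^sub>m ?m \<Longrightarrow> app f x = x" by blast
  obtain W G n h where W: "\<And>w. w \<in>\<^sub>m W \<Longrightarrow> w \<in>\<^sub>m X"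
    "\<And>i x. i \<in>\<^sub>m ?m \<Longrightarrow> x \<in>\<^sub>m app f i \<Longrightarrow> app (app G i) x \<in>\<^sub>m W"
    "\<And>i x y. i \<in>\<^sub>m ?m \<Longrightarrow> x \<in>\<^sub>m app f i \<Longrightarrow> y \<in>\<^sub>m app f i \<Longrightarrow> app (app G i) x = app (app G i) y \<Longrightarrow> x = y"
    and n: "Ord n" "bij h n W"
  proof (rule union_injections[OF AC Ord_hartogs Ord_hartogs, of X f X X])
    show "x \<in>\<^sub>m ?m" if "i \<in>\<^sub>m ?m" "x \<in>\<^sub>m app f i" for i x
      using Ord_trans[OF Ord_hartogs _ that(1)] that f by auto
    show "injects (app f i) X" if "i \<in>\<^sub>m ?m" for i using f[OF that] mem_hartogs_injects[OF that] by simp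
  qed blast
  obtain c where c: "Card c" "injects W c" "injects c W" using equipollent_Card_ex[OF n(1) bij_injects'[OF n(2)]] .
  have "injects c X" using injects_trans[OF c(3) injects_subset[OF W(1)]] .
  then have cm: "c \<in>\<^sub>m ?m" using mem_hartogs_iff c(1) unfolding Card_iff by blast
  have "least_ordinal (\<in>\<^sub>m) (\<lambda>a. Card a \<and> c \<in>\<^sub>m a) = ?m"
  proof (rule least_ordinal_eqI[OF Ord_hartogs])
    show "Card ?m \<and> c \<in>\<^sub>m ?m" using cm Card_hartogs by blast
    show "\<not> (Card y \<and> c \<in>\<^sub>m y)" if y: "y \<in>\<^sub>m ?m" for y
    proof
      assume cy: "Card y \<and> c \<in>\<^sub>m y"
      have "injects y W"
        by (rule injectsI[of y "app G y"]) (use W(2)[OF y] W(3)[OF y] f[OF y] in simp_all)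
      then have "injects y c" using c(2) injects_trans by blast
      then show False using cy unfolding Card_iff by blast
    qed
  qed
  then show ?thesis unfolding successor_cardinal_def using c(1) by auto
qed

section \<open>Infinite sets, cofinality and regularity\<close>

lemma infinite_Card_suc:
  assumes "Card m" "omega \<preceq> m" "x \<in>\<^sub>m m" shows "suc x \<in>\<^sub>m m"
proof (rule ccontr)
  assume "\<not> suc x \<in>\<^sub>m m"
  have m: "Ord m" and x: "Ord x" using assms(1,3) Ord_mem unfolding Card_iff by blast+
  have "m \<preceq> suc x" using le_not_mem[OF m Ord_suc[OF x]] \<open>\<not> suc x \<in>\<^sub>m m\<close> by blast
  then have l: "injects m (suc x)" using injects_of_le[OF Ord_suc[OF x]] by blast
  show False
  proof (cases "x \<in>\<^sub>m omega")
    case True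
    then show False using mem_le_trans[OF m suc_mem_omega[OF True] assms(2)] \<open>\<not> suc x \<in>\<^sub>m m\<close> by blast
  next
    case False
    then have "omega \<preceq> x" using le_not_mem[OF Ord_omega x] by blast
    then have "injects m x" using injects_trans[OF l injects_suc_infinite[OF x]] by blast
    then show False using assms(1,3) unfolding Card_iff by blast
  qed
qed

lemma infinite_set_iff: "infinite_set (\<in>\<^sub>m) X \<longleftrightarrow> \<not> (\<exists>n g. n \<in>\<^sub>m omega \<and> bij g n X)"
  unfolding infinite_set_def mem_omega[symmetric] using bijection_iff_bij by blast

lemma infinite_set_of_injects: "injects omega X \<Longrightarrow> infinite_set (\<in>\<^sub>m) X"
  unfolding infinite_set_iff using bij_injects' injects_trans not_injects_omega_nat by blast

text \<open>Without choice an infinite set may contain no copy of \<open>omega\<close>. It does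
  contain a copy of every natural number: an injection of \<open>k\<close> misses some point, and a
  missed point extends it to \<open>suc k\<close>.\<close>

lemma omega_le_hartogs:
  assumes inf: "infinite_set (\<in>\<^sub>m) X" shows "omega \<preceq> hartogs (\<in>\<^sub>m) X"
proof -
  have nl: "injects n X" if n: "n \<in>\<^sub>m omega" for n
  proof -
    have d: "definable (\<lambda>e. injects (ehd e) X)" by (intro definable_intros)
    show ?thesis
    proof (rule omega_induct[OF d n])
      show "injects emp X" by (rule injects_subset) simp
      fix k assume k: "k \<in>\<^sub>m omega" "injects k X"
      obtain g where g: "\<And>x. x \<in>\<^sub>m k \<Longrightarrow> app g x \<in>\<^sub>m X"
        "\<And>x y. x \<in>\<^sub>m k \<Longrightarrow> y \<in>\<^sub>m k \<Longrightarrow> app g x = app g y \<Longrightarrow> x = y" using injectsE[OF k(2)] by metis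
      have "\<not> bij g k X" using inf k(1) unfolding infinite_set_iff by blast
      then obtain x0 where x0: "x0 \<in>\<^sub>m X" "\<not> (\<exists>x. x \<in>\<^sub>m k \<and> app g x = x0)"
        using bijI[OF g] by blast
      define R where "R x y \<longleftrightarrow> (x = k \<and> y = x0) \<or> (x \<noteq> k \<and> y = app g x)" for x y
      show "injects (suc k) X"
      proof (rule injects_rel)
        show "definable (\<lambda>e. R (ehd (etl e)) (ehd e))" unfolding R_def by (intro definable_intros)
        show "\<exists>!y. R x y" for x unfolding R_def by auto
        show "y \<in>\<^sub>m X" if "x \<in>\<^sub>m suc k" "R x y" for x y
          using that g(1)[of x] x0 unfolding R_def by auto
        show "x = x'" if x: "x \<in>\<^sub>m suc k" "x' \<in>\<^sub>m suc k" "R x y" "R x' y" for x x' y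
          using x g(2)[of x x'] x0(2) unfolding R_def mem_suc by metis
      qed
    qed
  qed
  have "\<not> hartogs (\<in>\<^sub>m) X \<in>\<^sub>m omega" using nl hartogs_not_injects by blast
  then show ?thesis using le_not_mem[OF Ord_omega Ord_hartogs] by blast
qed

lemma cofinal_iff:
  "(\<exists>f. is_function (\<in>\<^sub>m) f a k \<and> (\<forall>b. b \<in>\<^sub>m k \<longrightarrow> (\<exists>x y. related (\<in>\<^sub>m) f x y \<and> b \<preceq> y))) \<longleftrightarrow>
   (\<exists>g. (\<forall>x. x \<in>\<^sub>m a \<longrightarrow> app g x \<in>\<^sub>m k) \<and> (\<forall>b. b \<in>\<^sub>m k \<longrightarrow> (\<exists>x. x \<in>\<^sub>m a \<and> b \<preceq> app g x)))"
  (is "?L \<longleftrightarrow> ?R")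
proof
  assume ?L
  then obtain f where f: "is_function (\<in>\<^sub>m) f a k"
    "\<forall>b. b \<in>\<^sub>m k \<longrightarrow> (\<exists>x y. related (\<in>\<^sub>m) f x y \<and> b \<preceq> y)" by blast
  have "\<exists>x. x \<in>\<^sub>m a \<and> b \<preceq> app f x" if b: "b \<in>\<^sub>m k" for b
  proof -
    obtain x y where xy: "related (\<in>\<^sub>m) f x y" "b \<preceq> y" using f(2) b by blast
    have x: "x \<in>\<^sub>m a" using related_domain[OF f(1) xy(1)] .
    then show ?thesis using xy is_function_app(2)[OF f(1) x] by auto
  qed
  then show ?R using is_function_app(1)[OF f(1)] by (intro exI[of _ f]) blast
next
  assume ?R
  then obtain g where g: "\<And>x. x \<in>\<^sub>m a \<Longrightarrow> app g x \<in>\<^sub>m k"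
    "\<And>b. b \<in>\<^sub>m k \<Longrightarrow> \<exists>x. x \<in>\<^sub>m a \<and> b \<preceq> app g x" by blast
  obtain f where f: "is_function (\<in>\<^sub>m) f a k"
    "\<And>x y. related (\<in>\<^sub>m) f x y \<longleftrightarrow> x \<in>\<^sub>m a \<and> y = app g x" using is_function_of_app[OF g(1)] by metis
  show ?L by (rule exI[of _ f]) (use f g(2) in blast)
qed

definition cofinal :: "'a \<Rightarrow> 'a \<Rightarrow> bool" where
  "cofinal a k \<longleftrightarrow> (\<exists>g. (\<forall>x. x \<in>\<^sub>m a \<longrightarrow> app g x \<in>\<^sub>m k) \<and> (\<forall>b. b \<in>\<^sub>m k \<longrightarrow> (\<exists>x. x \<in>\<^sub>m a \<and> b \<preceq> app g x)))"

lemma cofinality_eq: "cofinality (\<in>\<^sub>m) k = least_ordinal (\<in>\<^sub>m) (\<lambda>a. cofinal a k)"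
  unfolding cofinality_def cofinal_iff cofinal_def ..

lemma definable_cofinal [definable_intros]:
  assumes "definable_term t" "definable_term s" shows "definable (\<lambda>e. cofinal (t e) (s e))"
  unfolding cofinal_def by (intro definable_intros lift[OF assms(1)] lift[OF assms(2)])

lemma cofinal_refl: "cofinal k k"
proof -
  have "definable_term (\<lambda>e. ehd e)" by (intro definable_intros)
  from fun_ex_term[OF this, of k] obtain g where "\<And>x. x \<in>\<^sub>m k \<Longrightarrow> app g x = x" by blast
  then show ?thesis unfolding cofinal_def by (intro exI[of _ g]) (metis le_refl)
qed

text \<open>Given a cofinal map on some \<open>D\<close> below the Hartogs number, the ranges of the
  chosen injections have a union of order type \<open>n\<close>, also below it. Each
  \<open>y\<close> is then recorded by an index in \<open>D\<close> and a place in \<open>n\<close>,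
  which squeezes the Hartogs number into the square of a smaller ordinal.\<close>

theorem regular_hartogs_of_AC_WO:
  assumes AC: "AC_WO (\<in>\<^sub>m)" and inf: "infinite_set (\<in>\<^sub>m) X"
  shows "regular_cardinal (\<in>\<^sub>m) (hartogs (\<in>\<^sub>m) X)"
proof -
  let ?m = "hartogs (\<in>\<^sub>m) X"
  have om: "omega \<preceq> ?m" using omega_le_hartogs[OF inf] .
  have oml: "injects omega ?m" using injects_of_le[OF Ord_hartogs om] .
  have "\<not> cofinal D ?m" if D: "D \<in>\<^sub>m ?m" for D
  proof
    assume "cofinal D ?m"
    then obtain f where f: "\<And>x. x \<in>\<^sub>m D \<Longrightarrow> app f x \<in>\<^sub>m ?m"
      "\<And>b. b \<in>\<^sub>m ?m \<Longrightarrow> \<exists>x. x \<in>\<^sub>m D \<and> b \<preceq> app f x" unfolding cofinal_def by blast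
    have OD: "Ord D" using Ord_mem[OF Ord_hartogs D] .
    obtain W G n h where W: "\<And>w. w \<in>\<^sub>m W \<Longrightarrow> w \<in>\<^sub>m X"
      "\<And>i x. i \<in>\<^sub>m D \<Longrightarrow> x \<in>\<^sub>m app f i \<Longrightarrow> app (app G i) x \<in>\<^sub>m W"
      "\<And>i x y. i \<in>\<^sub>m D \<Longrightarrow> x \<in>\<^sub>m app f i \<Longrightarrow> y \<in>\<^sub>m app f i \<Longrightarrow> app (app G i) x = app (app G i) y \<Longrightarrow> x = y"
      and n: "Ord n" "bij h n W"
    proof (rule union_injections[OF AC OD Ord_hartogs, of f X X])
      show "x \<in>\<^sub>m ?m" if "i \<in>\<^sub>m D" "x \<in>\<^sub>m app f i" for i x
        using Ord_trans[OF Ord_hartogs that(2) f(1)[OF that(1)]] .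
      show "injects (app f i) X" if "i \<in>\<^sub>m D" for i using mem_hartogs_injects[OF f(1)[OF that]] .
    qed blast
    obtain k where k: "bij k W n" using bij_sym[OF n(2)] .
    have "injects n X" using injects_trans[OF bij_injects[OF n(2)] injects_subset[OF W(1)]] .
    then have nm: "n \<in>\<^sub>m ?m" using mem_hartogs_iff[OF n(1)] by blast
    obtain c where c: "c \<in>\<^sub>m ?m" "Ord c" "n \<preceq> c" "D \<preceq> c"
      using Ord_linear[OF n(1) OD] nm D n(1) OD unfolding ord_le_def by blast
    \<comment> \<open>The least index \<open>i\<close> with \<open>y\<close> in
      \<open>app f i\<close> is used, so that the code of \<open>y\<close> is unique and reveals
      which injection to invert.\<close>
    define R where "R y p \<longleftrightarrow> (\<exists>i. i \<in>\<^sub>m D \<and> y \<in>\<^sub>m app f i \<and> (\<forall>j. j \<in>\<^sub>m i \<longrightarrow> \<not> y \<in>\<^sub>m app f j) \<and>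
      p = pr i (app k (app (app G i) y)))" for y p
    have "injects ?m (prod c c)"
    proof (rule injects_rel)
      show "definable (\<lambda>e. R (ehd (etl e)) (ehd e))" unfolding R_def by (intro definable_intros)
      show "\<exists>!p. R y p" if y: "y \<in>\<^sub>m ?m" for y
      proof -
        \<comment> \<open>Cofinality only gives a value at or above a given ordinal; applying it to
          \<open>suc y\<close> makes \<open>y\<close> a member of \<open>app f i\<close>.\<close>
        obtain i where i: "i \<in>\<^sub>m D" "suc y \<preceq> app f i" using f(2)[OF infinite_Card_suc[OF Card_hartogs om y]] by blast
        have yi: "y \<in>\<^sub>m app f i"
          using mem_le_trans[OF Ord_mem[OF Ord_hartogs f(1)[OF i(1)]] _ i(2), of y] by simp
        have d: "definable (\<lambda>e. ehd e \<in>\<^sub>m D \<and> y \<in>\<^sub>m app f (ehd e))" by (intro definable_intros)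
        obtain m where m: "m \<in>\<^sub>m D" "y \<in>\<^sub>m app f m" "\<And>z. z \<in>\<^sub>m m \<Longrightarrow> \<not> (z \<in>\<^sub>m D \<and> y \<in>\<^sub>m app f z)"
          using Ord_least[OF d Ord_mem[OF OD i(1)]] i yi by blast
        have *: "i = m" if "i \<in>\<^sub>m D" "y \<in>\<^sub>m app f i" "\<forall>j. j \<in>\<^sub>m i \<longrightarrow> \<not> y \<in>\<^sub>m app f j" for i
          using that m Ord_linear[OF Ord_mem[OF OD] Ord_mem[OF OD], of i m] by blast
        have "R y (pr m (app k (app (app G m) y)))" unfolding R_def using m Ord_trans[OF OD] by blast
        moreover have "p = pr m (app k (app (app G m) y))" if "R y p" for p
          using that * unfolding R_def by blast
        ultimately show ?thesis by blast
      qed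
      show "p \<in>\<^sub>m prod c c" if "R y p" for y p
      proof -
        obtain i where i: "i \<in>\<^sub>m D" "y \<in>\<^sub>m app f i" "p = pr i (app k (app (app G i) y))"
          using \<open>R y p\<close> unfolding R_def by blast
        show ?thesis unfolding i(3)
          using mem_le_trans[OF c(2) i(1) c(4)] mem_le_trans[OF c(2) bij_mem[OF k W(2)[OF i(1,2)]] c(3)] by simp
      qed
      show "y = y'" if "R y p" "R y' p" for y y' p
      proof -
        obtain i where i: "i \<in>\<^sub>m D" "y \<in>\<^sub>m app f i" "p = pr i (app k (app (app G i) y))"
          using \<open>R y p\<close> unfolding R_def by blast
        obtain j where j: "j \<in>\<^sub>m D" "y' \<in>\<^sub>m app f j" "p = pr j (app k (app (app G j) y'))"
          using \<open>R y' p\<close> unfolding R_def by blast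
        have ij: "j = i" "app k (app (app G i) y) = app k (app (app G i) y')" using i(3) j(3) by auto
        have j2: "y' \<in>\<^sub>m app f i" using j(2) ij(1) by simp
        have "app (app G i) y = app (app G i) y'"
          by (rule bij_inj[OF k W(2)[OF i(1,2)] W(2)[OF i(1) j2] ij(2)])
        then show ?thesis by (rule W(3)[OF i(1,2) j2])
      qed
    qed
    then have "injects ?m c" using injects_prod_injects[OF c(2) oml] by blast
    then show False using Card_hartogs[of X] c(1) unfolding Card_iff by blast
  qed
  then have "cofinality (\<in>\<^sub>m) ?m = ?m"
    unfolding cofinality_eq by (intro least_ordinal_eqI Ord_hartogs cofinal_refl)
  then show ?thesis unfolding regular_cardinal_def using Card_hartogs infinite_set_of_injects[OF oml] by blast
qed

section \<open>Failure of well-ordered choice\<close>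


text \<open>Recursion is replaced by order types: \<open>T c a\<close> says that the cardinals
  between \<open>B\<close> and \<open>c\<close> have type \<open>a\<close>. If all these types
  stayed below \<open>L\<close>, the cardinals above \<open>B\<close> would form a set
  \<open>D\<close>, refuted by the Hartogs number of a bound. So some type reaches \<open>L\<close>,
  and the inverse of its collapse enumerates the cardinals.\<close>

lemma increasing_Cards:
  assumes L: "Ord L" and B: "Ord B"
  obtains k where "\<And>a. a \<in>\<^sub>m L \<Longrightarrow> Card (app k a) \<and> B \<in>\<^sub>m app k a"
    "\<And>a b. b \<in>\<^sub>m L \<Longrightarrow> a \<in>\<^sub>m b \<Longrightarrow> app k a \<in>\<^sub>m app k b"
proof -
  let ?C = "\<lambda>c. Card c \<and> B \<in>\<^sub>m c"
  have CO: "Ord c" if "Card c" for c using that unfolding Card_iff by blast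
  define T where "T c a \<longleftrightarrow> Ord a \<and> (\<exists>S g. (\<forall>x. x \<in>\<^sub>m S \<longleftrightarrow> x \<in>\<^sub>m c \<and> ?C x) \<and> iso S (\<in>\<^sub>m) a g)" for c a
  have exT: "\<exists>a. T c a" for c
  proof -
    have "definable (\<lambda>e. ?C (ehd e))" by (intro definable_intros)
    from Sep[OF this, of c] obtain S where S: "\<forall>x. x \<in>\<^sub>m S \<longleftrightarrow> x \<in>\<^sub>m c \<and> ?C x" by blast
    then have "\<And>x. x \<in>\<^sub>m S \<Longrightarrow> Ord x" using CO by blast
    then obtain a g where "Ord a" "iso S (\<in>\<^sub>m) a g" using order_type_ordinals by metis
    then show ?thesis unfolding T_def using S by blast
  qed
  have T_less: "a \<in>\<^sub>m a'" if c: "?C c" "Card c'" "c \<in>\<^sub>m c'" and T: "T c a" "T c' a'" for c c' a a'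
  proof -
    obtain S g S' g' where S: "\<forall>x. x \<in>\<^sub>m S \<longleftrightarrow> x \<in>\<^sub>m c \<and> ?C x" "iso S (\<in>\<^sub>m) a g" "Ord a"
      "\<forall>x. x \<in>\<^sub>m S' \<longleftrightarrow> x \<in>\<^sub>m c' \<and> ?C x" "iso S' (\<in>\<^sub>m) a' g'" "Ord a'" using T unfolding T_def by blast
    have cS: "c \<in>\<^sub>m S'" using S(4) c by blast
    have "y \<in>\<^sub>m S \<longleftrightarrow> y \<in>\<^sub>m S' \<and> y \<in>\<^sub>m c" for y
      using S(1,4) Ord_trans[OF CO[OF c(2)] _ c(3), of y] by blast
    then have i: "iso S (\<in>\<^sub>m) (app g' c) g'" "app g' c \<in>\<^sub>m a'"
      using iso_segment[OF S(5,6) cS] by blast+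
    have "a = app g' c" using iso_unique[OF S(2) i(1) S(3) Ord_mem[OF S(6) i(2)]] .
    then show ?thesis using i(2) by simp
  qed
  have "\<exists>t a. T t a \<and> L \<preceq> a"
  proof (rule ccontr)
    assume neg: "\<not> (\<exists>t a. T t a \<and> L \<preceq> a)"
    have small: "a \<in>\<^sub>m L" if "T c a" for c a
      using neg that le_not_mem[OF L] unfolding T_def by blast
    \<comment> \<open>Replacement runs backwards, from order types in \<open>L\<close> to cardinals;
      \<open>T_less\<close> makes each type determine its cardinal.\<close>
    have d: "definable (\<lambda>e. ?C (ehd e) \<and> T (ehd e) (ehd (etl e)))"
      unfolding T_def by (intro definable_intros)
    have "c = c'" if c: "?C c \<and> T c a" "?C c' \<and> T c' a" for c c' a
      using Ord_linear[OF CO CO, of c c'] T_less[of c c' a a] T_less[of c' c a a] c mem_irrefl by blast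
    then have "\<exists>D. \<forall>c. c \<in>\<^sub>m D \<longleftrightarrow> (\<exists>a. a \<in>\<^sub>m L \<and> ?C c \<and> T c a)" by (intro Repl[OF d]) blast
    then obtain D where D: "\<And>c. c \<in>\<^sub>m D \<longleftrightarrow> (\<exists>a. a \<in>\<^sub>m L \<and> ?C c \<and> T c a)" by blast
    have D': "c \<in>\<^sub>m D \<longleftrightarrow> ?C c" for c using D exT[of c] small by blast
    obtain U where U: "\<forall>z. z \<in>\<^sub>m U \<longleftrightarrow> (\<exists>y. y \<in>\<^sub>m D \<and> z \<in>\<^sub>m y)" using union by blast
    have OU: "Ord U" by (rule Ord_Union[OF U]) (use D' CO in blast)
    obtain V where V: "Ord V" "U \<preceq> V" "B \<preceq> V" using Ord_max[OF OU B] .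
    have "V \<in>\<^sub>m hartogs (\<in>\<^sub>m) V" using self_mem_hartogs[OF V(1)] .
    then have "hartogs (\<in>\<^sub>m) V \<in>\<^sub>m D"
      unfolding D' using Card_hartogs le_mem_trans[OF Ord_hartogs V(3)] by blast
    then have "V \<in>\<^sub>m U" using U \<open>V \<in>\<^sub>m hartogs (\<in>\<^sub>m) V\<close> by blast
    then show False using V(2) le_not_mem[OF OU V(1)] by blast
  qed
  then obtain t a where ta: "T t a" "L \<preceq> a" by blast
  then obtain S g where S: "\<forall>x. x \<in>\<^sub>m S \<longleftrightarrow> x \<in>\<^sub>m t \<and> ?C x" "iso S (\<in>\<^sub>m) a g" "Ord a" unfolding T_def by blast
  have b: "bij g S a" by (rule iso_bij[OF S(2)]) (use S(1) CO Ord_linear in blast)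
  obtain k where k: "\<And>y. y \<in>\<^sub>m a \<Longrightarrow> app k y \<in>\<^sub>m S" "\<And>y. y \<in>\<^sub>m a \<Longrightarrow> app g (app k y) = y"
    using inverse_ex[OF bij_onto[OF b] bij_inj[OF b]] by blast
  have La: "x \<in>\<^sub>m a" if "x \<in>\<^sub>m L" for x using mem_le_trans[OF S(3) that ta(2)] .
  show ?thesis
  proof (rule that[of k])
    show "?C (app k x)" if "x \<in>\<^sub>m L" for x using S(1) k(1)[OF La[OF that]] by blast
    show "app k x \<in>\<^sub>m app k y" if xy: "y \<in>\<^sub>m L" "x \<in>\<^sub>m y" for x y
    proof -
      have x: "x \<in>\<^sub>m L" using Ord_trans[OF L xy(2,1)] .
      have "app g (app k x) \<in>\<^sub>m app g (app k y)" using k(2)[OF La[OF x]] k(2)[OF La[OF xy(1)]] xy(2) by simp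
      then show ?thesis using iso_less[OF S(2) k(1)[OF La[OF x]] k(1)[OF La[OF xy(1)]]] by blast
    qed
  qed
qed

text \<open>Arguments sharing a second coordinate differ in the first, so each such fibre injects
  into \<open>Q\<close> and has its positions below \<open>hartogs Q\<close>, hence in
  \<open>k\<close>. Second coordinate and position together would inject \<open>k'\<close> into
  \<open>prod k k\<close> and thus into \<open>k\<close>. \<open>Q\<close> itself is never
  well-ordered.\<close>

lemma not_injects_prod_Card:
  assumes k: "Ord k" "omega \<preceq> k" and Q: "hartogs (\<in>\<^sub>m) Q \<preceq> k" and k': "Card k'" "k \<in>\<^sub>m k'"
  shows "\<not> injects k' (prod Q k)"
proof
  assume "injects k' (prod Q k)"
  then obtain f where f: "\<And>x. x \<in>\<^sub>m k' \<Longrightarrow> app f x \<in>\<^sub>m prod Q k"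
    "\<And>x y. x \<in>\<^sub>m k' \<Longrightarrow> y \<in>\<^sub>m k' \<Longrightarrow> app f x = app f y \<Longrightarrow> x = y" by (rule injectsE) blast
  have Ok': "Ord k'" using k'(1) unfolding Card_iff by blast
  let ?t = "\<lambda>x. psnd (app f x)"
  let ?F = "\<lambda>S y. \<forall>x. x \<in>\<^sub>m S \<longleftrightarrow> x \<in>\<^sub>m y \<and> ?t x = ?t y"
  \<comment> \<open>\<open>z\<close> is the position of \<open>y\<close> in its fibre: the order
    type of the earlier arguments with the same second coordinate.\<close>
  define P where "P y z \<longleftrightarrow> Ord z \<and> (\<exists>S g. ?F S y \<and> iso S (\<in>\<^sub>m) z g)" for y z
  have SO: "Ord x" if "y \<in>\<^sub>m k'" "?F S y" "x \<in>\<^sub>m S" for x y S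
    using that Ord_mem[OF Ord_mem[OF Ok']] by blast
  have exP: "\<exists>z. P y z" if y: "y \<in>\<^sub>m k'" for y
  proof -
    have "definable (\<lambda>e. ?t (ehd e) = ?t y)" by (intro definable_intros)
    from Sep[OF this, of y] obtain S where S: "?F S y" by blast
    obtain a g where "Ord a" "iso S (\<in>\<^sub>m) a g" using order_type_ordinals[OF SO[OF y S]] by metis
    then show ?thesis unfolding P_def using S by blast
  qed
  have uP: "z = z'" if z: "P y z" "P y z'" for y z z'
  proof -
    obtain S g S' g' where S: "?F S y" "iso S (\<in>\<^sub>m) z g" "Ord z" "?F S' y" "iso S' (\<in>\<^sub>m) z' g'" "Ord z'"
      using z unfolding P_def by blast
    have "S = S'" by (rule ext_eq) (use S(1,4) in blast)
    then show ?thesis using iso_unique[OF S(2) _ S(3,6)] S(5) by blast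
  qed
  have P_less: "z \<in>\<^sub>m z'" if y: "y' \<in>\<^sub>m k'" "y \<in>\<^sub>m y'" "?t y = ?t y'" and z: "P y z" "P y' z'" for y y' z z'
  proof -
    obtain S g S' g' where S: "?F S y" "iso S (\<in>\<^sub>m) z g" "Ord z" "?F S' y'" "iso S' (\<in>\<^sub>m) z' g'" "Ord z'"
      using z unfolding P_def by blast
    have yS: "y \<in>\<^sub>m S'" using S(4) y by blast
    have "x \<in>\<^sub>m S \<longleftrightarrow> x \<in>\<^sub>m S' \<and> x \<in>\<^sub>m y" for x
      using S(1,4) y(3) Ord_trans[OF Ord_mem[OF Ok' y(1)] _ y(2), of x] by auto
    then have i: "iso S (\<in>\<^sub>m) (app g' y) g'" "app g' y \<in>\<^sub>m z'"
      using iso_segment[OF S(5,6) yS] by blast+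
    have "z = app g' y" using iso_unique[OF S(2) i(1) S(3) Ord_mem[OF S(6) i(2)]] .
    then show ?thesis using i(2) by simp
  qed
  have P_small: "z \<in>\<^sub>m k" if y: "y \<in>\<^sub>m k'" and z: "P y z" for y z
  proof -
    obtain S g where S: "?F S y" "iso S (\<in>\<^sub>m) z g" "Ord z" using z unfolding P_def by blast
    have b: "bij g S z" by (rule iso_bij[OF S(2)]) (use SO[OF y S(1)] Ord_linear in blast)
    have Sk: "x \<in>\<^sub>m k'" if "x \<in>\<^sub>m S" for x using S(1) that Ord_trans[OF Ok' _ y] by blast
    have "injects S Q"
    proof (rule injects_term)
      show "definable_term (\<lambda>e. pfst (app f (ehd e)))" by (intro definable_intros)
      show "pfst (app f x) \<in>\<^sub>m Q" if "x \<in>\<^sub>m S" for x using prod_mem_cases(1)[OF f(1)[OF Sk[OF that]]] .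
      show "x = x'" if x: "x \<in>\<^sub>m S" "x' \<in>\<^sub>m S" "pfst (app f x) = pfst (app f x')" for x x'
      proof (rule f(2)[OF Sk[OF x(1)] Sk[OF x(2)]])
        have "?t x = ?t x'" using S(1) x(1,2) by metis
        then show "app f x = app f x'"
          using prod_mem_cases(3)[OF f(1)[OF Sk[OF x(1)]]] prod_mem_cases(3)[OF f(1)[OF Sk[OF x(2)]]] x(3) by simp
      qed
    qed
    then have "injects z Q" using injects_trans[OF bij_injects'[OF b]] by blast
    then have "z \<in>\<^sub>m hartogs (\<in>\<^sub>m) Q" using mem_hartogs_iff[OF S(3)] by blast
    then show ?thesis using mem_le_trans[OF k(1) _ Q] by blast
  qed
  define R where "R y p \<longleftrightarrow> (\<exists>z. P y z \<and> p = pr (?t y) z)" for y p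
  have "injects k' (prod k k)"
  proof (rule injects_rel)
    show "definable (\<lambda>e. R (ehd (etl e)) (ehd e))" unfolding R_def P_def by (intro definable_intros)
    show "\<exists>!p. R y p" if "y \<in>\<^sub>m k'" for y using exP[OF that] uP unfolding R_def by blast
    show "p \<in>\<^sub>m prod k k" if y: "y \<in>\<^sub>m k'" and r: "R y p" for y p
      using r P_small[OF y] prod_mem_cases(2)[OF f(1)[OF y]] unfolding R_def by auto
    show "y = y'" if y: "y \<in>\<^sub>m k'" "y' \<in>\<^sub>m k'" and r: "R y p" "R y' p" for y y' p
    proof -
      obtain z where z: "P y z" "P y' z" "?t y = ?t y'" using r unfolding R_def by auto
      show ?thesis
        using Ord_linear[OF Ord_mem[OF Ok' y(1)] Ord_mem[OF Ok' y(2)]] P_less[OF y(2) _ z(3,1,2)]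
          P_less[OF y(1) _ z(3)[symmetric] z(2,1)] mem_irrefl by blast
    qed
  qed
  then have "injects k' k" using injects_trans injects_prod_infinite[OF k] by blast
  then show False using k' unfolding Card_iff by blast
qed

text \<open>The length is minimised over all families at once, so every proper restriction of the
  resulting \<open>A\<close> has a choice function. The length is closed under \<open>suc\<close>,
  because a choice function below \<open>a\<close> extends to \<open>a\<close> by picking one
  element.\<close>

lemma minimal_choiceless_family:
  assumes "\<not> AC_WO (\<in>\<^sub>m)"
  obtains L A where "Ord L" "\<And>i. i \<in>\<^sub>m L \<Longrightarrow> \<exists>z. z \<in>\<^sub>m app A i"
    "\<not> (\<exists>c. \<forall>i. i \<in>\<^sub>m L \<longrightarrow> app c i \<in>\<^sub>m app A i)"
    "\<And>a. a \<in>\<^sub>m L \<Longrightarrow> \<exists>c. \<forall>i. i \<in>\<^sub>m a \<longrightarrow> app c i \<in>\<^sub>m app A i"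
    "\<And>a. a \<in>\<^sub>m L \<Longrightarrow> suc a \<in>\<^sub>m L"
proof -
  define N where "N A a \<longleftrightarrow> (\<forall>i. i \<in>\<^sub>m a \<longrightarrow> (\<exists>z. z \<in>\<^sub>m app A i)) \<and>
    \<not> (\<exists>c. \<forall>i. i \<in>\<^sub>m a \<longrightarrow> app c i \<in>\<^sub>m app A i)" for A a
  obtain F where F: "well_orderable (\<in>\<^sub>m) F" "\<And>x. x \<in>\<^sub>m F \<Longrightarrow> nonempty (\<in>\<^sub>m) x"
    "\<And>c B. is_function (\<in>\<^sub>m) c F B \<Longrightarrow> \<not> (\<forall>x y. x \<in>\<^sub>m F \<and> related (\<in>\<^sub>m) c x y \<longrightarrow> y \<in>\<^sub>m x)"
    using assms unfolding AC_WO_def by blast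
  obtain r where r: "well_orders (\<in>\<^sub>m) (related (\<in>\<^sub>m) r) F" using F(1) unfolding well_orderable_def by blast
  have "definable (\<lambda>e. related (\<in>\<^sub>m) r (ehd (etl e)) (ehd e))" unfolding related_iff by (intro definable_intros)
  from order_type_ex[OF this r] obtain a g where a: "Ord a" "iso F (related (\<in>\<^sub>m) r) a g" by blast
  have lin: "related (\<in>\<^sub>m) r x y \<or> x = y \<or> related (\<in>\<^sub>m) r y x" if "x \<in>\<^sub>m F" "y \<in>\<^sub>m F" for x y
    using r that unfolding well_orders_def by (elim conjE) blast
  have b: "bij g F a" using iso_bij[OF a(2) lin] .
  obtain A where A: "\<And>i. i \<in>\<^sub>m a \<Longrightarrow> app A i \<in>\<^sub>m F" "\<And>i. i \<in>\<^sub>m a \<Longrightarrow> app g (app A i) = i"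
    using inverse_ex[OF bij_onto[OF b] bij_inj[OF b]] by blast
  have "N A a" unfolding N_def
  proof (intro conjI allI impI notI)
    show "\<exists>z. z \<in>\<^sub>m app A i" if "i \<in>\<^sub>m a" for i using F(2)[OF A(1)[OF that]] unfolding nonempty_def .
    assume "\<exists>c. \<forall>i. i \<in>\<^sub>m a \<longrightarrow> app c i \<in>\<^sub>m app A i"
    then obtain c where c: "\<And>i. i \<in>\<^sub>m a \<Longrightarrow> app c i \<in>\<^sub>m app A i" by blast
    have "definable_term (\<lambda>e. app c (app g (ehd e)))" by (intro definable_intros)
    from fun_ex_term[OF this, of F] obtain h where h: "\<And>x. x \<in>\<^sub>m F \<Longrightarrow> app h x = app c (app g x)" by blast
    have hx: "app h x \<in>\<^sub>m x" if x: "x \<in>\<^sub>m F" for x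
    proof -
      have gx: "app g x \<in>\<^sub>m a" using bij_mem[OF b x] .
      have "app A (app g x) = x" by (rule bij_inj[OF b A(1)[OF gx] x A(2)[OF gx]])
      then show ?thesis using c[OF gx] h[OF x] by simp
    qed
    \<comment> \<open>\<open>AC_WO\<close> asks for a function graph into some set; the range of
      \<open>h\<close> serves as that set.\<close>
    obtain B where B: "\<And>y. y \<in>\<^sub>m B \<longleftrightarrow> (\<exists>x. x \<in>\<^sub>m F \<and> y = app h x)" using image_ex by metis
    have "\<And>x. x \<in>\<^sub>m F \<Longrightarrow> app h x \<in>\<^sub>m B" using B by blast
    then obtain f where f: "is_function (\<in>\<^sub>m) f F B" "\<And>x y. related (\<in>\<^sub>m) f x y \<longleftrightarrow> x \<in>\<^sub>m F \<and> y = app h x"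
      using is_function_of_app by metis
    then show False using F(3)[OF f(1)] hx by (simp add: f(2))
  qed
  then have ex: "\<exists>A. N A a" by blast
  have d: "definable (\<lambda>e. \<exists>A. N A (ehd e))" unfolding N_def by (intro definable_intros)
  obtain L where L: "Ord L" "\<exists>A. N A L" "\<And>z. z \<in>\<^sub>m L \<Longrightarrow> \<not> (\<exists>A. N A z)" using Ord_least[OF d a(1) ex] by blast
  then obtain A where NA: "N A L" by blast
  then have ne: "\<And>i. i \<in>\<^sub>m L \<Longrightarrow> \<exists>z. z \<in>\<^sub>m app A i" and no: "\<not> (\<exists>c. \<forall>i. i \<in>\<^sub>m L \<longrightarrow> app c i \<in>\<^sub>m app A i)"
    unfolding N_def by blast+
  have part: "\<exists>c. \<forall>i. i \<in>\<^sub>m a \<longrightarrow> app c i \<in>\<^sub>m app A i" if a: "a \<in>\<^sub>m L" for a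
  proof -
    have "\<not> N A a" using L(3)[OF a] by blast
    moreover have "\<And>i. i \<in>\<^sub>m a \<Longrightarrow> \<exists>z. z \<in>\<^sub>m app A i" using ne Ord_trans[OF L(1) _ a] by blast
    ultimately show ?thesis unfolding N_def by blast
  qed
  have "suc a \<in>\<^sub>m L" if a: "a \<in>\<^sub>m L" for a
  proof (rule ccontr)
    assume "\<not> suc a \<in>\<^sub>m L"
    then have le: "L \<preceq> suc a" using le_not_mem[OF L(1) Ord_suc[OF Ord_mem[OF L(1) a]]] by blast
    have mem: "i \<in>\<^sub>m a \<or> i = a" if "i \<in>\<^sub>m L" for i
      using mem_le_trans[OF Ord_suc[OF Ord_mem[OF L(1) a]] that le] by simp
    obtain c where c: "\<And>i. i \<in>\<^sub>m a \<Longrightarrow> app c i \<in>\<^sub>m app A i" using part[OF a] by blast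
    obtain z where z: "z \<in>\<^sub>m app A a" using ne[OF a] by blast
    define R where "R i y \<longleftrightarrow> (i = a \<and> y = z) \<or> (i \<noteq> a \<and> y = app c i)" for i y
    have dR: "definable (\<lambda>e. R (ehd (etl e)) (ehd e))" unfolding R_def by (intro definable_intros)
    have "\<exists>!y. R i y" for i unfolding R_def by auto
    from fun_ex[OF dR this, of L] obtain h where h: "\<And>i. i \<in>\<^sub>m L \<Longrightarrow> R i (app h i)" by blast
    have "app h i \<in>\<^sub>m app A i" if "i \<in>\<^sub>m L" for i
      using h[OF that] mem[OF that] c[of i] z unfolding R_def by auto
    then show False using no by blast
  qed
  then show ?thesis using that L(1) ne no part by blast
qed

text \<open>
  \<open>M\<close> is the supremum of the cardinals \<open>k a\<close> for \<open>a \<in> L\<close>, and \<open>X\<close> consists of the triples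
  \<open>((a, p), \<xi>)\<close> where \<open>p\<close> is a choice function for the restriction of \<open>A\<close> to \<open>a\<close> and \<open>\<xi> \<in> k a\<close>.
\<close>

theorem limit_hartogs_of_not_AC_WO:
  assumes nAC: "\<not> AC_WO (\<in>\<^sub>m)" and K: "Ord K"
  obtains X M where "hartogs (\<in>\<^sub>m) X = M" "K \<in>\<^sub>m M" "omega \<in>\<^sub>m M" "surjects X M"
    "\<And>c. c \<in>\<^sub>m M \<Longrightarrow> \<exists>d. d \<in>\<^sub>m M \<and> Card d \<and> c \<in>\<^sub>m d"
    "\<exists>D. D \<in>\<^sub>m M \<and> cofinal D M"
proof -
  obtain L A where L: "Ord L" and ne: "\<And>i. i \<in>\<^sub>m L \<Longrightarrow> \<exists>z. z \<in>\<^sub>m app A i"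
    and no: "\<not> (\<exists>c. \<forall>i. i \<in>\<^sub>m L \<longrightarrow> app c i \<in>\<^sub>m app A i)"
    and part: "\<And>a. a \<in>\<^sub>m L \<Longrightarrow> \<exists>c. \<forall>i. i \<in>\<^sub>m a \<longrightarrow> app c i \<in>\<^sub>m app A i"
    and lim: "\<And>a. a \<in>\<^sub>m L \<Longrightarrow> suc a \<in>\<^sub>m L"
    by (rule minimal_choiceless_family[OF nAC]) blast
  obtain i0 where i0: "i0 \<in>\<^sub>m L" using no by blast
  obtain I where I: "\<And>y. y \<in>\<^sub>m I \<longleftrightarrow> (\<exists>i. i \<in>\<^sub>m L \<and> y = app A i)" using image_ex by metis
  obtain U where U: "\<And>z. z \<in>\<^sub>m U \<longleftrightarrow> (\<exists>y. y \<in>\<^sub>m I \<and> z \<in>\<^sub>m y)" using union by metis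
  have AU: "z \<in>\<^sub>m U" if "i \<in>\<^sub>m L" "z \<in>\<^sub>m app A i" for i z using that U I by blast
  \<comment> \<open>Choice functions are sought among subsets of \<open>prod L U\<close>, which
    makes them a set.\<close>
  obtain Z where Z: "\<And>y. y \<in>\<^sub>m Z \<longleftrightarrow> (\<forall>z. z \<in>\<^sub>m y \<longrightarrow> z \<in>\<^sub>m prod L U)" using power_set by metis
  define ch where "ch a p \<longleftrightarrow> (\<forall>i. i \<in>\<^sub>m a \<longrightarrow> app p i \<in>\<^sub>m app A i)" for a p
  have part': "\<exists>p. p \<in>\<^sub>m Z \<and> ch a p" if a: "a \<in>\<^sub>m L" for a
  proof -
    obtain c where c: "\<And>i. i \<in>\<^sub>m a \<Longrightarrow> app c i \<in>\<^sub>m app A i" using part[OF a] by blast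
    have aL: "i \<in>\<^sub>m L" if "i \<in>\<^sub>m a" for i using Ord_trans[OF L that a] .
    have "\<And>i. i \<in>\<^sub>m a \<Longrightarrow> app c i \<in>\<^sub>m U" using AU[OF aL] c by blast
    then obtain p where p: "is_function (\<in>\<^sub>m) p a U" "\<And>i. i \<in>\<^sub>m a \<Longrightarrow> app p i = app c i"
      using is_function_of_app by metis
    have "z \<in>\<^sub>m prod L U" if "z \<in>\<^sub>m p" for z
      using p(1) that aL unfolding is_function_def is_opair_iff mem_prod by blast
    then have "p \<in>\<^sub>m Z" unfolding Z by blast
    moreover have "ch a p" unfolding ch_def using p(2) c by simp
    ultimately show ?thesis by blast
  qed
  let ?Q = "prod L Z"
  \<comment> \<open>\<open>B\<close> dominates \<open>K\<close>, \<open>omega\<close>,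
    \<open>L\<close> and the Hartogs number of \<open>?Q\<close>: \<open>L\<close> for singularity,
    \<open>omega\<close> and the Hartogs number for \<open>not_injects_prod_Card\<close>.\<close>
  obtain B1 where B1: "Ord B1" "K \<preceq> B1" "omega \<preceq> B1" using Ord_max[OF K Ord_omega] .
  obtain B2 where B2: "Ord B2" "L \<preceq> B2" "hartogs (\<in>\<^sub>m) ?Q \<preceq> B2" using Ord_max[OF L Ord_hartogs] .
  obtain B where B: "Ord B" "B1 \<preceq> B" "B2 \<preceq> B" using Ord_max[OF B1(1) B2(1)] .
  note leB = le_trans[OF B(1) B1(2) B(2)] le_trans[OF B(1) B1(3) B(2)] le_trans[OF B(1) B2(2) B(3)]
    le_trans[OF B(1) B2(3) B(3)]
  obtain k where k: "\<And>a. a \<in>\<^sub>m L \<Longrightarrow> Card (app k a) \<and> B \<in>\<^sub>m app k a"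
    "\<And>a b. b \<in>\<^sub>m L \<Longrightarrow> a \<in>\<^sub>m b \<Longrightarrow> app k a \<in>\<^sub>m app k b" using increasing_Cards[OF L B(1)] by blast
  have kO: "Ord (app k a)" if "a \<in>\<^sub>m L" for a using k(1)[OF that] unfolding Card_iff by blast
  have Bk: "x \<in>\<^sub>m app k a" if "a \<in>\<^sub>m L" "x \<preceq> B" for a x using le_mem_trans[OF kO[OF that(1)] that(2)] k(1)[OF that(1)] by blast
  obtain J where J: "\<And>y. y \<in>\<^sub>m J \<longleftrightarrow> (\<exists>a. a \<in>\<^sub>m L \<and> y = app k a)" using image_ex by metis
  obtain M where M: "\<forall>z. z \<in>\<^sub>m M \<longleftrightarrow> (\<exists>y. y \<in>\<^sub>m J \<and> z \<in>\<^sub>m y)" using union by blast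
  have M': "z \<in>\<^sub>m M \<longleftrightarrow> (\<exists>a. a \<in>\<^sub>m L \<and> z \<in>\<^sub>m app k a)" for z using M J by auto
  have OM: "Ord M" by (rule Ord_Union[OF M]) (use J kO in auto)
  \<comment> \<open>\<open>L\<close> is closed under \<open>suc\<close>, so \<open>app k a\<close>
    is exceeded by the next cardinal of the sequence.\<close>
  have kM: "app k a \<in>\<^sub>m M" if a: "a \<in>\<^sub>m L" for a
    unfolding M' using lim[OF a] k(2)[OF lim[OF a], of a] by auto
  define E where "E z \<longleftrightarrow> psnd z \<in>\<^sub>m app k (pfst (pfst z)) \<and> ch (pfst (pfst z)) (psnd (pfst z))" for z
  have "definable (\<lambda>e. E (ehd e))" unfolding E_def ch_def by (intro definable_intros)
  from Sep[OF this, of "prod ?Q M"] obtain X where X: "\<And>z. z \<in>\<^sub>m X \<longleftrightarrow> z \<in>\<^sub>m prod ?Q M \<and> E z" by blast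
  have XI: "pr (pr a p) x \<in>\<^sub>m X" if "a \<in>\<^sub>m L" "p \<in>\<^sub>m Z" "ch a p" "x \<in>\<^sub>m app k a" for a p x
    unfolding X E_def using that M' by auto
  have notles: "\<not> injects M X"
  proof
    assume "injects M X"
    then obtain f where f: "\<And>x. x \<in>\<^sub>m M \<Longrightarrow> app f x \<in>\<^sub>m X"
      "\<And>x y. x \<in>\<^sub>m M \<Longrightarrow> y \<in>\<^sub>m M \<Longrightarrow> app f x = app f y \<Longrightarrow> x = y" by (rule injectsE) blast
    let ?i = "\<lambda>x. pfst (pfst (app f x))"
    have fX: "app f x \<in>\<^sub>m prod ?Q M" "E (app f x)" if "x \<in>\<^sub>m M" for x using f(1)[OF that] X by blast+
    have iL: "?i x \<in>\<^sub>m L" if "x \<in>\<^sub>m M" for x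
      using prod_mem_cases(1)[OF prod_mem_cases(1)[OF fX(1)[OF that]]] .
    show False
    proof (cases "\<forall>a. a \<in>\<^sub>m L \<longrightarrow> (\<exists>x. x \<in>\<^sub>m M \<and> a \<in>\<^sub>m ?i x)")
      case True
      \<comment> \<open>Unbounded case: the least \<open>x\<close> whose summand has an index beyond
        \<open>a\<close> supplies a partial choice function that covers \<open>a\<close>.\<close>
      define R where "R a y \<longleftrightarrow> (\<exists>x. x \<in>\<^sub>m M \<and> a \<in>\<^sub>m ?i x \<and> (\<forall>x'. x' \<in>\<^sub>m x \<longrightarrow> \<not> a \<in>\<^sub>m ?i x') \<and>
        y = app (psnd (pfst (app f x))) a)" for a y
      have dR: "definable (\<lambda>e. R (ehd (etl e)) (ehd e))" unfolding R_def by (intro definable_intros)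
      have exR: "\<exists>!y. R a y" if a: "a \<in>\<^sub>m L" for a
      proof -
        obtain x0 where x0: "x0 \<in>\<^sub>m M" "a \<in>\<^sub>m ?i x0" using True a by blast
        have d: "definable (\<lambda>e. ehd e \<in>\<^sub>m M \<and> a \<in>\<^sub>m pfst (pfst (app f (ehd e))))" by (intro definable_intros)
        obtain m where m: "m \<in>\<^sub>m M" "a \<in>\<^sub>m ?i m" "\<And>z. z \<in>\<^sub>m m \<Longrightarrow> \<not> (z \<in>\<^sub>m M \<and> a \<in>\<^sub>m ?i z)"
          using Ord_least[OF d Ord_mem[OF OM x0(1)]] x0 by blast
        have *: "x = m" if "x \<in>\<^sub>m M" "a \<in>\<^sub>m ?i x" "\<forall>x'. x' \<in>\<^sub>m x \<longrightarrow> \<not> a \<in>\<^sub>m ?i x'" for x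
          using that m Ord_linear[OF Ord_mem[OF OM] Ord_mem[OF OM], of x m] by blast
        have "R a (app (psnd (pfst (app f m))) a)" unfolding R_def using m Ord_trans[OF OM] by blast
        moreover have "y = app (psnd (pfst (app f m))) a" if "R a y" for y using that * unfolding R_def by blast
        ultimately show ?thesis by blast
      qed
      obtain c where c: "\<And>a. a \<in>\<^sub>m L \<Longrightarrow> R a (app c a)" using fun_ex[OF dR exR, of L] by blast
      have "app c a \<in>\<^sub>m app A a" if a: "a \<in>\<^sub>m L" for a
      proof -
        obtain x where x: "x \<in>\<^sub>m M" "a \<in>\<^sub>m ?i x" "app c a = app (psnd (pfst (app f x))) a"
          using c[OF a] unfolding R_def by blast
        then show ?thesis using fX(2)[OF x(1)] unfolding E_def ch_def by simp
      qed
      then show False using no by blast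
    next
      case False
      then obtain a where a: "a \<in>\<^sub>m L" "\<And>x. x \<in>\<^sub>m M \<Longrightarrow> \<not> a \<in>\<^sub>m ?i x" by blast
      \<comment> \<open>Bounded case: every index met is at most \<open>a\<close>, so the second
        coordinates of the values of \<open>f\<close> stay in \<open>app k a\<close>, even on the
        next larger cardinal.\<close>
      have "injects (app k (suc a)) (prod ?Q (app k a))"
      proof (rule injectsI[of _ f])
        show "app f x \<in>\<^sub>m prod ?Q (app k a)" if "x \<in>\<^sub>m app k (suc a)" for x
        proof -
          have x: "x \<in>\<^sub>m M" unfolding M' using lim[OF a(1)] that by blast
          have "?i x \<preceq> a" using le_not_mem[OF Ord_mem[OF L iL[OF x]] Ord_mem[OF L a(1)]] a(2)[OF x] by blast
          then have "app k (?i x) \<preceq> app k a" using k(2)[OF a(1)] unfolding ord_le_def by auto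
          then have "psnd (app f x) \<in>\<^sub>m app k a"
            using fX(2)[OF x] mem_le_trans[OF kO[OF a(1)]] unfolding E_def by blast
          then have "pr (pfst (app f x)) (psnd (app f x)) \<in>\<^sub>m prod ?Q (app k a)"
            using prod_mem_cases(1)[OF fX(1)[OF x]] by simp
          then show ?thesis using prod_mem_cases(3)[OF fX(1)[OF x]] by simp
        qed
        show "x = y" if xy: "x \<in>\<^sub>m app k (suc a)" "y \<in>\<^sub>m app k (suc a)" "app f x = app f y" for x y
          by (rule f(2)[OF _ _ xy(3)]) (use M' lim[OF a(1)] xy in blast)+
      qed
      moreover have "omega \<preceq> app k a" "hartogs (\<in>\<^sub>m) ?Q \<preceq> app k a"
        using Bk[OF a(1) leB(2)] Bk[OF a(1) leB(4)] unfolding ord_le_def by blast+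
      ultimately show False
        using not_injects_prod_Card[OF kO[OF a(1)]] k(1)[OF lim[OF a(1)]] k(2)[OF lim[OF a(1)], of a] by simp
    qed
  qed
  have inj: "injects b X" if b: "b \<in>\<^sub>m M" for b
  proof -
    obtain a where a: "a \<in>\<^sub>m L" "b \<in>\<^sub>m app k a" using b M' by blast
    obtain p where p: "p \<in>\<^sub>m Z" "ch a p" using part'[OF a(1)] by blast
    show ?thesis
    proof (rule injects_term)
      show "definable_term (\<lambda>e. pr (pr a p) (ehd e))" by (intro definable_intros)
      show "pr (pr a p) x \<in>\<^sub>m X" if "x \<in>\<^sub>m b" for x
        using XI[OF a(1) p] Ord_trans[OF kO[OF a(1)] that a(2)] by blast
    qed simp
  qed
  \<comment> \<open>Projection to the last coordinate is onto because no summand is empty: each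
    proper restriction of \<open>A\<close> has a choice function.\<close>
  have "surjects X M"
  proof -
    have "definable_term (\<lambda>e. psnd (ehd e))" by (intro definable_intros)
    from fun_ex_term[OF this, of X] obtain g where g: "\<And>x. x \<in>\<^sub>m X \<Longrightarrow> app g x = psnd x" by blast
    have "\<exists>x. x \<in>\<^sub>m X \<and> app g x = y" if y: "y \<in>\<^sub>m M" for y
    proof -
      obtain a where a: "a \<in>\<^sub>m L" "y \<in>\<^sub>m app k a" using y M' by blast
      obtain p where p: "p \<in>\<^sub>m Z" "ch a p" using part'[OF a(1)] by blast
      show ?thesis using XI[OF a(1) p a(2)] g[OF XI[OF a(1) p a(2)]] by auto
    qed
    moreover have "app g x \<in>\<^sub>m M" if "x \<in>\<^sub>m X" for x
      using g[OF that] prod_mem_cases(2)[of x ?Q M] X that by simp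
    ultimately show ?thesis unfolding surjects_def by blast
  qed
  moreover have "hartogs (\<in>\<^sub>m) X = M" using hartogs_eqI[OF OM notles inj] .
  moreover have "K \<in>\<^sub>m M" "omega \<in>\<^sub>m M" "L \<in>\<^sub>m M"
    unfolding M' using Bk[OF i0 leB(1)] Bk[OF i0 leB(2)] Bk[OF i0 leB(3)] i0 by blast+
  moreover have "\<exists>d. d \<in>\<^sub>m M \<and> Card d \<and> c \<in>\<^sub>m d" if "c \<in>\<^sub>m M" for c
    using that[unfolded M'] kM k(1) by blast
  moreover have "cofinal L M" unfolding cofinal_def
    by (rule exI[of _ k]) (use kM M' in \<open>auto simp: ord_le_def\<close>)
  ultimately show ?thesis using that by blast
qed

end

text \<open>The implications proved are (1) to (2) to (3) to (4), (5) to (4), (6) to (4), and from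
  (4) to (1), (5) and (6). A failure of (4) is played against (3), (5) and (6) through
  \<open>limit_hartogs_of_not_AC_WO\<close>.\<close>

theorem theorem3p4:
  fixes mem :: "'a \<Rightarrow> 'a \<Rightarrow> bool"
  assumes "ZF_model mem"
  shows
    "let P1 = (\<forall>X. hartogs mem X = lindenbaum mem X);
         P2 = (\<exists>\<kappa>. cardinal mem \<kappa> \<and>
                (\<forall>X. ord_le mem \<kappa> (lindenbaum mem X) \<longrightarrow> hartogs mem X = lindenbaum mem X));
         P3 = (\<exists>\<kappa>. cardinal mem \<kappa> \<and>
                (\<forall>X. ord_le mem \<kappa> (hartogs mem X) \<longrightarrow> hartogs mem X = lindenbaum mem X));
         P4 = AC_WO mem;
         P5 = (\<forall>X. successor_cardinal mem (hartogs mem X));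
         P6 = (\<forall>X. infinite_set mem X \<longrightarrow> regular_cardinal mem (hartogs mem X))
     in (P1 \<longleftrightarrow> P2) \<and> (P2 \<longleftrightarrow> P3) \<and> (P3 \<longleftrightarrow> P4) \<and> (P4 \<longleftrightarrow> P5) \<and> (P5 \<longleftrightarrow> P6)"
proof -
  interpret ZF_model mem by fact
  let ?P1 = "\<forall>X. hartogs mem X = lindenbaum mem X"
  let ?P2 = "\<exists>\<kappa>. cardinal mem \<kappa> \<and>
                (\<forall>X. ord_le mem \<kappa> (lindenbaum mem X) \<longrightarrow> hartogs mem X = lindenbaum mem X)"
  let ?P3 = "\<exists>\<kappa>. cardinal mem \<kappa> \<and>
                (\<forall>X. ord_le mem \<kappa> (hartogs mem X) \<longrightarrow> hartogs mem X = lindenbaum mem X)"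
  let ?P5 = "\<forall>X. successor_cardinal mem (hartogs mem X)"
  let ?P6 = "\<forall>X. infinite_set mem X \<longrightarrow> regular_cardinal mem (hartogs mem X)"
  \<comment> \<open>Any cardinal is a threshold here; a Hartogs number shows that there is
    one.\<close>
  have 12: "?P2" if ?P1 using that Card_hartogs by blast
  have 23: "?P3" if ?P2
  proof -
    obtain \<kappa> where \<kappa>: "cardinal mem \<kappa>" "\<And>X. ord_le mem \<kappa> (lindenbaum mem X) \<Longrightarrow> hartogs mem X = lindenbaum mem X"
      using \<open>?P2\<close> by blast
    \<comment> \<open>The threshold is kept: a Hartogs number at or above it forces the Lindenbaum
      number above it too.\<close>
    then show ?thesis using le_trans[OF Ord_lindenbaum _ hartogs_le_lindenbaum] by blast
  qed
  have 34: "AC_WO mem" if ?P3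
  proof (rule ccontr)
    assume nAC: "\<not> AC_WO mem"
    obtain \<kappa> where \<kappa>: "cardinal mem \<kappa>" "\<And>X. ord_le mem \<kappa> (hartogs mem X) \<Longrightarrow> hartogs mem X = lindenbaum mem X"
      using \<open>?P3\<close> by blast
    have "ordinal mem \<kappa>" using \<kappa>(1) unfolding Card_iff by blast
    \<comment> \<open>Building the example above the threshold brings its Hartogs number within the
      scope of (3), while \<open>X\<close> still maps onto that number.\<close>
    then obtain X where X: "mem \<kappa> (hartogs mem X)" "surjects X (hartogs mem X)"
      using limit_hartogs_of_not_AC_WO[OF nAC] by metis
    then have "hartogs mem X = lindenbaum mem X" using \<kappa>(2) unfolding ord_le_def by blast
    then show False using X(2) lindenbaum_not_surjects by metis
  qed
  have 54: "AC_WO mem" if ?P5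
  proof (rule ccontr)
    assume nAC: "\<not> AC_WO mem"
    obtain X where X: "\<And>c. mem c (hartogs mem X) \<Longrightarrow> \<exists>d. mem d (hartogs mem X) \<and> cardinal mem d \<and> mem c d"
      using limit_hartogs_of_not_AC_WO[OF nAC Ord_emp] by metis
    obtain c where c: "cardinal mem c" "hartogs mem X = least_ordinal mem (\<lambda>\<alpha>. cardinal mem \<alpha> \<and> mem c \<alpha>)"
      using \<open>?P5\<close> unfolding successor_cardinal_def by blast
    have d: "definable (\<lambda>e. cardinal mem (ehd e) \<and> mem c (ehd e))" by (intro definable_intros)
    have "ordinal mem c" using c(1) unfolding Card_iff by blast
    then have h: "cardinal mem (hartogs mem c) \<and> mem c (hartogs mem c)" using Card_hartogs self_mem_hartogs by blast
    note least = least_ordinal_props[OF d Ord_hartogs h, folded c(2)]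
    \<comment> \<open>A cardinal \<open>d\<close> strictly between \<open>c\<close> and the Hartogs
      number contradicts that number being the successor of \<open>c\<close>.\<close>
    show False using X[of c] least(2,3) by blast
  qed
  have 64: "AC_WO mem" if ?P6
  proof (rule ccontr)
    assume nAC: "\<not> AC_WO mem"
    obtain X D where X: "mem omega (hartogs mem X)" "mem D (hartogs mem X)" "cofinal D (hartogs mem X)"
      using limit_hartogs_of_not_AC_WO[OF nAC Ord_emp] by metis
    \<comment> \<open>(6) speaks of infinite sets only; \<open>omega\<close> below the Hartogs
      number gives \<open>X\<close> a copy of \<open>omega\<close>.\<close>
    have "infinite_set mem X" using infinite_set_of_injects mem_hartogs_injects[OF X(1)] by blast
    then have c: "cofinality mem (hartogs mem X) = hartogs mem X"
      using \<open>?P6\<close> unfolding regular_cardinal_def by blast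
    have d: "definable (\<lambda>e. cofinal (ehd e) (hartogs mem X))" by (intro definable_intros)
    show False
      using least_ordinal_props(3)[OF d Ord_hartogs cofinal_refl, folded cofinality_eq, unfolded c] X(2,3) by blast
  qed
  have 4: ?P1 ?P5 ?P6 if "AC_WO mem"
    using that hartogs_eq_lindenbaum_of_AC_WO successor_hartogs_of_AC_WO regular_hartogs_of_AC_WO by blast+
  show ?thesis unfolding Let_def using 12 23 34 54 64 4 by argo
qed

end
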